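(* Let $\varphi_0,\varphi\in L^2(\mathbb{R}^2)$ satisfy the window assumptions (i)–(iii) of the context, with covering constants $0<A\le B<\infty$, and let $\Lambda\subseteq\mathbb{R}^2$ be a lattice with dual lattice $\Gamma$. Define $$\Delta(\Lambda) := \sum_{\gamma \in \Gamma \setminus \{0\}} \max\{\Theta(\gamma),\Theta(-\gamma)\},$$ where $\Theta$ is the time-scale correlation function defined in the context. If $\Delta(\Lambda)<A$, then the set of wavepackets $$\mathcal{C}_\Lambda=\{\varphi_{0,\lambda}:\lambda\in\Lambda\}\cup\{\varphi_{j,k,\lambda}:\lambda\in\Lambda,\ j\ge 1,\ 0\le k\le 2^j-1\}$$ is a frame of $L^2(\mathbb{R}^2)$ with frame bounds $|\Lambda|^{-1}(A-\Delta(\Lambda))$ (lower) and $|\Lambda|^{-1}(B+\Delta(\Lambda))$ (upper).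
   Context: Notation. $|x|$ is the Euclidean norm on $\mathbb{R}^2$. The Fourier transform is $\widehat f(\xi)=\int_{\mathbb{R}^2} f(x)e^{-2\pi i \xi\cdot x}\,dx$ (extended to $L^2$). Let $$D_j=\begin{bmatrix}4^j&0\\0&2^j\end{bmatrix},\quad R_\theta=\begin{bmatrix}\cos\theta&-\sin\theta\\ \sin\theta&\cos\theta\end{bmatrix},\quad A_{j,k}=D_jR_{2k\pi/2^j},\quad B_{j,k}=(A_{j,k}^* )^{-1}=D_j^{-1}R_{2k\pi/2^j}.$$ A lattice is a set $\Lambda=P\mathbb{Z}^2$ with $P\in\mathbb{R}^{2\times2}$ invertible; its volume is $|\Lambda|=|\det P|$ and its dual lattice is $\Gamma=(P^{-1})^*\mathbb{Z}^2$. Window assumptions on $\varphi_0,\varphi\in L^2(\mathbb{R}^2)$: (i) there are constants $0<A\le B<\infty$ with $A\le |\widehat{\varphi_0}(\xi)|^2+\sum_{j\ge1}\sum_{k=0}^{2^j-1}|\widehat{\varphi}(B_{j,k}\xi)|^2\le B$ for (almost) every $\xi\in\mathbb{R}^2$; (ii) $|\widehat{\varphi_0}(\xi)|\lesssim e^{-\delta|\xi|^2}$; (iii) $|\widehat{\varphi}(\xi)|\lesssim \min(1,|\xi_1|^{\varsigma})e^{-\delta|\xi|^2}$, for some $\delta>0$ and $\varsigma>2$. Here $X\lesssim Y$ means $X\le cY$ for a constant $c>0$ (independent of $\xi$). Wavepackets: $\varphi_{0,\lambda}(x)=\varphi_0(x-\lambda)$ and $\varphi_{j,k,\lambda}(x)=8^{j/2}\varphi(A_{j,k}x-\lambda)$.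 Time-scale correlation function: for $\zeta\in\mathbb{R}^2$, $$\Theta(\zeta)=\operatorname*{ess\,sup}_{\xi\in\mathbb{R}^2}\Big(|\widehat{\varphi_0}(\xi)||\widehat{\varphi_0}(\xi-\zeta)|+\sum_{j\ge1}\sum_{k=0}^{2^j-1}|\widehat{\varphi}(B_{j,k}\xi)||\widehat{\varphi}(B_{j,k}\xi-\zeta)|\Big).$$ A family $\{e_i\}$ is a frame of $L^2(\mathbb{R}^2)$ with bounds $a,b>0$ if $a\|f\|_2^2\le\sum_i|\langle f,e_i\rangle|^2\le b\|f\|_2^2$ for all $f\in L^2(\mathbb{R}^2)$. *)

theory Defs
  imports "HOL-Probability.Probability" "HOL-Probability.Essential_Supremum"
begin

text \<open>
  Elements of \<open>L\<^sup>2(\<real>\<^sup>2)\<close> are represented by Borel functions; every class modulo null sets has such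
  a representative.
\<close>

definition L2 :: "(real^2 \<Rightarrow> complex) set" where
  "L2 = {f \<in> borel_measurable lborel. integrable lborel (\<lambda>x. (norm (f x))\<^sup>2)}"

definition L2_norm :: "(real^2 \<Rightarrow> complex) \<Rightarrow> real" where
  "L2_norm f = sqrt (\<integral>x. (norm (f x))\<^sup>2 \<partial>lborel)"

definition L2_inner :: "(real^2 \<Rightarrow> complex) \<Rightarrow> (real^2 \<Rightarrow> complex) \<Rightarrow> complex" where
  "L2_inner f g = (\<integral>x. f x * cnj (g x) \<partial>lborel)"

definition fourier_integral :: "(real^2 \<Rightarrow> complex) \<Rightarrow> real^2 \<Rightarrow> complex" where
  "fourier_integral f \<xi> = (\<integral>x. f x * exp (- 2 * of_real pi * \<i> * of_real (\<xi> \<bullet> x)) \<partial>lborel)"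

text \<open>
  Convergence in \<open>L\<^sup>2\<close> is expressed by the nonnegative integral, because the Bochner integral of a
  function that is not integrable is \<open>0\<close> and would make divergent sequences converge.
\<close>

definition L2_tendsto :: "(nat \<Rightarrow> real^2 \<Rightarrow> complex) \<Rightarrow> (real^2 \<Rightarrow> complex) \<Rightarrow> bool" where
  "L2_tendsto h f \<longleftrightarrow> (\<lambda>n. \<integral>\<^sup>+x. ennreal ((norm (h n x - f x))\<^sup>2) \<partial>lborel) \<longlonglongrightarrow> 0"

text \<open>
  The Fourier transform on \<open>L\<^sup>2\<close> is the continuous extension of the Fourier integral from
  \<open>L\<^sup>1 \<inter> L\<^sup>2\<close>. It is determined up to a null set, and \<open>fourier_L2\<close> picks one version.
\<close>

definition is_fourier_L2 :: "(real^2 \<Rightarrow> complex) \<Rightarrow> (real^2 \<Rightarrow> complex) \<Rightarrow> bool" where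
  "is_fourier_L2 f g \<longleftrightarrow> g \<in> L2 \<and>
     (\<exists>h. (\<forall>n. h n \<in> L2 \<and> integrable lborel (h n)) \<and>
          L2_tendsto h f \<and> L2_tendsto (\<lambda>n. fourier_integral (h n)) g)"

definition fourier_L2 :: "(real^2 \<Rightarrow> complex) \<Rightarrow> real^2 \<Rightarrow> complex" where
  "fourier_L2 f = (SOME g. is_fourier_L2 f g)"

definition dil :: "nat \<Rightarrow> real^2^2" where
  "dil j = vector [vector [4 ^ j, 0], vector [0, 2 ^ j]]"

definition rot :: "real \<Rightarrow> real^2^2" where
  "rot \<theta> = vector [vector [cos \<theta>, - sin \<theta>], vector [sin \<theta>, cos \<theta>]]"

definition A_mat :: "nat \<Rightarrow> nat \<Rightarrow> real^2^2" where
  "A_mat j k = dil j ** rot (2 * real k * pi / 2 ^ j)"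

definition B_mat :: "nat \<Rightarrow> nat \<Rightarrow> real^2^2" where
  "B_mat j k = matrix_inv (transpose (A_mat j k))"

definition lattice_of :: "real^2^2 \<Rightarrow> (real^2) set" where
  "lattice_of P = (\<lambda>z. P *v z) ` {z. \<forall>i. z $ i \<in> \<int>}"

definition dual_lattice_of :: "real^2^2 \<Rightarrow> (real^2) set" where
  "dual_lattice_of P = lattice_of (transpose (matrix_inv P))"

definition covering_sum :: "(real^2 \<Rightarrow> complex) \<Rightarrow> (real^2 \<Rightarrow> complex) \<Rightarrow> real^2 \<Rightarrow> ennreal" where
  "covering_sum \<phi>0 \<phi> \<xi> =
     ennreal ((norm (fourier_L2 \<phi>0 \<xi>))\<^sup>2) +
     (\<Sum>\<^sub>\<infinity>j\<in>{1..}. \<Sum>k<2 ^ j. ennreal ((norm (fourier_L2 \<phi> (B_mat j k *v \<xi>)))\<^sup>2))"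

definition Theta :: "(real^2 \<Rightarrow> complex) \<Rightarrow> (real^2 \<Rightarrow> complex) \<Rightarrow> real^2 \<Rightarrow> ennreal" where
  "Theta \<phi>0 \<phi> \<zeta> = esssup lborel (\<lambda>\<xi>.
     ennreal (norm (fourier_L2 \<phi>0 \<xi>) * norm (fourier_L2 \<phi>0 (\<xi> - \<zeta>))) +
     (\<Sum>\<^sub>\<infinity>j\<in>{1..}. \<Sum>k<2 ^ j.
        ennreal (norm (fourier_L2 \<phi> (B_mat j k *v \<xi>)) * norm (fourier_L2 \<phi> (B_mat j k *v \<xi> - \<zeta>)))))"

definition Delta :: "(real^2 \<Rightarrow> complex) \<Rightarrow> (real^2 \<Rightarrow> complex) \<Rightarrow> (real^2) set \<Rightarrow> ennreal" where
  "Delta \<phi>0 \<phi> \<Gamma> = (\<Sum>\<^sub>\<infinity>\<gamma>\<in>\<Gamma> - {0}. max (Theta \<phi>0 \<phi> \<gamma>) (Theta \<phi>0 \<phi> (- \<gamma>)))"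

text \<open>
  The wavepackets form an indexed family, not a set of functions: distinct indices may give the
  same function (for instance if \<open>\<phi>\<close> is even), and such a function is then counted repeatedly.
  \<open>Inl \<lambda>\<close> indexes \<open>\<phi>\<^bsub>0,\<lambda>\<^esub>\<close> and \<open>Inr (j, k, \<lambda>)\<close> indexes \<open>\<phi>\<^bsub>j,k,\<lambda>\<^esub>\<close>.
\<close>

type_synonym wp_index = "(real^2) + (nat \<times> nat \<times> (real^2))"

definition wavepacket_indices :: "(real^2) set \<Rightarrow> wp_index set" where
  "wavepacket_indices \<Lambda> = \<Lambda> <+> {(j, k, l). 1 \<le> j \<and> k < 2 ^ j \<and> l \<in> \<Lambda>}"

definition wavepacket :: "(real^2 \<Rightarrow> complex) \<Rightarrow> (real^2 \<Rightarrow> complex) \<Rightarrow> wp_index \<Rightarrow> real^2 \<Rightarrow> complex" where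
  "wavepacket \<phi>0 \<phi> i = (case i of
       Inl l \<Rightarrow> (\<lambda>x. \<phi>0 (x - l))
     | Inr (j, k, l) \<Rightarrow> (\<lambda>x. of_real (8 powr (real j / 2)) * \<phi> (A_mat j k *v x - l)))"

definition frame_with_bounds :: "'i set \<Rightarrow> ('i \<Rightarrow> real^2 \<Rightarrow> complex) \<Rightarrow> real \<Rightarrow> real \<Rightarrow> bool" where
  "frame_with_bounds I e a b \<longleftrightarrow> a > 0 \<and> b > 0 \<and> (\<forall>i\<in>I. e i \<in> L2) \<and>
     (\<forall>f\<in>L2. (\<lambda>i. (norm (L2_inner f (e i)))\<^sup>2) summable_on I \<and>
        a * (L2_norm f)\<^sup>2 \<le> (\<Sum>\<^sub>\<infinity>i\<in>I. (norm (L2_inner f (e i)))\<^sup>2) \<and>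
        (\<Sum>\<^sub>\<infinity>i\<in>I. (norm (L2_inner f (e i)))\<^sup>2) \<le> b * (L2_norm f)\<^sup>2)"

end

theory Submission
  imports Defs
begin

text \<open>
  Let \<open>g\<close> and \<open>w\<close> be the Fourier transforms of \<open>f\<close> and of a window \<open>\<psi>\<close>, let \<open>A\<close> be one of the matrices
  \<open>A\<^bsub>j,k\<^esub>\<close>, and \<open>B\<close> the inverse of its transpose. Plancherel's theorem turns the coefficients of \<open>f\<close>
  against the normalized translates \<open>\<psi> (A x - \<lambda>)\<close> into the Fourier coefficients of the periodization
  over \<open>B\<^sup>-\<^sup>1 \<Gamma>\<close> of \<open>H \<xi> = g \<xi> * cnj (w (B \<xi>))\<close>. By Parseval on the torus their square sum is, up to the
  factor \<open>1 / \<bar>det P\<bar>\<close>, the diagonal term \<open>\<integral> \<bar>H \<xi>\<bar>\<^sup>2\<close> with an error of at most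
  \<open>\<Sum>\<gamma>\<noteq>0. \<integral> \<bar>H \<xi>\<bar> \<bar>H (\<xi> + B\<^sup>-\<^sup>1 \<gamma>)\<bar>\<close>. Summed over all scales and angles, the diagonal terms are controlled by
  the covering condition, and splitting the product of the two values of \<open>g\<close> by AM-GM bounds the
  errors by the mean of \<open>\<Theta> \<gamma>\<close> and \<open>\<Theta> (- \<gamma>)\<close>.

  Plancherel's theorem itself follows from Parseval on the torus: the norm of a function supported
  in a cube of side \<open>L\<close> can be read off the samples of its Fourier transform on any translate of
  the lattice \<open>L\<^sup>-\<^sup>1 \<int>\<^sup>2\<close>, and one integrates over the translates.
\<close>

text \<open>All sums over lattice points, scales and angles are handled as
  \<open>ennreal\<close>-valued integrals over counting measures, so Tonelli rearranges them freely.
  For this reason every estimate comes as a pair of inequalities with the error added on either side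
  and never subtracted; real arithmetic returns only once finiteness is known. The obstacle is that
  \<open>H\<close>, a product of two square-integrable functions, is integrable, but neither
  \<open>H\<close> nor its periodization is square integrable a priori. The covering bound and the
  finiteness of \<open>Delta\<close> supply this, so Parseval applies to every \<open>f\<close> in
  \<open>L2\<close> without a density argument. A shift by B^-1 \<gamma> moves the argument of the
  window by exactly \<gamma>, whatever the scale and angle. Errors of all scales therefore share the
  same \<gamma> and sum under the integral to the correlation bounded by \<open>Theta\<close>. Both
  signs of \<gamma> occur because AM-GM leaves the square of \<open>g\<close> at two points, and
  translating the second back to the first reverses \<gamma>. The same lattice estimate serves
  twice: with error zero for Plancherel, with the true error for the frame bounds.\<close>

section \<open>Sums over countable sets as integrals for the counting measure\<close>

text \<open>Finite partial sums clearly stay below the integral. Conversely, an enumeration exhausts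
  the countable set by increasing finite sets, and monotone convergence applies. This opens the sums
  in the definitions to Tonelli's theorem.\<close>

lemma infsum_ennreal_eq_nn_integral:
  fixes f :: "'a \<Rightarrow> ennreal"
  assumes "countable A"
  shows "infsum f A = (\<integral>\<^sup>+x. f x \<partial>count_space A)"
proof (rule antisym)
  have "sum f F \<le> (\<integral>\<^sup>+x. f x \<partial>count_space A)" if F: "finite F" "F \<subseteq> A" for F
  proof -
    have "sum f F = (\<integral>\<^sup>+x. f x * indicator F x \<partial>count_space A)"
      using F by (subst nn_integral_count_space'[of F]) auto
    also have "\<dots> \<le> (\<integral>\<^sup>+x. f x \<partial>count_space A)"
      by (intro nn_integral_mono) (auto simp: indicator_def)
    finally show ?thesis .
  qed
  then show "infsum f A \<le> (\<integral>\<^sup>+x. f x \<partial>count_space A)"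
    by (subst nonneg_infsum_complete) (auto intro!: SUP_least)
next
  \<comment> \<open>Cutting with \<open>A\<close> matters only for empty \<open>A\<close>, where
    \<open>from_nat_into\<close> returns an arbitrary element.\<close>
  define F where "F n = from_nat_into A ` {..n} \<inter> A" for n :: nat
  have F: "finite (F n)" "F n \<subseteq> A" for n
    by (auto simp: F_def)
  have incF: "incseq F"
    by (auto simp: incseq_def F_def)
  have UF: "x \<in> (\<Union>n. F n)" if "x \<in> A" for x
    using from_nat_into_surj[OF assms that] that by (force simp: F_def)
  have "f x = (SUP n. f x * indicator (F n) x)" if x: "x \<in> A" for x
  proof (rule antisym)
    obtain n where "x \<in> F n" using UF[OF x] by auto
    then show "f x \<le> (SUP n. f x * indicator (F n) x)"
      by (intro SUP_upper2[of n]) auto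
    show "(SUP n. f x * indicator (F n) x) \<le> f x"
      by (intro SUP_least) (auto simp: indicator_def)
  qed
  then have "(\<integral>\<^sup>+x. f x \<partial>count_space A) = (\<integral>\<^sup>+x. (SUP n. f x * indicator (F n) x) \<partial>count_space A)"
    by (intro nn_integral_cong) auto
  also have "\<dots> = (SUP n. \<integral>\<^sup>+x. f x * indicator (F n) x \<partial>count_space A)"
    using incF by (intro nn_integral_monotone_convergence_SUP)
      (auto simp: incseq_def le_fun_def indicator_def)
  also have "\<dots> = (SUP n. sum f (F n))"
  proof (rule SUP_cong[OF refl])
    fix n
    show "(\<integral>\<^sup>+x. f x * indicator (F n) x \<partial>count_space A) = sum f (F n)"
      using F[of n] by (subst nn_integral_count_space'[of "F n"]) auto
  qed
  also have "\<dots> \<le> infsum f A"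
    using F by (subst nonneg_infsum_complete) (auto intro!: SUP_least SUP_upper)
  finally show "(\<integral>\<^sup>+x. f x \<partial>count_space A) \<le> infsum f A" .
qed

lemma infsum_ennreal_of_real:
  fixes f :: "'a \<Rightarrow> real"
  assumes "f summable_on A" and nn: "\<And>x. x \<in> A \<Longrightarrow> 0 \<le> f x"
  shows "infsum (\<lambda>x. ennreal (f x)) A = ennreal (infsum f A)"
proof -
  have "infsum (\<lambda>x. ennreal (f x)) A = (SUP F\<in>{F. finite F \<and> F \<subseteq> A}. \<Sum>x\<in>F. ennreal (f x))"
    by (rule nonneg_infsum_complete) simp
  also have "\<dots> = (SUP F\<in>{F. finite F \<and> F \<subseteq> A}. ennreal (sum f F))"
    by (intro SUP_cong refl sum_ennreal) (use nn in blast)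
  also have "\<dots> = ennreal (infsum f A)"
    by (rule infsum_nonneg_is_SUPREMUM_ennreal[OF assms, symmetric])
  finally show ?thesis .
qed

text \<open>Without summability a real \<open>infsum\<close> would silently be 0, so finiteness of
  the nonnegative integral has to be known before an estimate is moved back to real sums.\<close>

lemma summable_on_of_nn_integral:
  fixes f :: "'a \<Rightarrow> real"
  assumes "countable A" "\<And>x. x \<in> A \<Longrightarrow> 0 \<le> f x" "(\<integral>\<^sup>+x. ennreal (f x) \<partial>count_space A) < \<infinity>"
  shows "f summable_on A" "ennreal (infsum f A) = (\<integral>\<^sup>+x. ennreal (f x) \<partial>count_space A)"
proof -
  have i: "infsum (\<lambda>x. ennreal (f x)) A = (\<integral>\<^sup>+x. ennreal (f x) \<partial>count_space A)"
    by (rule infsum_ennreal_eq_nn_integral) fact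
  have b: "ennreal (sum f F) \<le> (\<integral>\<^sup>+x. ennreal (f x) \<partial>count_space A)" if "finite F" "F \<subseteq> A" for F
  proof -
    have "ennreal (sum f F) = (\<Sum>x\<in>F. ennreal (f x))"
      using assms(2) that by (subst sum_ennreal) auto
    also have "\<dots> \<le> infsum (\<lambda>x. ennreal (f x)) A"
      using that by (subst nonneg_infsum_complete) (auto intro!: SUP_upper)
    finally show ?thesis using i by simp
  qed
  show s: "f summable_on A"
  proof (rule nonneg_bdd_above_summable_on)
    show "bdd_above (sum f ` {F. F \<subseteq> A \<and> finite F})"
    proof (rule bdd_aboveI2)
      fix F assume "F \<in> {F. F \<subseteq> A \<and> finite F}"
      then show "sum f F \<le> enn2real (\<integral>\<^sup>+x. ennreal (f x) \<partial>count_space A)"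
        using b[of F] assms(3) by (metis (no_types, lifting) ennreal_enn2real ennreal_le_iff enn2real_nonneg infinity_ennreal_def mem_Collect_eq)
    qed
  qed (use assms in auto)
  show "ennreal (infsum f A) = (\<integral>\<^sup>+x. ennreal (f x) \<partial>count_space A)"
    using i infsum_ennreal_of_real[OF s assms(2)] by simp
qed

lemma nn_integral_of_has_sum:
  fixes f :: "'a \<Rightarrow> real"
  assumes "countable A" "\<And>x. x \<in> A \<Longrightarrow> 0 \<le> f x" "(f has_sum s) A"
  shows "(\<integral>\<^sup>+x. ennreal (f x) \<partial>count_space A) = ennreal s"
proof -
  have s: "f summable_on A" "infsum f A = s"
    using assms(3) by (auto simp: has_sum_imp_summable infsumI)
  show ?thesis
    using infsum_ennreal_eq_nn_integral[OF assms(1)] infsum_ennreal_of_real[OF s(1) assms(2)] s(2)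
    by metis
qed

section \<open>Linear changes of variables\<close>

lemma matrix_inv_inverse:
  assumes "invertible M"
  shows "M ** matrix_inv M = mat 1" "matrix_inv M ** M = mat 1"
proof -
  have "M ** matrix_inv M = mat 1 \<and> matrix_inv M ** M = mat 1"
    using assms unfolding invertible_def matrix_inv_def by (rule someI_ex)
  then show "M ** matrix_inv M = mat 1" "matrix_inv M ** M = mat 1" by auto
qed

text \<open>The preimage under \<open>M\<close> is the image under the inverse matrix, whose
  determinant is the reciprocal. Boundedness of \<open>S\<close> keeps the measures finite, as the
  image formula for \<open>measure\<close> requires; the boxes that characterize
  \<open>lborel\<close> are bounded.\<close>

lemma emeasure_lborel_linear_vimage:
  fixes M :: "real^'n::{finite,wellorder}^'n::_"
  assumes "invertible M" and S: "S \<in> sets borel" "bounded S"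
  shows "emeasure lborel ((\<lambda>x. M *v x) -` S) = emeasure lborel S / ennreal \<bar>det M\<bar>"
proof -
  let ?N = "matrix_inv M"
  have N: "M ** ?N = mat 1" "?N ** M = mat 1"
    using matrix_inv_inverse[OF assms(1)] by auto
  have MN[simp]: "M *v (?N *v x) = x" "?N *v (M *v x) = x" for x
    by (simp_all add: matrix_vector_mul_assoc N)
  have vim: "(\<lambda>x. M *v x) -` S = (\<lambda>x. ?N *v x) ` S"
    by (auto simp: image_iff) (metis MN(2))
  have dd: "det M * det ?N = 1"
    using N by (metis det_I det_mul)
  then have d0: "det M \<noteq> 0" by auto
  have meas: "(\<lambda>x. M *v x) -` S \<in> sets borel"
    using measurable_sets[OF borel_measurable_continuous_onI[OF matrix_vector_mult_linear_continuous_on] S(1), of M]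
    by simp
  have SL: "S \<in> lmeasurable"
    using S by (auto intro!: bounded_set_imp_lmeasurable)
  have "measure lebesgue ((\<lambda>x. ?N *v x) ` S) = \<bar>det ?N\<bar> * measure lebesgue S"
    using measure_linear_image[of "(*v) ?N" S] SL by simp
  moreover have "(\<lambda>x. ?N *v x) ` S \<in> lmeasurable"
    using measurable_linear_image[of "(*v) ?N" S] SL by simp
  moreover have "\<bar>det ?N\<bar> = 1 / \<bar>det M\<bar>"
    using dd d0 by (simp add: field_simps flip: abs_mult)
  ultimately have "emeasure lebesgue ((\<lambda>x. M *v x) -` S) = ennreal (measure lebesgue S / \<bar>det M\<bar>)"
    by (simp add: vim emeasure_eq_measure2)
  also have "\<dots> = emeasure lebesgue S / ennreal \<bar>det M\<bar>"
    using SL d0 by (simp add: emeasure_eq_measure2 divide_ennreal)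
  finally show ?thesis
    using meas S by (simp add: emeasure_completion)
qed

lemma borel_measurable_matrix_vector_mult [measurable]:
  fixes M :: "real^'n^'m"
  shows "(\<lambda>x. M *v x) \<in> borel_measurable borel"
  by (intro borel_measurable_continuous_onI matrix_vector_mult_linear_continuous_on)

lemma lborel_matrix:
  fixes M :: "real^'n::{finite,wellorder}^'n::_"
  assumes "invertible M"
  shows "lborel = density (distr lborel borel (\<lambda>x. M *v x)) (\<lambda>_. ennreal \<bar>det M\<bar>)"
proof (rule lborel_eqI)
  have d0: "det M \<noteq> 0"
    using assms invertible_det_nz by blast
  fix l u :: "(real, 'n) vec" assume le: "\<And>b. b \<in> Basis \<Longrightarrow> l \<bullet> b \<le> u \<bullet> b"
  have "emeasure (density (distr lborel borel (\<lambda>x. M *v x)) (\<lambda>_. ennreal \<bar>det M\<bar>)) (box l u)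
     = ennreal \<bar>det M\<bar> * (emeasure lborel (box l u) / ennreal \<bar>det M\<bar>)"
    by (simp add: emeasure_density nn_integral_cmult emeasure_distr emeasure_lborel_linear_vimage[OF assms])
  also have "\<dots> = emeasure lborel (box l u)"
    using d0 by (simp add: ennreal_times_divide ennreal_mult_divide_eq mult.commute[of "ennreal _"])
  finally show "emeasure (density (distr lborel borel (\<lambda>x. M *v x)) (\<lambda>_. ennreal \<bar>det M\<bar>)) (box l u)
     = (\<Prod>b\<in>Basis. (u - l) \<bullet> b)"
    using le by simp
qed simp

lemma nn_integral_matrix:
  fixes M :: "real^'n::{finite,wellorder}^'n::_"
  assumes "invertible M" and [measurable]: "f \<in> borel_measurable borel"
  shows "(\<integral>\<^sup>+x. f x \<partial>lborel) = ennreal \<bar>det M\<bar> * (\<integral>\<^sup>+x. f (M *v x) \<partial>lborel)"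
  by (subst lborel_matrix[OF assms(1)]) (simp add: nn_integral_density nn_integral_distr nn_integral_cmult)

lemma integral_matrix:
  fixes M :: "real^'n::{finite,wellorder}^'n::_" and f :: "_ \<Rightarrow> 'b::{banach,second_countable_topology}"
  assumes "invertible M" and [measurable]: "f \<in> borel_measurable borel"
  shows "(\<integral>x. f x \<partial>lborel) = \<bar>det M\<bar> *\<^sub>R (\<integral>x. f (M *v x) \<partial>lborel)"
  by (subst lborel_matrix[OF assms(1)]) (simp add: integral_density integral_distr)

lemma integrable_matrix_iff:
  fixes M :: "real^'n::{finite,wellorder}^'n::_" and f :: "_ \<Rightarrow> 'b::{banach,second_countable_topology}"
  assumes "invertible M" and [measurable]: "f \<in> borel_measurable borel"
  shows "integrable lborel (\<lambda>x. f (M *v x)) \<longleftrightarrow> integrable lborel f"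
proof -
  have d0: "det M \<noteq> 0"
    using assms invertible_det_nz by blast
  have "integrable lborel f \<longleftrightarrow> integrable lborel (\<lambda>x. \<bar>det M\<bar> *\<^sub>R f (M *v x))"
    by (subst lborel_matrix[OF assms(1)]) (simp add: integrable_density integrable_distr_eq)
  also have "\<dots> \<longleftrightarrow> integrable lborel (\<lambda>x. f (M *v x))"
    using integrable_scaleR_right[of "1 / \<bar>det M\<bar>" lborel "\<lambda>x. \<bar>det M\<bar> *\<^sub>R f (M *v x)"] d0 by auto
  finally show ?thesis ..
qed

lemma nn_integral_shift:
  fixes c :: "'a::euclidean_space"
  assumes [measurable]: "f \<in> borel_measurable borel"
  shows "(\<integral>\<^sup>+x. f (x + c) \<partial>lborel) = (\<integral>\<^sup>+x. f x \<partial>lborel)"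
  by (subst (2) lborel_distr_plus[of c, symmetric]) (simp add: nn_integral_distr add.commute)

lemma integral_shift:
  fixes c :: "'a::euclidean_space" and f :: "_ \<Rightarrow> 'b::{banach,second_countable_topology}"
  assumes [measurable]: "f \<in> borel_measurable borel"
  shows "(\<integral>x. f (x + c) \<partial>lborel) = (\<integral>x. f x \<partial>lborel)"
  by (subst (2) lborel_distr_plus[of c, symmetric]) (simp add: integral_distr add.commute)

lemma integrable_shift_iff:
  fixes c :: "'a::euclidean_space" and f :: "_ \<Rightarrow> 'b::{banach,second_countable_topology}"
  assumes [measurable]: "f \<in> borel_measurable borel"
  shows "integrable lborel (\<lambda>x. f (x + c)) \<longleftrightarrow> integrable lborel f"
  by (subst (2) lborel_distr_plus[of c, symmetric]) (simp add: integrable_distr_eq add.commute)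

section \<open>Periodization over the integer lattice\<close>

definition int_points :: "(real^'n) set" where
  "int_points = {z. \<forall>i. z $ i \<in> \<int>}"

definition unit_cell :: "(real^'n) set" where
  "unit_cell = {x. \<forall>i. 0 \<le> x $ i \<and> x $ i < 1}"

text \<open>Lebesgue measure on a fundamental domain, kept as a measure on the whole space:
  functions on the torus are then ordinary functions on \<open>real^'n\<close>, and periodicity is
  not demanded of them.\<close>

definition torus :: "(real^'n) measure" where
  "torus = density lborel (indicator unit_cell)"

lemma torus_real_density: "torus = density lborel (\<lambda>x. ennreal (indicator unit_cell x))"
  by (simp add: torus_def ennreal_indicator)

lemma int_points_closed [simp]:
  "0 \<in> int_points"
  "x \<in> int_points \<Longrightarrow> y \<in> int_points \<Longrightarrow> x + y \<in> int_points"
  "x \<in> int_points \<Longrightarrow> y \<in> int_points \<Longrightarrow> x - y \<in> int_points"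
  "- x \<in> int_points \<longleftrightarrow> x \<in> int_points"
  by (auto simp: int_points_def)

lemma axis_int_points [simp]: "axis i 1 \<in> int_points"
  by (auto simp: int_points_def axis_def)

lemma countable_int_points [simp]: "countable (int_points :: (real^'n) set)"
proof -
  have "int_points \<subseteq> range (\<lambda>g::'n \<Rightarrow> int. \<chi> i. real_of_int (g i))"
  proof
    fix z :: "real^'n" assume "z \<in> int_points"
    then have "z = (\<chi> i. real_of_int \<lfloor>z $ i\<rfloor>)"
      by (auto simp: int_points_def vec_eq_iff Ints_def)
    then show "z \<in> range (\<lambda>g::'n \<Rightarrow> int. \<chi> i. real_of_int (g i))" by (auto intro!: image_eqI)
  qed
  then show ?thesis
    by (rule countable_subset) auto
qed

lemma unit_cell_borel [measurable]: "unit_cell \<in> sets borel"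
  unfolding unit_cell_def by measurable

lemma sets_torus [measurable_cong, simp]: "sets torus = sets borel"
  and space_torus [simp]: "space torus = UNIV"
  by (auto simp: torus_def)

text \<open>The half-open cell is a fundamental domain: in each coordinate only the integer
  \<open>- \<lfloor>x $ i\<rfloor>\<close> moves \<open>x $ i\<close> into the interval from 0
  (included) to 1 (excluded).\<close>

lemma unit_cell_translate:
  obtains w :: "real^'n" where "w \<in> int_points" "\<And>z. z \<in> int_points \<Longrightarrow> x + z \<in> unit_cell \<longleftrightarrow> z = w"
proof
  let ?w = "(\<chi> i. - real_of_int \<lfloor>x $ i\<rfloor>) :: real^'n"
  show "?w \<in> int_points" by (auto simp: int_points_def)
  fix z :: "real^'n" assume z: "z \<in> int_points"
  have "(0 \<le> x $ i + z $ i \<and> x $ i + z $ i < 1) \<longleftrightarrow> z $ i = - real_of_int \<lfloor>x $ i\<rfloor>" for i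
  proof -
    obtain k where k: "z $ i = real_of_int k" using z by (auto simp: int_points_def Ints_def)
    have "(0 \<le> x $ i + real_of_int k \<and> x $ i + real_of_int k < 1) \<longleftrightarrow> \<lfloor>x $ i\<rfloor> = - k"
      unfolding floor_eq_iff by auto
    then show ?thesis unfolding k by (metis minus_minus of_int_eq_iff of_int_minus)
  qed
  then show "x + z \<in> unit_cell \<longleftrightarrow> z = ?w"
    by (auto simp: unit_cell_def vec_eq_iff)
qed

lemma nn_integral_unit_cell_translate:
  fixes x :: "real^'n"
  shows "(\<integral>\<^sup>+z. indicator unit_cell (x + z) \<partial>count_space int_points) = 1"
proof -
  obtain w where w: "w \<in> int_points" "\<And>z. z \<in> int_points \<Longrightarrow> x + z \<in> unit_cell \<longleftrightarrow> z = w"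
    by (rule unit_cell_translate[of x]) blast
  have "(\<integral>\<^sup>+z. indicator unit_cell (x + z) \<partial>count_space int_points)
      = (\<Sum>z\<in>{w}. indicator unit_cell (x + z))"
    using w by (intro nn_integral_count_space') (auto simp: indicator_def)
  also have "\<dots> = 1"
    using w(2)[OF w(1)] by simp
  finally show ?thesis .
qed

lemma nn_integral_torus:
  assumes "f \<in> borel_measurable borel"
  shows "(\<integral>\<^sup>+x. f x \<partial>torus) = (\<integral>\<^sup>+x. indicator unit_cell x * f x \<partial>lborel)"
  using assms unfolding torus_def by (subst nn_integral_density) auto

lemma nn_integral_int_points_measurable [measurable]:
  fixes f :: "real^'n \<Rightarrow> ennreal"
  assumes [measurable]: "f \<in> borel_measurable borel"
  shows "(\<lambda>x. \<integral>\<^sup>+z. f (x + z) \<partial>count_space int_points) \<in> borel_measurable borel"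
proof -
  interpret Z: sigma_finite_measure "count_space (int_points :: (real^'n) set)"
    by (rule sigma_finite_measure_count_space_countable) simp
  have [measurable]: "(\<lambda>z. z) \<in> borel_measurable (count_space (int_points :: (real^'n) set))" by simp
  show ?thesis by measurable
qed

text \<open>After Tonelli, translating by \<open>z\<close> moves the shift from \<open>f\<close> to
  the indicator of the cell; the translated cells cover every point exactly once.\<close>

lemma nn_integral_periodize:
  fixes f :: "real^'n \<Rightarrow> ennreal"
  assumes [measurable]: "f \<in> borel_measurable borel"
  shows "(\<integral>\<^sup>+x. (\<integral>\<^sup>+z. f (x + z) \<partial>count_space int_points) \<partial>torus) = (\<integral>\<^sup>+x. f x \<partial>lborel)"
proof -
  have "(\<integral>\<^sup>+x. (\<integral>\<^sup>+z. f (x + z) \<partial>count_space int_points) \<partial>torus)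
      = (\<integral>\<^sup>+x. (\<integral>\<^sup>+z. indicator unit_cell x * f (x + z) \<partial>count_space int_points) \<partial>lborel)"
    by (simp add: nn_integral_torus nn_integral_cmult)
  also have "\<dots> = (\<integral>\<^sup>+z. (\<integral>\<^sup>+x. indicator unit_cell x * f (x + z) \<partial>lborel) \<partial>count_space int_points)"
    by (rule nn_integral_count_space_nn_integral) auto
  also have "\<dots> = (\<integral>\<^sup>+z. (\<integral>\<^sup>+x. indicator unit_cell (x - z) * f x \<partial>lborel) \<partial>count_space int_points)"
  proof (rule nn_integral_cong)
    fix z :: "real^'n"
    have "(\<lambda>x. indicator unit_cell (x - z) * f x) \<in> borel_measurable borel" by measurable
    from nn_integral_shift[OF this, of z]
    show "(\<integral>\<^sup>+x. indicator unit_cell x * f (x + z) \<partial>lborel) = (\<integral>\<^sup>+x. indicator unit_cell (x - z) * f x \<partial>lborel)"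
      by simp
  qed
  also have "\<dots> = (\<integral>\<^sup>+x. (\<integral>\<^sup>+z. indicator unit_cell (x - z) * f x \<partial>count_space int_points) \<partial>lborel)"
    by (rule nn_integral_count_space_nn_integral[symmetric]) auto
  also have "\<dots> = (\<integral>\<^sup>+x. (\<integral>\<^sup>+z. indicator unit_cell (x - z) \<partial>count_space int_points) * f x \<partial>lborel)"
    by (simp add: nn_integral_multc)
  also have "(\<lambda>x. \<integral>\<^sup>+z. indicator unit_cell (x - z) \<partial>count_space int_points) = (\<lambda>x::real^'n. 1)"
  proof
    fix x :: "real^'n"
    have "(\<integral>\<^sup>+z. indicator unit_cell (x - z) \<partial>count_space int_points)
        = (\<integral>\<^sup>+z. indicator unit_cell (x + z) \<partial>count_space int_points)"
      by (subst nn_integral_bij_count_space[of uminus int_points int_points, symmetric])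
        (auto intro!: bij_betwI[where g=uminus])
    then show "(\<integral>\<^sup>+z. indicator unit_cell (x - z) \<partial>count_space int_points) = 1"
      by (simp add: nn_integral_unit_cell_translate)
  qed
  finally show ?thesis by simp
qed

lemma prob_space_torus: "prob_space (torus :: (real^'n) measure)"
proof
  have "unit_cell \<subseteq> cbox (0::real^'n) 1" "box (0::real^'n) 1 \<subseteq> unit_cell"
    by (auto simp: unit_cell_def mem_box_cart less_imp_le)
  then have "emeasure lborel (unit_cell :: (real^'n) set) \<le> emeasure lborel (cbox (0::real^'n) 1)"
    "emeasure lborel (box (0::real^'n) 1) \<le> emeasure lborel (unit_cell :: (real^'n) set)"
    by (auto intro!: emeasure_mono)
  moreover have "(1::real^'n) \<bullet> b = 1" if "b \<in> Basis" for b
    using that by (auto simp: Basis_vec_def inner_axis)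
  then have "emeasure lborel (cbox (0::real^'n) 1) = 1" "emeasure lborel (box (0::real^'n) 1) = 1"
    by simp_all
  ultimately have "emeasure lborel (unit_cell :: (real^'n) set) = 1"
    by (auto intro: antisym)
  then show "emeasure (torus :: (real^'n) measure) (space torus) = 1"
    by (simp add: torus_def emeasure_density)
qed

text \<open>The faces of the cube are null. Discarding them makes \<open>torus_embed\<close>
  injective on the points that remain.\<close>

lemma torus_box: "AE x in torus. x \<in> box (0::real^'n) 1"
proof -
  interpret prob_space "torus :: (real^'n) measure" by (rule prob_space_torus)
  have b: "box (0::real^'n) 1 \<subseteq> unit_cell"
    by (auto simp: unit_cell_def mem_box_cart less_imp_le)
  have "(1::real^'n) \<bullet> b = 1" if "b \<in> Basis" for b
    using that by (auto simp: Basis_vec_def inner_axis)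
  then have "emeasure lborel (box (0::real^'n) 1) = 1"
    by simp
  moreover have "emeasure torus (box (0::real^'n) 1) = emeasure lborel (unit_cell \<inter> box (0::real^'n) 1)"
    by (simp add: torus_def emeasure_density indicator_inter_arith[symmetric])
  ultimately have "emeasure torus (box (0::real^'n) 1) = 1"
    using b by (simp add: Int_absorb1)
  then show ?thesis
    by (subst AE_in_set_eq_1) (auto simp: emeasure_eq_measure)
qed

text \<open>Periodization written as an equality of measures, so that Fubini's theorem on the
  product becomes available for complex-valued integrable functions.\<close>

lemma lborel_eq_distr_torus:
  "distr (torus \<Otimes>\<^sub>M count_space (int_points :: (real^'n) set)) borel (\<lambda>(x, z). x + z) = lborel"
proof (rule measure_eqI)
  interpret Z: sigma_finite_measure "count_space (int_points :: (real^'n) set)"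
    by (rule sigma_finite_measure_count_space_countable) simp
  have [measurable]: "(\<lambda>z. z) \<in> borel_measurable (count_space (int_points :: (real^'n) set))" by simp
  fix A assume "A \<in> sets (distr (torus \<Otimes>\<^sub>M count_space (int_points :: (real^'n) set)) borel (\<lambda>(x, z). x + z))"
  then have [measurable]: "A \<in> sets borel" by simp
  have "emeasure (distr (torus \<Otimes>\<^sub>M count_space int_points) borel (\<lambda>(x, z). x + z)) A
    = (\<integral>\<^sup>+p. indicator A (fst p + snd p) \<partial>(torus \<Otimes>\<^sub>M count_space int_points))"
    by (subst nn_integral_indicator[symmetric]) (simp_all add: nn_integral_distr split_beta' del: nn_integral_indicator)
  also have "\<dots> = (\<integral>\<^sup>+x. (\<integral>\<^sup>+z. indicator A (x + z) \<partial>count_space int_points) \<partial>torus)"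
    by (subst Z.nn_integral_fst[symmetric]) auto
  also have "\<dots> = emeasure lborel A"
    by (subst nn_integral_periodize) auto
  finally show "emeasure (distr (torus \<Otimes>\<^sub>M count_space int_points) borel (\<lambda>(x, z). x + z)) A
    = emeasure lborel A" .
qed simp

text \<open>Fubini's theorem on the product of torus and lattice. The inner sum converges absolutely
  only for almost every \<open>x\<close>; elsewhere the Bochner integral is 0 by convention, which
  does not affect the outer integral.\<close>

lemma integral_periodize:
  fixes f :: "real^'n \<Rightarrow> complex"
  assumes f: "integrable lborel f"
  shows "AE x in torus. integrable (count_space int_points) (\<lambda>z. f (x + z))"
    and "integrable torus (\<lambda>x. \<integral>z. f (x + z) \<partial>count_space int_points)"
    and "(\<integral>x. (\<integral>z. f (x + z) \<partial>count_space int_points) \<partial>torus) = (\<integral>x. f x \<partial>lborel)"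
proof -
  interpret T: prob_space "torus :: (real^'n) measure" by (rule prob_space_torus)
  interpret Z: sigma_finite_measure "count_space (int_points :: (real^'n) set)"
    by (rule sigma_finite_measure_count_space_countable) simp
  interpret P: pair_sigma_finite "torus :: (real^'n) measure" "count_space (int_points :: (real^'n) set)" ..
  have [measurable]: "(\<lambda>z. z) \<in> borel_measurable (count_space (int_points :: (real^'n) set))" by simp
  have [measurable]: "f \<in> borel_measurable borel" using f by auto
  have i: "integrable (torus \<Otimes>\<^sub>M count_space int_points) (\<lambda>(x, z). f (x + z))"
    using f by (subst (asm) lborel_eq_distr_torus[symmetric])
      (auto simp: integrable_distr_eq split_beta')
  have e: "(\<integral>x. f x \<partial>lborel) = (\<integral>(x, z). f (x + z) \<partial>(torus \<Otimes>\<^sub>M count_space int_points))"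
    by (subst lborel_eq_distr_torus[symmetric]) (auto simp: integral_distr split_beta')
  show "AE x in torus. integrable (count_space int_points) (\<lambda>z. f (x + z))"
    using P.AE_integrable_fst'[OF i] by simp
  show "integrable torus (\<lambda>x. \<integral>z. f (x + z) \<partial>count_space int_points)"
    using P.integrable_fst'[OF i] by simp
  show "(\<integral>x. (\<integral>z. f (x + z) \<partial>count_space int_points) \<partial>torus) = (\<integral>x. f x \<partial>lborel)"
    using P.integral_fst'[OF i] e by simp
qed

section \<open>Characters\<close>

definition echar :: "real^'n \<Rightarrow> real^'n \<Rightarrow> complex" where
  "echar z x = cis (2 * pi * (z \<bullet> x))"

lemma echar_simps [simp]:
  "norm (echar z x) = 1" "echar 0 x = 1" "echar z 0 = 1"
  by (simp_all add: echar_def)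

lemma echar_add_left: "echar (z + w) x = echar z x * echar w x"
  and echar_add_right: "echar z (x + y) = echar z x * echar z y"
  and cnj_echar: "cnj (echar z x) = echar (- z) x"
  by (simp_all add: echar_def cis_mult cis_cnj algebra_simps inner_add_left inner_add_right inner_commute)

lemma echar_measurable [measurable]:
  assumes [measurable]: "f \<in> borel_measurable M" "g \<in> borel_measurable M"
  shows "(\<lambda>x. echar (f x) (g x)) \<in> borel_measurable M"
proof -
  have "(\<lambda>t. cis (2 * pi * t)) \<in> borel_measurable borel"
    by (intro borel_measurable_continuous_onI continuous_intros)
  then show ?thesis unfolding echar_def by measurable
qed

lemma echar_int_points:
  assumes "z \<in> int_points" "w \<in> int_points"
  shows "echar z w = 1"
proof -
  have "z \<bullet> w \<in> \<int>"
    using assms unfolding inner_vec_def int_points_def by (auto intro!: Ints_sum Ints_mult)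
  then show ?thesis
    unfolding echar_def by (rule cis_multiple_2pi)
qed

text \<open>For nonzero \<open>z\<close> the integral of the character over a translated cell is
  evaluated twice. Undoing the translation gives minus the integral over the original cell;
  periodizing gives the integral itself, since a translated cell is again a fundamental
  domain.\<close>

lemma integral_echar:
  fixes z :: "real^'n"
  assumes z: "z \<in> int_points"
  shows "(\<integral>x. echar z x \<partial>torus) = (if z = 0 then 1 else 0)"
proof (cases "z = 0")
  case True
  interpret T: prob_space "torus :: (real^'n) measure" by (rule prob_space_torus)
  show ?thesis using True T.prob_space by simp
next
  case False
  then obtain i where i: "z $ i \<noteq> 0" by (auto simp: vec_eq_iff)
  \<comment> \<open>translation by half a period changes the sign of the character\<close>
  define t :: "real^'n" where "t = axis i (1 / (2 * z $ i))"
  have zt: "2 * pi * (z \<bullet> - t) = - pi" using i by (simp add: t_def inner_axis)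
  have et: "echar z (- t) = - 1"
    unfolding echar_def zt by (simp add: complex_eq_iff)
  define f where "f x = indicator unit_cell (x + t) *\<^sub>R echar z x" for x
  have [measurable]: "f \<in> borel_measurable borel" unfolding f_def by measurable
  interpret T: prob_space "torus :: (real^'n) measure" by (rule prob_space_torus)
  have it: "integrable torus (echar z)"
    by (rule T.integrable_const_bound[of _ 1]) auto
  then have il: "integrable lborel (\<lambda>x. indicator unit_cell x *\<^sub>R echar z x)"
    unfolding torus_real_density by (subst (asm) integrable_density) auto
  have sh: "f (x + - t) = - (indicator unit_cell x *\<^sub>R echar z x)" for x
    using et by (simp add: f_def echar_add_right[of z x "-t", simplified])
  have fi: "integrable lborel f"
    using il integrable_shift_iff[of f "-t"] unfolding sh by simp
  have "(\<integral>x. f x \<partial>lborel) = - (\<integral>x. indicator unit_cell x *\<^sub>R echar z x \<partial>lborel)"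
    by (subst integral_shift[of f "-t", symmetric]) (simp_all add: sh del: add_uminus_conv_diff)
  also have "(\<integral>x. indicator unit_cell x *\<^sub>R echar z x \<partial>lborel) = (\<integral>x. echar z x \<partial>torus)"
    unfolding torus_real_density by (subst integral_density) auto
  finally have 1: "(\<integral>x. f x \<partial>lborel) = - (\<integral>x. echar z x \<partial>torus)" .
  have "(\<integral>w. f (x + w) \<partial>count_space int_points) = echar z x" for x
  proof -
    obtain w where w: "w \<in> int_points" "\<And>y. y \<in> int_points \<Longrightarrow> (x + t) + y \<in> unit_cell \<longleftrightarrow> y = w"
      by (rule unit_cell_translate[of "x + t"]) blast
    have "(\<integral>y. f (x + y) \<partial>count_space int_points) = (\<integral>y. indicator {w} y *\<^sub>R echar z x \<partial>count_space int_points)"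
    proof (rule Bochner_Integration.integral_cong)
      fix y assume "y \<in> space (count_space (int_points :: (real^'n) set))"
      then show "f (x + y) = indicator {w} y *\<^sub>R echar z x"
        using w(2)[of y] echar_int_points[OF z, of y]
        by (auto simp: f_def echar_add_right indicator_def ac_simps)
    qed simp
    also have "\<dots> = echar z x"
      using w by (subst integral_scaleR_left) (auto simp: measure_count_space)
    finally show ?thesis .
  qed
  then have 2: "(\<integral>x. f x \<partial>lborel) = (\<integral>x. echar z x \<partial>torus)"
    using integral_periodize(3)[OF fi] by simp
  have "2 * (\<integral>x. echar z x \<partial>torus) = 0"
    using 1 2 by (simp add: eq_neg_iff_add_eq_0)
  then show ?thesis using False by simp
qed

section \<open>Completeness of the characters\<close>

inductive trig :: "(real^'n \<Rightarrow> complex) \<Rightarrow> bool" where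
  char: "z \<in> int_points \<Longrightarrow> trig (\<lambda>x. c * echar z x)"
| add: "trig f \<Longrightarrow> trig g \<Longrightarrow> trig (\<lambda>x. f x + g x)"

lemma trig_const: "trig (\<lambda>x. c)"
  using trig.char[of 0 c] by simp

lemma trig_mult:
  assumes "trig f" "trig g"
  shows "trig (\<lambda>x. f x * g x)"
  using assms(1)
proof induction
  case (char z c)
  show ?case using assms(2)
  proof induction
    case (char w d)
    show ?case using trig.char[of "z + w" "c * d"] \<open>z \<in> int_points\<close> char
      by (simp add: echar_add_left ac_simps)
  next
    case (add f g)
    then show ?case using trig.add by (simp add: distrib_left)
  qed
next
  case (add f h)
  then show ?case using trig.add by (simp add: distrib_right)
qed

lemma trig_sum: "finite I \<Longrightarrow> (\<And>i. i \<in> I \<Longrightarrow> trig (f i)) \<Longrightarrow> trig (\<lambda>x. \<Sum>i\<in>I. f i x)"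
  by (induction rule: finite_induct) (auto intro: trig_const trig.add)

text \<open>The sign in \<open>echar (- z)\<close> pairs \<open>b z\<close> with the coefficient
  \<open>\<integral>x. F x * echar z x \<partial>torus\<close>. Collecting repeated frequencies
  leaves one coefficient per lattice point, as orthogonality requires.\<close>

lemma trig_representation:
  assumes "trig p"
  shows "\<exists>K b. finite K \<and> K \<subseteq> int_points \<and> p = (\<lambda>x. \<Sum>z\<in>K. b z * echar (- z) x)"
  using assms
proof induction
  case (char z c)
  show ?case
    by (rule exI[of _ "{-z}"], rule exI[of _ "\<lambda>_. c"]) (use char in auto)
next
  case (add f g)
  then obtain K b L d where *: "finite K" "K \<subseteq> int_points" "f = (\<lambda>x. \<Sum>z\<in>K. b z * echar (- z) x)"
    "finite L" "L \<subseteq> int_points" "g = (\<lambda>x. \<Sum>z\<in>L. d z * echar (- z) x)" by blast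
  define c where "c z = (if z \<in> K then b z else 0) + (if z \<in> L then d z else 0)" for z
  have "f x = (\<Sum>z\<in>K \<union> L. (if z \<in> K then b z else 0) * echar (- z) x)" for x
    unfolding * using * by (intro sum.mono_neutral_cong_left) auto
  moreover have "g x = (\<Sum>z\<in>K \<union> L. (if z \<in> L then d z else 0) * echar (- z) x)" for x
    unfolding * using * by (intro sum.mono_neutral_cong_left) auto
  ultimately have "(\<lambda>x. f x + g x) = (\<lambda>x. \<Sum>z\<in>K \<union> L. c z * echar (- z) x)"
    by (simp add: c_def distrib_right sum.distrib)
  then show ?case
    using * by (intro exI[of _ "K \<union> L"] exI[of _ c]) auto
qed

lemma trig_measurable: "trig p \<Longrightarrow> p \<in> borel_measurable borel"
  by (induction rule: trig.induct) measurable

text \<open>The torus as a product of circles in complex space. The compact image lets the real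
  Stone-Weierstrass theorem produce polynomials that pull back to trigonometric polynomials.\<close>

definition torus_embed :: "real^'n \<Rightarrow> complex^'n" where
  "torus_embed x = (\<chi> i. cis (2 * pi * x $ i))"

lemma continuous_torus_embed: "continuous_on S torus_embed"
  unfolding torus_embed_def by (intro continuous_intros)

lemma trig_torus_embed:
  "trig (\<lambda>x. complex_of_real (Re (torus_embed x $ i)))"
  "trig (\<lambda>x. complex_of_real (Im (torus_embed x $ i)))"
proof -
  have e: "echar (axis i 1) x = cis (2 * pi * x $ i)" "echar (- axis i 1) x = cis (- (2 * pi * x $ i))" for x
    by (simp_all add: echar_def inner_axis')
  have re: "complex_of_real (Re (torus_embed x $ i)) = 1/2 * echar (axis i 1) x + 1/2 * echar (- axis i 1) x"
    and im: "complex_of_real (Im (torus_embed x $ i)) = - \<i>/2 * echar (axis i 1) x + \<i>/2 * echar (- axis i 1) x" for x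
    by (simp_all add: e torus_embed_def complex_eq_iff)
  show "trig (\<lambda>x. complex_of_real (Re (torus_embed x $ i)))"
    "trig (\<lambda>x. complex_of_real (Im (torus_embed x $ i)))"
    unfolding re im by (intro trig.intros; simp)+
qed

text \<open>A real-linear functional on complex space is a real combination of the real and
  imaginary parts of the coordinates, which pull back to cosines and sines; sums and products stay
  within \<open>trig\<close>.\<close>

lemma trig_polynomial:
  fixes p :: "complex^'n \<Rightarrow> real"
  assumes "real_polynomial_function p"
  shows "trig (\<lambda>x. complex_of_real (p (torus_embed x)))"
  using assms
proof induction
  case (linear f)
  interpret f: bounded_linear f by fact
  have ax: "axis i c = Re c *\<^sub>R axis i 1 + Im c *\<^sub>R (axis i \<i> :: complex^'n)" for i c
    by (auto simp: vec_eq_iff axis_def complex_eq_iff)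
  have fv: "f v = (\<Sum>i\<in>UNIV. Re (v $ i) * f (axis i 1) + Im (v $ i) * f (axis i \<i>))" for v
  proof -
    have "v = (\<Sum>i\<in>UNIV. axis i (v $ i))"
      by (simp add: vec_eq_iff axis_def sum_component if_distrib cong: if_cong)
    then have "f v = (\<Sum>i\<in>UNIV. f (axis i (v $ i)))"
      using f.sum[of "\<lambda>i. axis i (v $ i)" UNIV] by simp
    also have "\<dots> = (\<Sum>i\<in>UNIV. Re (v $ i) * f (axis i 1) + Im (v $ i) * f (axis i \<i>))"
      by (subst ax) (simp add: f.add f.scaleR)
    finally show ?thesis .
  qed
  have "(\<lambda>x. complex_of_real (f (torus_embed x))) =
    (\<lambda>x. \<Sum>i\<in>UNIV. complex_of_real (Re (torus_embed x $ i)) * complex_of_real (f (axis i 1))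
      + complex_of_real (Im (torus_embed x $ i)) * complex_of_real (f (axis i \<i>)))"
    (is "_ = ?g")
  proof
    fix x
    show "complex_of_real (f (torus_embed x)) = ?g x"
      using arg_cong[OF fv[of "torus_embed x"], of complex_of_real]
      by (simp only: of_real_sum of_real_add of_real_mult)
  qed
  then show ?case
    by (simp only:) (intro trig_sum trig.add trig_mult trig_torus_embed trig_const finite)
next
  case (mult f g)
  then show ?case using trig_mult[OF mult.IH] by simp
next
  case (add f g)
  then show ?case using trig.add[OF add.IH] by simp
qed (rule trig_const)

text \<open>The closure of the trigonometric polynomials for the mean-square distance on the torus.
  The nonnegative integral is used so that a divergent distance counts as infinite and not as
  0.\<close>

definition trig_limit :: "(real^'n \<Rightarrow> complex) \<Rightarrow> bool" where
  "trig_limit F \<longleftrightarrow> F \<in> borel_measurable borel \<and>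
     (\<forall>\<epsilon>>0. \<exists>p. trig p \<and> (\<integral>\<^sup>+x. ennreal ((norm (F x - p x))\<^sup>2) \<partial>torus) < ennreal \<epsilon>)"

lemma norm_add_square_le: "(norm (a + b))\<^sup>2 \<le> 2 * (norm a)\<^sup>2 + 2 * (norm (b::'a::real_normed_vector))\<^sup>2"
proof -
  have "(norm (a + b))\<^sup>2 \<le> (norm a + norm b)\<^sup>2"
    by (intro power_mono norm_triangle_ineq) auto
  also have "\<dots> \<le> 2 * (norm a)\<^sup>2 + 2 * (norm b)\<^sup>2"
    using sum_squares_bound[of "norm a" "norm b"] by (simp add: power2_sum)
  finally show ?thesis .
qed

lemma nn_integral_norm_add_square_le:
  fixes f g :: "'a \<Rightarrow> 'b::{real_normed_vector,second_countable_topology}"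
  assumes [measurable]: "f \<in> borel_measurable M" "g \<in> borel_measurable M"
  shows "(\<integral>\<^sup>+x. ennreal ((norm (f x + g x))\<^sup>2) \<partial>M)
    \<le> 2 * (\<integral>\<^sup>+x. ennreal ((norm (f x))\<^sup>2) \<partial>M) + 2 * (\<integral>\<^sup>+x. ennreal ((norm (g x))\<^sup>2) \<partial>M)"
proof -
  have "(\<integral>\<^sup>+x. ennreal ((norm (f x + g x))\<^sup>2) \<partial>M)
      \<le> (\<integral>\<^sup>+x. 2 * ennreal ((norm (f x))\<^sup>2) + 2 * ennreal ((norm (g x))\<^sup>2) \<partial>M)"
  proof (rule nn_integral_mono)
    fix x
    have "ennreal ((norm (f x + g x))\<^sup>2) \<le> ennreal (2 * (norm (f x))\<^sup>2 + 2 * (norm (g x))\<^sup>2)"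
      by (intro ennreal_leI norm_add_square_le)
    then show "ennreal ((norm (f x + g x))\<^sup>2) \<le> 2 * ennreal ((norm (f x))\<^sup>2) + 2 * ennreal ((norm (g x))\<^sup>2)"
      by (simp add: ennreal_plus ennreal_mult)
  qed
  then show ?thesis by (simp add: nn_integral_add nn_integral_cmult)
qed

lemma trig_limit_close:
  assumes [measurable]: "F \<in> borel_measurable borel"
    and close: "\<And>\<epsilon>. \<epsilon> > 0 \<Longrightarrow> \<exists>G. trig_limit G \<and> (\<integral>\<^sup>+x. ennreal ((norm (F x - G x))\<^sup>2) \<partial>torus) < ennreal \<epsilon>"
  shows "trig_limit F"
  unfolding trig_limit_def
proof (intro conjI allI impI)
  fix \<epsilon> :: real assume "\<epsilon> > 0"
  \<comment> \<open>A quarter of \<epsilon>, because squaring the triangle inequality costs a factor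
    2 on each of two terms.\<close>
  then obtain G where G: "trig_limit G" "(\<integral>\<^sup>+x. ennreal ((norm (F x - G x))\<^sup>2) \<partial>torus) < ennreal (\<epsilon> / 4)"
    using close[of "\<epsilon> / 4"] by auto
  then obtain p where p: "trig p" "(\<integral>\<^sup>+x. ennreal ((norm (G x - p x))\<^sup>2) \<partial>torus) < ennreal (\<epsilon> / 4)"
    using \<open>\<epsilon> > 0\<close> unfolding trig_limit_def by (meson divide_pos_pos zero_less_numeral)
  have [measurable]: "G \<in> borel_measurable borel" using G by (simp add: trig_limit_def)
  note [measurable] = trig_measurable[OF p(1)]
  have "(\<integral>\<^sup>+x. ennreal ((norm (F x - p x))\<^sup>2) \<partial>torus)
      = (\<integral>\<^sup>+x. ennreal ((norm ((F x - G x) + (G x - p x)))\<^sup>2) \<partial>torus)" by simp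
  also have "\<dots> \<le> 2 * (\<integral>\<^sup>+x. ennreal ((norm (F x - G x))\<^sup>2) \<partial>torus) + 2 * (\<integral>\<^sup>+x. ennreal ((norm (G x - p x))\<^sup>2) \<partial>torus)"
    by (rule nn_integral_norm_add_square_le) measurable
  also have "\<dots> < 2 * ennreal (\<epsilon> / 4) + 2 * ennreal (\<epsilon> / 4)"
    using G(2) p(2) by (intro add_strict_mono ennreal_mult_strict_left_mono) auto
  also have "\<dots> = ennreal \<epsilon>"
    using \<open>\<epsilon> > 0\<close> by (simp add: ennreal_mult[symmetric] ennreal_plus[symmetric] flip: ennreal_numeral del: ennreal_plus)
  finally show "\<exists>p. trig p \<and> (\<integral>\<^sup>+x. ennreal ((norm (F x - p x))\<^sup>2) \<partial>torus) < ennreal \<epsilon>"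
    using p(1) by blast
qed fact

lemma trig_limit_trig: "trig p \<Longrightarrow> trig_limit p"
  unfolding trig_limit_def using trig_measurable[of p] by (auto intro!: exI[of _ p])

lemma trig_limit_add:
  assumes F: "trig_limit F" and G: "trig_limit G"
  shows "trig_limit (\<lambda>x. F x + G x)"
  unfolding trig_limit_def
proof (intro conjI allI impI)
  have [measurable]: "F \<in> borel_measurable borel" "G \<in> borel_measurable borel"
    using assms by (simp_all add: trig_limit_def)
  show "(\<lambda>x. F x + G x) \<in> borel_measurable borel" by measurable
  fix \<epsilon> :: real assume "\<epsilon> > 0"
  then obtain p q where p: "trig p" "(\<integral>\<^sup>+x. ennreal ((norm (F x - p x))\<^sup>2) \<partial>torus) < ennreal (\<epsilon> / 4)"
    and q: "trig q" "(\<integral>\<^sup>+x. ennreal ((norm (G x - q x))\<^sup>2) \<partial>torus) < ennreal (\<epsilon> / 4)"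
    using F G unfolding trig_limit_def by (meson divide_pos_pos zero_less_numeral)
  note [measurable] = trig_measurable[OF p(1)] trig_measurable[OF q(1)]
  have "(\<integral>\<^sup>+x. ennreal ((norm (F x + G x - (p x + q x)))\<^sup>2) \<partial>torus)
      = (\<integral>\<^sup>+x. ennreal ((norm ((F x - p x) + (G x - q x)))\<^sup>2) \<partial>torus)" by (simp add: algebra_simps)
  also have "\<dots> \<le> 2 * (\<integral>\<^sup>+x. ennreal ((norm (F x - p x))\<^sup>2) \<partial>torus) + 2 * (\<integral>\<^sup>+x. ennreal ((norm (G x - q x))\<^sup>2) \<partial>torus)"
    by (rule nn_integral_norm_add_square_le) measurable
  also have "\<dots> < 2 * ennreal (\<epsilon> / 4) + 2 * ennreal (\<epsilon> / 4)"
    using p(2) q(2) by (intro add_strict_mono ennreal_mult_strict_left_mono) auto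
  also have "\<dots> = ennreal \<epsilon>"
    using \<open>\<epsilon> > 0\<close> by (simp add: ennreal_mult[symmetric] ennreal_plus[symmetric] flip: ennreal_numeral del: ennreal_plus)
  finally show "\<exists>p. trig p \<and> (\<integral>\<^sup>+x. ennreal ((norm (F x + G x - p x))\<^sup>2) \<partial>torus) < ennreal \<epsilon>"
    using trig.add[OF p(1) q(1)] by blast
qed

lemma trig_limit_cmult:
  assumes F: "trig_limit F"
  shows "trig_limit (\<lambda>x. c * F x)"
proof (cases "c = 0")
  case False
  have [measurable]: "F \<in> borel_measurable borel"
    using assms by (simp_all add: trig_limit_def)
  show ?thesis
    unfolding trig_limit_def
  proof (intro conjI allI impI)
    show "(\<lambda>x. c * F x) \<in> borel_measurable borel" by measurable
    fix \<epsilon> :: real assume "\<epsilon> > 0"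
    then obtain p where p: "trig p" "(\<integral>\<^sup>+x. ennreal ((norm (F x - p x))\<^sup>2) \<partial>torus) < ennreal (\<epsilon> / (norm c)\<^sup>2)"
      using F False unfolding trig_limit_def by (meson divide_pos_pos zero_less_power zero_less_norm_iff)
    note [measurable] = trig_measurable[OF p(1)]
    have "(\<integral>\<^sup>+x. ennreal ((norm (c * F x - c * p x))\<^sup>2) \<partial>torus)
       = (\<integral>\<^sup>+x. ennreal ((norm c)\<^sup>2) * ennreal ((norm (F x - p x))\<^sup>2) \<partial>torus)"
      by (simp add: norm_mult power_mult_distrib ennreal_mult flip: right_diff_distrib)
    also have "\<dots> = ennreal ((norm c)\<^sup>2) * (\<integral>\<^sup>+x. ennreal ((norm (F x - p x))\<^sup>2) \<partial>torus)"
      by (rule nn_integral_cmult) measurable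
    also have "\<dots> < ennreal ((norm c)\<^sup>2) * ennreal (\<epsilon> / (norm c)\<^sup>2)"
      using p(2) False by (intro ennreal_mult_strict_left_mono) auto
    also have "\<dots> = ennreal \<epsilon>"
      using \<open>\<epsilon> > 0\<close> False by (simp add: ennreal_mult[symmetric])
    finally show "\<exists>p. trig p \<and> (\<integral>\<^sup>+x. ennreal ((norm (c * F x - p x))\<^sup>2) \<partial>torus) < ennreal \<epsilon>"
      using trig_mult[OF trig_const p(1), of c] by blast
  qed
qed (simp add: trig_limit_trig trig_const)

lemma trig_limit_sum:
  "finite I \<Longrightarrow> (\<And>i. i \<in> I \<Longrightarrow> trig_limit (f i)) \<Longrightarrow> trig_limit (\<lambda>x. \<Sum>i\<in>I. f i x)"
  by (induction rule: finite_induct) (auto intro: trig_limit_trig[OF trig_const] trig_limit_add)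

text \<open>Dominated convergence makes the mean-square distances tend to 0. This closure property
  carries the approximation from continuous functions to indicators of open sets, then to Borel
  sets, then to all square-integrable functions.\<close>

lemma trig_limit_dominated:
  fixes F :: "real^'n \<Rightarrow> complex"
  assumes G: "\<And>n. trig_limit (G n)" and F [measurable]: "F \<in> borel_measurable borel"
    and lim: "AE x in torus. (\<lambda>n. G n x) \<longlonglongrightarrow> F x"
    and w [measurable]: "w \<in> borel_measurable borel"
    and bound: "\<And>n. AE x in torus. norm (G n x - F x) \<le> w x"
    and fin: "(\<integral>\<^sup>+x. ennreal ((w x)\<^sup>2) \<partial>torus) < \<infinity>"
  shows "trig_limit F"
proof (rule trig_limit_close[OF F])
  have [measurable]: "G n \<in> borel_measurable borel" for n
    using G by (simp add: trig_limit_def)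
  have "(\<lambda>n. \<integral>\<^sup>+x. ennreal ((norm (F x - G n x))\<^sup>2) \<partial>torus) \<longlonglongrightarrow> (\<integral>\<^sup>+x. 0 \<partial>(torus :: (real^'n) measure))"
  proof (rule nn_integral_dominated_convergence[where u'="\<lambda>x. 0" and w="\<lambda>x. ennreal ((w x)\<^sup>2)"])
    show "AE x in torus. ennreal ((norm (F x - G n x))\<^sup>2) \<le> ennreal ((w x)\<^sup>2)" for n
      using bound[of n] by eventually_elim (auto intro!: ennreal_leI power_mono simp: norm_minus_commute)
    show "AE x in torus. (\<lambda>n. ennreal ((norm (F x - G n x))\<^sup>2)) \<longlonglongrightarrow> 0"
      using lim
    proof eventually_elim
      case (elim x)
      have "(\<lambda>n. ennreal ((norm (F x - G n x))\<^sup>2)) \<longlonglongrightarrow> ennreal ((norm (F x - F x))\<^sup>2)"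
        by (intro tendsto_intros elim)
      then show ?case by simp
    qed
  qed (use fin in auto)
  then have lim0: "(\<lambda>n. \<integral>\<^sup>+x. ennreal ((norm (F x - G n x))\<^sup>2) \<partial>torus) \<longlonglongrightarrow> 0" by simp
  fix \<epsilon> :: real assume "\<epsilon> > 0"
  then have "eventually (\<lambda>n. (\<integral>\<^sup>+x. ennreal ((norm (F x - G n x))\<^sup>2) \<partial>torus) < ennreal \<epsilon>) sequentially"
    by (intro order_tendstoD[OF lim0]) auto
  then show "\<exists>G. trig_limit G \<and> (\<integral>\<^sup>+x. ennreal ((norm (F x - G x))\<^sup>2) \<partial>torus) < ennreal \<epsilon>"
    using G by (auto simp: eventually_sequentially)
qed

lemma trig_limit_continuous:
  fixes h :: "complex^'n \<Rightarrow> real"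
  assumes h: "continuous_on UNIV h"
  shows "trig_limit (\<lambda>x. complex_of_real (h (torus_embed x)))"
  unfolding trig_limit_def
proof (intro conjI allI impI)
  interpret prob_space "torus :: (real^'n) measure" by (rule prob_space_torus)
  have "continuous_on UNIV (\<lambda>x. h (torus_embed x))"
    using continuous_on_compose2[OF h continuous_torus_embed] by auto
  from borel_measurable_continuous_onI[OF this]
  show "(\<lambda>x. complex_of_real (h (torus_embed x))) \<in> borel_measurable borel" by measurable
  fix \<epsilon> :: real assume e: "\<epsilon> > 0"
  have "compact (torus_embed ` cbox (0::real^'n) 1)"
    by (intro compact_continuous_image continuous_torus_embed compact_cbox)
  \<comment> \<open>The uniform error \<open>sqrt (\<epsilon> / 2)\<close> squares to half of
    \<epsilon>, and the torus has total mass 1, so the mean-square error is strictly below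
    \<epsilon>.\<close>
  then obtain p where p: "real_polynomial_function p"
    "\<And>v. v \<in> torus_embed ` cbox (0::real^'n) 1 \<Longrightarrow> \<bar>h v - p v\<bar> < sqrt (\<epsilon> / 2)"
    using Stone_Weierstrass_real_polynomial_function[of "torus_embed ` cbox (0::real^'n) 1" h "sqrt (\<epsilon> / 2)"]
      continuous_on_subset[OF h] e by auto
  let ?p = "\<lambda>x. complex_of_real (p (torus_embed x))"
  have "(\<integral>\<^sup>+x. ennreal ((norm (complex_of_real (h (torus_embed x)) - ?p x))\<^sup>2) \<partial>torus)
      \<le> (\<integral>\<^sup>+x. ennreal (\<epsilon> / 2) \<partial>(torus :: (real^'n) measure))"
  proof (rule nn_integral_mono_AE)
    show "AE x::real^'n in torus. ennreal ((norm (complex_of_real (h (torus_embed x)) - ?p x))\<^sup>2) \<le> ennreal (\<epsilon> / 2)"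
      using torus_box
    proof eventually_elim
      case (elim x)
      then have "x \<in> cbox 0 1" using box_subset_cbox by blast
      then have "\<bar>h (torus_embed x) - p (torus_embed x)\<bar>\<^sup>2 \<le> (sqrt (\<epsilon> / 2))\<^sup>2"
        by (intro power_mono[OF less_imp_le[OF p(2)]]) auto
      moreover have "norm (complex_of_real (h (torus_embed x)) - ?p x) = \<bar>h (torus_embed x) - p (torus_embed x)\<bar>"
        by (metis norm_of_real of_real_diff)
      ultimately show ?case
        using e by (intro ennreal_leI) simp
    qed
  qed
  also have "\<dots> = ennreal (\<epsilon> / 2)"
    using emeasure_space_1 by simp
  also have "\<dots> < ennreal \<epsilon>"
    using e by (simp add: ennreal_less_iff)
  finally show "\<exists>p. trig p \<and> (\<integral>\<^sup>+x. ennreal ((norm (complex_of_real (h (torus_embed x)) - p x))\<^sup>2) \<partial>torus) < ennreal \<epsilon>"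
    using trig_polynomial[OF p(1)] by blast
qed

text \<open>Equal images force each coordinate difference to be an integer. With one point in the
  open cube and the other in the closed cube it is smaller than 1 in absolute value; with both on
  the boundary, opposite faces would be identified.\<close>

lemma torus_embed_inj:
  assumes "torus_embed x = torus_embed y" "x \<in> box 0 1" "y \<in> cbox 0 1"
  shows "x = y"
proof -
  have "x $ i = y $ i" for i
  proof -
    have "cis (2 * pi * (x $ i - y $ i)) = 1"
      using assms(1) cis_mult[of "2 * pi * x $ i" "- (2 * pi * y $ i)"]
      by (simp add: torus_embed_def vec_eq_iff algebra_simps cis_mult)
    then have "cos (2 * pi * (x $ i - y $ i)) = 1"
      by (simp add: complex_eq_iff)
    then obtain k :: int where "2 * pi * (x $ i - y $ i) = of_int k * 2 * pi"
      unfolding cos_one_2pi_int by auto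
    then have k: "x $ i - y $ i = of_int k" by simp
    moreover have "\<bar>x $ i - y $ i\<bar> < 1"
      using assms(2,3) by (auto simp: mem_box_cart abs_less_iff) (smt (verit, best))+
    ultimately have "k = 0" by linarith
    then show ?thesis using k by simp
  qed
  then show ?thesis by (simp add: vec_eq_iff)
qed

text \<open>
  The indicator is approximated by truncated multiples of the distance, within the embedded torus,
  to the image of the complement; \<open>A\<close> has to avoid the faces of the cube, on which \<open>torus_embed\<close> is
  not injective.
\<close>

lemma trig_limit_indicator_open:
  fixes A :: "(real^'n) set"
  assumes A: "open A" "A \<subseteq> box 0 1"
  shows "trig_limit (indicator A)"
proof -
  interpret prob_space "torus :: (real^'n) measure" by (rule prob_space_torus)
  have [measurable]: "A \<in> sets borel" using A by simp
  let ?K = "torus_embed ` (cbox (0::real^'n) 1 - A)"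
  have K: "compact ?K"
    using A by (intro compact_continuous_image continuous_torus_embed compact_diff compact_cbox)
  \<comment> \<open>The corner 0 belongs to the closed cube but not to the open one. It makes
    \<open>?K\<close> nonempty; the distance to an empty set would be 0 by convention.\<close>
  have "(0::real^'n) \<in> cbox 0 1 - A"
    using A by (auto simp: mem_box_cart subset_iff)
  then have K0: "?K \<noteq> {}" by blast
  define G where "G n x = complex_of_real (min 1 (real n * infdist (torus_embed x) ?K))" for n and x :: "real^'n"
  show ?thesis
  proof (rule trig_limit_dominated[where G=G and w="\<lambda>_. 1"])
    show "trig_limit (G n)" for n
      unfolding G_def by (rule trig_limit_continuous[of "\<lambda>v. min 1 (real n * infdist v ?K)"])
        (intro continuous_intros)
    show "AE x in torus. (\<lambda>n. G n x) \<longlonglongrightarrow> indicator A x"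
      using torus_box
    proof eventually_elim
      case (elim x)
      show ?case
      proof (cases "x \<in> A")
        case True
        have "torus_embed x \<notin> ?K"
          using torus_embed_inj[OF _ elim] True by auto
        then have "infdist (torus_embed x) ?K > 0"
          using K K0 by (metis compact_imp_closed in_closed_iff_infdist_zero infdist_nonneg less_eq_real_def)
        then obtain N where "1 < real N * infdist (torus_embed x) ?K"
          using reals_Archimedean3 by blast
        then have "1 \<le> real n * infdist (torus_embed x) ?K" if "n \<ge> N" for n
          using that by (smt (verit) infdist_nonneg mult_right_mono of_nat_le_iff)
        then have "G n x = 1" if "n \<ge> N" for n
          using that by (simp add: G_def min_def)
        then show ?thesis
          using True by (auto intro!: tendsto_eventually eventually_sequentiallyI[of N])
      next
        case False
        then have "torus_embed x \<in> ?K" using elim box_subset_cbox by blast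
        then show ?thesis using False by (simp add: G_def)
      qed
    qed
    show "AE x in torus. norm (G n x - indicator A x) \<le> 1" for n
    proof (rule AE_I2)
      fix x :: "real^'n"
      define m where "m = min 1 (real n * infdist (torus_embed x) ?K)"
      have "0 \<le> m" "m \<le> 1" by (auto simp: m_def infdist_nonneg)
      moreover have "G n x - indicator A x = complex_of_real (m - indicator A x)"
        by (simp add: G_def m_def indicator_def)
      ultimately show "norm (G n x - indicator A x) \<le> 1"
        by (simp only: norm_of_real) (auto simp: indicator_def)
    qed
  qed (use emeasure_space_1 in auto)
qed

text \<open>Induction over the Borel sets from the intersection-stable generator of open sets. Every
  set is cut with the open cube so that the base case applies; complements are differences of
  indicators, and the partial sums of a disjoint union stay within distance 1 of their
  limit.\<close>

lemma trig_limit_indicator: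
  fixes A :: "(real^'n) set"
  assumes "A \<in> sets borel"
  shows "trig_limit (indicator (A \<inter> box 0 1))"
proof -
  interpret prob_space "torus :: (real^'n) measure" by (rule prob_space_torus)
  have "Int_stable {S::(real^'n) set. open S}" "{S::(real^'n) set. open S} \<subseteq> Pow UNIV"
    "A \<in> sigma_sets UNIV {S. open S}"
    using assms by (auto simp: Int_stable_def borel_def)
  then show ?thesis
  proof (induction rule: sigma_sets_induct_disjoint)
    case (basic A)
    then show ?case by (intro trig_limit_indicator_open) auto
  next
    case empty
    show ?case using trig_limit_trig[OF trig_const[of 0]] by simp
  next
    case (compl A)
    have "trig_limit (\<lambda>x. indicator (box 0 1) x + (-1) * indicator (A \<inter> box 0 1) x)"
      by (intro trig_limit_add trig_limit_cmult compl.IH trig_limit_indicator_open) auto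
    also have "(\<lambda>x. indicator (box 0 1) x + (-1) * indicator (A \<inter> box 0 1) x) = (indicator ((UNIV - A) \<inter> box 0 1) :: _ \<Rightarrow> complex)"
      by (auto simp: indicator_def)
    finally show ?case .
  next
    case (union A)
    have [measurable]: "A i \<in> sets borel" for i using union by (simp add: borel_def range_subsetD)
    show ?case
    proof (rule trig_limit_dominated[where G="\<lambda>n x. \<Sum>i<n. indicator (A i \<inter> box 0 1) x" and w="\<lambda>_. 1"])
      show "trig_limit (\<lambda>x. \<Sum>i<n. indicator (A i \<inter> box 0 1) x)" for n
        by (intro trig_limit_sum union.IH) auto
      have eq: "(\<Sum>i<n. indicator (A i \<inter> box 0 1) x) = (indicator (\<Union>i<n. A i \<inter> box 0 1) x :: complex)" for n x
        using union(1) by (intro indicator_UN_disjoint[symmetric]) (auto simp: disjoint_family_on_def)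
      have "(\<lambda>n. indicator (\<Union>i<n. A i \<inter> box 0 1) x :: complex) \<longlonglongrightarrow> indicator (\<Union>i. A i \<inter> box 0 1) x" for x
        by (rule LIMSEQ_indicator_UN)
      then show "AE x in torus. (\<lambda>n. \<Sum>i<n. indicator (A i \<inter> box 0 1) x) \<longlonglongrightarrow> (indicator (\<Union> (range A) \<inter> box 0 1) x :: complex)"
        unfolding eq by (simp add: UN_simps)
      show "AE x in torus. norm ((\<Sum>i<n. indicator (A i \<inter> box 0 1) x) - (indicator (\<Union> (range A) \<inter> box 0 1) x :: complex)) \<le> 1" for n
        unfolding eq by (intro AE_I2) (auto simp: indicator_def)
    qed (use emeasure_space_1 in auto)
  qed
qed

text \<open>Simple functions \<open>s i\<close> converge to \<open>F\<close> with norm at most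
  \<open>2 * norm (F x)\<close>, so the error is dominated by \<open>3 * norm (F x)\<close>, which
  is square integrable; each simple function is a finite combination of indicators.\<close>

lemma trig_limit_L2:
  fixes F :: "real^'n \<Rightarrow> complex"
  assumes [measurable]: "F \<in> borel_measurable borel"
    and fin: "(\<integral>\<^sup>+x. ennreal ((norm (F x))\<^sup>2) \<partial>torus) < \<infinity>"
  shows "trig_limit F"
proof -
  have "F \<in> borel_measurable borel" by measurable
  from borel_measurable_implies_sequence_metric[OF this, of 0] obtain s where
    s: "\<And>i. simple_function borel (s i)" "\<And>x. (\<lambda>i. s i x) \<longlonglongrightarrow> F x"
       "\<And>i x. norm (s i x) \<le> 2 * norm (F x)"
    by simp metis
  show ?thesis
  proof (rule trig_limit_dominated[where G="\<lambda>i x. indicator (box 0 1) x * s i x" and w="\<lambda>x. 3 * norm (F x)"])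
    fix i
    have fs: "finite (range (s i))" and ms: "s i -` {y} \<in> sets borel" for y
      using simple_functionD(1)[OF s(1)[of i]] simple_functionD(2)[OF s(1)[of i], of "{y}"] by simp_all
    have "indicator (box 0 1) x * s i x = (\<Sum>y\<in>range (s i). y * indicator (s i -` {y} \<inter> box 0 1) x)" for x :: "real^'n"
    proof -
      have "s i x = (\<Sum>y\<in>range (s i). indicator (s i -` {y}) x *\<^sub>R y)"
        using simple_function_indicator_representation_banach[OF s(1)[of i], of x]
        unfolding space_borel Int_UNIV_right by blast
      then have "indicator (box 0 1) x * s i x = indicator (box 0 1) x * (\<Sum>y\<in>range (s i). indicator (s i -` {y}) x *\<^sub>R y)"
        by (rule arg_cong[where f="\<lambda>t. indicator (box 0 1) x * t"])
      also have "\<dots> = (\<Sum>y\<in>range (s i). y * indicator (s i -` {y} \<inter> box 0 1) x)"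
        unfolding sum_distrib_left by (intro sum.cong refl) (auto simp: indicator_def)
      finally show ?thesis .
    qed
    then show "trig_limit (\<lambda>x. indicator (box 0 1) x * s i x)"
      using fs ms by (simp only:) (intro trig_limit_sum trig_limit_cmult trig_limit_indicator)
  next
    show "AE x in torus. (\<lambda>i. indicator (box 0 1) x * s i x) \<longlonglongrightarrow> F x"
      using torus_box by eventually_elim (use s(2) in auto)
    show "AE x in torus. norm (indicator (box 0 1) x * s i x - F x) \<le> 3 * norm (F x)" for i
      using torus_box
    proof eventually_elim
      case (elim x)
      then show ?case using norm_triangle_ineq4[of "s i x" "F x"] s(3)[of i x] by simp
    qed
    have "(\<integral>\<^sup>+x. ennreal ((3 * norm (F x))\<^sup>2) \<partial>torus) = 9 * (\<integral>\<^sup>+x. ennreal ((norm (F x))\<^sup>2) \<partial>torus)"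
      by (simp add: power_mult_distrib ennreal_mult nn_integral_cmult)
    also have "\<dots> < \<infinity>" using fin by (simp add: ennreal_mult_less_top)
    finally show "(\<integral>\<^sup>+x. ennreal ((3 * norm (F x))\<^sup>2) \<partial>torus) < \<infinity>" .
  qed measurable
qed

section \<open>Parseval's identity on the torus\<close>

lemma square_integrable_torus:
  fixes F :: "real^'n \<Rightarrow> complex"
  assumes [measurable]: "F \<in> borel_measurable borel" and "integrable torus (\<lambda>x. (norm (F x))\<^sup>2)"
  shows "integrable torus F"
proof (rule Bochner_Integration.integrable_bound)
  interpret prob_space "torus :: (real^'n) measure" by (rule prob_space_torus)
  show "integrable torus (\<lambda>x. 1 + (norm (F x))\<^sup>2)" using assms by simp
  show "AE x in torus. norm (F x) \<le> norm (1 + (norm (F x))\<^sup>2)"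
  proof (rule AE_I2)
    fix x
    have "0 \<le> (norm (F x) - 1)\<^sup>2" by simp
    then have "2 * norm (F x) \<le> 1 + (norm (F x))\<^sup>2"
      by (simp add: power2_diff)
    then have "norm (F x) \<le> 1 + (norm (F x))\<^sup>2"
      using norm_ge_zero[of "F x"] by linarith
    then show "norm (F x) \<le> norm (1 + (norm (F x))\<^sup>2)" by simp
  qed
qed simp

lemma norm_diff_square_complex:
  "(norm (g - b))\<^sup>2 = (norm g)\<^sup>2 - 2 * Re (cnj b * g) + (norm (b::complex))\<^sup>2"
  by (simp add: cmod_power2 power2_diff algebra_simps)

text \<open>Frequencies are removed one at a time. By orthogonality the residual \<open>G\<close>
  still has the coefficient \<open>c w\<close> at a new frequency \<open>w\<close>, so subtracting
  \<open>b w * echar (- w) x\<close> changes the squared norm by exactly the summand for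
  \<open>w\<close>. Arbitrary \<open>b\<close> lets one identity give both Bessel's inequality and
  the distance to any trigonometric polynomial.\<close>

lemma torus_distance_identity:
  fixes F :: "real^'n \<Rightarrow> complex"
  defines "c \<equiv> \<lambda>z. \<integral>x. F x * echar z x \<partial>torus"
  assumes F [measurable]: "F \<in> borel_measurable borel" and int: "integrable torus (\<lambda>x. (norm (F x))\<^sup>2)"
    and "finite K" "K \<subseteq> int_points"
  shows "integrable torus (\<lambda>x. (norm (F x - (\<Sum>z\<in>K. b z * echar (- z) x)))\<^sup>2) \<and>
    (\<integral>x. (norm (F x - (\<Sum>z\<in>K. b z * echar (- z) x)))\<^sup>2 \<partial>torus)
      = (\<integral>x. (norm (F x))\<^sup>2 \<partial>torus) + (\<Sum>z\<in>K. (norm (c z - b z))\<^sup>2 - (norm (c z))\<^sup>2)"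
  using assms(4,5)
proof (induction K rule: finite_induct)
  case empty
  then show ?case using int by simp
next
  case (insert w K)
  interpret prob_space "torus :: (real^'n) measure" by (rule prob_space_torus)
  define G where "G x = F x - (\<Sum>z\<in>K. b z * echar (- z) x)" for x
  have [measurable]: "G \<in> borel_measurable borel" unfolding G_def by measurable
  have w: "w \<in> int_points" and K: "K \<subseteq> int_points" using insert by auto
  have IH: "integrable torus (\<lambda>x. (norm (G x))\<^sup>2)"
    "(\<integral>x. (norm (G x))\<^sup>2 \<partial>torus) = (\<integral>x. (norm (F x))\<^sup>2 \<partial>torus) + (\<Sum>z\<in>K. (norm (c z - b z))\<^sup>2 - (norm (c z))\<^sup>2)"
    using insert.IH[OF K] by (simp_all add: G_def)
  have bd: "integrable torus (\<lambda>x. f x * echar w x)"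
    if "integrable torus f" for f :: "real^'n \<Rightarrow> complex"
  proof (rule Bochner_Integration.integrable_bound[OF that])
    have [measurable]: "f \<in> borel_measurable borel"
      using borel_measurable_integrable[OF that] by simp
    show "(\<lambda>x. f x * echar w x) \<in> borel_measurable torus"
      by measurable
  qed (simp add: norm_mult)
  have iF: "integrable torus (\<lambda>x. F x * echar w x)"
    and iG: "integrable torus (\<lambda>x. G x * echar w x)"
    using IH(1) int by (auto intro!: bd square_integrable_torus)
  have ie: "integrable torus (\<lambda>x. b z * echar (- z) x * echar w x)" for z
    by (intro bd integrable_const_bound[of _ "norm (b z)"]) (auto simp: norm_mult)
  have "G x * echar w x = F x * echar w x - (\<Sum>z\<in>K. b z * echar (- z) x * echar w x)" for x
    by (simp add: G_def algebra_simps sum_distrib_left sum_distrib_right)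
  then have "(\<integral>x. G x * echar w x \<partial>torus) = c w - (\<Sum>z\<in>K. \<integral>x. b z * echar (- z) x * echar w x \<partial>torus)"
    using iF ie by (simp add: c_def)
  also have "(\<Sum>z\<in>K. \<integral>x. b z * echar (- z) x * echar w x \<partial>torus) = 0"
  proof (rule sum.neutral, rule ballI)
    fix z assume z: "z \<in> K"
    have "(\<integral>x. b z * echar (- z) x * echar w x \<partial>torus) = b z * (\<integral>x. echar (- z + w) x \<partial>torus)"
      by (simp only: echar_add_left mult.assoc integral_mult_right_zero)
    also have "(\<integral>x. echar (- z + w) x \<partial>torus) = 0"
      using integral_echar[of "- z + w"] z K w insert.hyps by (auto simp: subset_iff)
    finally show "(\<integral>x. b z * echar (- z) x * echar w x \<partial>torus) = 0" by simp
  qed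
  finally have Gw: "(\<integral>x. G x * echar w x \<partial>torus) = c w" by simp
  have sq: "(norm (F x - (\<Sum>z\<in>insert w K. b z * echar (- z) x)))\<^sup>2
      = (norm (G x))\<^sup>2 - 2 * Re (cnj (b w) * (G x * echar w x)) + (norm (b w))\<^sup>2" for x
  proof -
    have "F x - (\<Sum>z\<in>insert w K. b z * echar (- z) x) = G x - b w * echar (- w) x"
      using insert.hyps by (simp add: G_def)
    then show ?thesis
      by (simp only: norm_diff_square_complex) (simp add: norm_mult cnj_echar ac_simps)
  qed
  have iR: "integrable torus (\<lambda>x. 2 * Re (cnj (b w) * (G x * echar w x)))"
    using iG by (intro integrable_mult_right integrable_Re) auto
  have "(\<integral>x. (norm (G x))\<^sup>2 - 2 * Re (cnj (b w) * (G x * echar w x)) + (norm (b w))\<^sup>2 \<partial>torus)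
      = (\<integral>x. (norm (G x))\<^sup>2 \<partial>torus) - 2 * Re (cnj (b w) * c w) + (norm (b w))\<^sup>2"
  proof -
    have "(\<integral>x. Re (cnj (b w) * (G x * echar w x)) \<partial>torus) = Re (\<integral>x. cnj (b w) * (G x * echar w x) \<partial>torus)"
      using iG by (intro integral_Re) auto
    then show ?thesis
      using IH(1) iR Gw prob_space by (simp del: times_complex.simps)
  qed
  then show ?case
    unfolding sq using IH iR insert.hyps by (simp add: norm_diff_square_complex)
qed

text \<open>With \<open>b = c\<close> the distance identity is Bessel's inequality, which bounds all
  finite sums from above. Applied to the coefficients of a close trigonometric polynomial, it shows
  that the sum over the frequencies of that polynomial already comes within \<epsilon> of the
  norm.\<close>

lemma torus_parseval:
  fixes F :: "real^'n \<Rightarrow> complex"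
  assumes F [measurable]: "F \<in> borel_measurable borel" and int: "integrable torus (\<lambda>x. (norm (F x))\<^sup>2)"
  shows "((\<lambda>z. (norm (\<integral>x. F x * echar z x \<partial>torus))\<^sup>2) has_sum (\<integral>x. (norm (F x))\<^sup>2 \<partial>torus)) int_points"
proof -
  define c where "c z = (\<integral>x. F x * echar z x \<partial>torus)" for z
  note ident = torus_distance_identity[OF F int, folded c_def]
  have bessel: "(\<Sum>z\<in>K. (norm (c z))\<^sup>2) \<le> (\<integral>x. (norm (F x))\<^sup>2 \<partial>torus)" if K: "finite K" "K \<subseteq> int_points" for K
  proof -
    have "0 \<le> (\<integral>x. (norm (F x - (\<Sum>z\<in>K. c z * echar (- z) x)))\<^sup>2 \<partial>torus)" by simp
    then show ?thesis
      using ident[OF K, of c] by (simp add: sum_negf)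
  qed
  have nF: "(\<integral>\<^sup>+x. ennreal ((norm (F x))\<^sup>2) \<partial>torus) < \<infinity>"
    using int by (simp add: nn_integral_eq_integral)
  have "((\<lambda>z. (norm (c z))\<^sup>2) has_sum (\<integral>x. (norm (F x))\<^sup>2 \<partial>torus)) int_points"
    unfolding has_sum_def tendsto_iff
  proof (intro allI impI)
    fix \<epsilon> :: real assume e: "\<epsilon> > 0"
    obtain p where p: "trig p" "(\<integral>\<^sup>+x. ennreal ((norm (F x - p x))\<^sup>2) \<partial>torus) < ennreal \<epsilon>"
      using trig_limit_L2[OF F nF] e unfolding trig_limit_def by blast
    obtain K b where K: "finite K" "K \<subseteq> int_points" "p = (\<lambda>x. \<Sum>z\<in>K. b z * echar (- z) x)"
      using trig_representation[OF p(1)] by blast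
    have "ennreal (\<integral>x. (norm (F x - p x))\<^sup>2 \<partial>torus) < ennreal \<epsilon>"
      using p(2) ident[OF K(1,2), of b] by (subst (asm) nn_integral_eq_integral) (auto simp: K(3))
    then have "(\<integral>x. (norm (F x - p x))\<^sup>2 \<partial>torus) < \<epsilon>"
      using e by (simp add: ennreal_less_iff)
    \<comment> \<open>The squares of \<open>c z - b z\<close> in the identity are nonnegative and
      are dropped.\<close>
    moreover have "(\<integral>x. (norm (F x - p x))\<^sup>2 \<partial>torus) \<ge> (\<integral>x. (norm (F x))\<^sup>2 \<partial>torus) - (\<Sum>z\<in>K. (norm (c z))\<^sup>2)"
      using ident[OF K(1,2), of b] sum_nonneg[of K "\<lambda>z. (norm (c z - b z))\<^sup>2"]
      by (simp add: K(3) sum_subtractf)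
    ultimately have lower: "(\<integral>x. (norm (F x))\<^sup>2 \<partial>torus) - \<epsilon> < (\<Sum>z\<in>K. (norm (c z))\<^sup>2)" by simp
    have "dist (\<Sum>z\<in>Y. (norm (c z))\<^sup>2) (\<integral>x. (norm (F x))\<^sup>2 \<partial>torus) < \<epsilon>"
      if Y: "finite Y" "K \<subseteq> Y" "Y \<subseteq> int_points" for Y
    proof -
      have "(\<Sum>z\<in>K. (norm (c z))\<^sup>2) \<le> (\<Sum>z\<in>Y. (norm (c z))\<^sup>2)"
        using Y by (intro sum_mono2) auto
      then show ?thesis
        using bessel[OF Y(1,3)] lower by (simp add: dist_real_def)
    qed
    then show "\<forall>\<^sub>F Y in finite_subsets_at_top int_points.
        dist (\<Sum>z\<in>Y. (norm (c z))\<^sup>2) (\<integral>x. (norm (F x))\<^sup>2 \<partial>torus) < \<epsilon>"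
      unfolding eventually_finite_subsets_at_top using K by blast
  qed
  then show ?thesis by (simp add: c_def)
qed

lemma nn_integral_torus_parseval:
  fixes F :: "real^'n \<Rightarrow> complex"
  assumes F [measurable]: "F \<in> borel_measurable borel" and fin: "(\<integral>\<^sup>+x. ennreal ((norm (F x))\<^sup>2) \<partial>torus) < \<infinity>"
  shows "(\<integral>\<^sup>+z. ennreal ((norm (\<integral>x. F x * echar z x \<partial>torus))\<^sup>2) \<partial>count_space int_points)
    = (\<integral>\<^sup>+x. ennreal ((norm (F x))\<^sup>2) \<partial>torus)"
proof -
  have int: "integrable torus (\<lambda>x. (norm (F x))\<^sup>2)"
    using fin by (intro integrableI_bounded) auto
  have "(\<integral>\<^sup>+x. ennreal ((norm (F x))\<^sup>2) \<partial>torus) = ennreal (\<integral>x. (norm (F x))\<^sup>2 \<partial>torus)"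
    using int by (rule nn_integral_eq_integral) simp
  moreover have "(\<integral>\<^sup>+z. ennreal ((norm (\<integral>x. F x * echar z x \<partial>torus))\<^sup>2) \<partial>count_space int_points)
     = ennreal (\<integral>x. (norm (F x))\<^sup>2 \<partial>torus)"
    by (rule nn_integral_of_has_sum[OF _ _ torus_parseval[OF F int]]) auto
  ultimately show ?thesis by simp
qed

section \<open>A perturbed Parseval identity for lattices\<close>

text \<open>Let \<open>t\<close> be the sum of the absolute values. Then \<open>t * t\<close>
  expands into \<open>q + r\<close>, which gives the upper bound. For the lower bound,
  \<open>s\<close> is split into \<open>a w\<close> and the rest, and the product of
  \<open>a w\<close> with the rest is estimated in absolute value, so that no double series of
  complex products has to be rearranged.\<close>

lemma norm_sum_square_bounds:
  fixes a :: "'i \<Rightarrow> complex"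
  assumes int: "integrable (count_space I) a"
  defines "s \<equiv> \<integral>w. a w \<partial>count_space I"
    and "q \<equiv> \<integral>\<^sup>+w. ennreal ((norm (a w))\<^sup>2) \<partial>count_space I"
    and "r \<equiv> \<integral>\<^sup>+w. ennreal (norm (a w)) * (\<integral>\<^sup>+v. ennreal (norm (a v)) \<partial>count_space (I - {w})) \<partial>count_space I"
  shows "ennreal ((norm s)\<^sup>2) \<le> q + r" "q \<le> ennreal ((norm s)\<^sup>2) + r"
proof -
  define t where "t = (\<integral>\<^sup>+w. ennreal (norm (a w)) \<partial>count_space I)"
  have tail: "(\<integral>\<^sup>+v. ennreal (norm (a v)) \<partial>count_space (I - {w}))
      = (\<integral>\<^sup>+v. ennreal (norm (a v)) * indicator (- {w}) v \<partial>count_space I)" for w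
    by (simp add: nn_integral_count_space_indicator) (auto intro!: nn_integral_cong simp: indicator_def)
  have split: "t = ennreal (norm (a w)) + (\<integral>\<^sup>+v. ennreal (norm (a v)) \<partial>count_space (I - {w}))" if w: "w \<in> I" for w
  proof -
    have "t = (\<integral>\<^sup>+v. ennreal (norm (a v)) * indicator {w} v + ennreal (norm (a v)) * indicator (- {w}) v \<partial>count_space I)"
      unfolding t_def by (intro nn_integral_cong) (auto simp: indicator_def)
    also have "\<dots> = (\<integral>\<^sup>+v. ennreal (norm (a v)) * indicator {w} v \<partial>count_space I) + (\<integral>\<^sup>+v. ennreal (norm (a v)) * indicator (- {w}) v \<partial>count_space I)"
      by (rule nn_integral_add) auto
    also have "(\<integral>\<^sup>+v. ennreal (norm (a v)) * indicator {w} v \<partial>count_space I) = ennreal (norm (a w))"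
      using w by (subst nn_integral_count_space'[of "{w}"]) auto
    finally show ?thesis by (simp add: tail)
  qed
  have tt: "t * t = q + r"
  proof -
    have "t * t = (\<integral>\<^sup>+w. ennreal (norm (a w)) * t \<partial>count_space I)"
      by (subst nn_integral_multc) (auto simp: t_def)
    also have "\<dots> = (\<integral>\<^sup>+w. ennreal ((norm (a w))\<^sup>2) + ennreal (norm (a w)) * (\<integral>\<^sup>+v. ennreal (norm (a v)) \<partial>count_space (I - {w})) \<partial>count_space I)"
    proof (rule nn_integral_cong)
      fix w assume "w \<in> space (count_space I)"
      then show "ennreal (norm (a w)) * t = ennreal ((norm (a w))\<^sup>2) + ennreal (norm (a w)) * (\<integral>\<^sup>+v. ennreal (norm (a v)) \<partial>count_space (I - {w}))"
        using split[of w] by (simp add: distrib_left power2_eq_square ennreal_mult)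
    qed
    also have "\<dots> = q + r" unfolding q_def r_def by (rule nn_integral_add) auto
    finally show ?thesis .
  qed
  have st: "ennreal (norm s) \<le> t"
    unfolding s_def t_def using int by (rule integral_norm_bound_ennreal)
  have "ennreal ((norm s)\<^sup>2) = ennreal (norm s) * ennreal (norm s)"
    by (simp add: power2_eq_square ennreal_mult)
  also have "\<dots> \<le> t * t" using st by (intro mult_mono) auto
  finally show "ennreal ((norm s)\<^sup>2) \<le> q + r" by (simp add: tt)
  have d: "ennreal (norm (s - a w)) \<le> (\<integral>\<^sup>+v. ennreal (norm (a v)) \<partial>count_space (I - {w}))" if w: "w \<in> I" for w
  proof -
    have i1: "integrable (count_space I) (\<lambda>v. indicator {w} v *\<^sub>R a w)"
      using w by (intro integrable_scaleR_left) (auto simp: measure_count_space)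
    have i2: "(\<integral>v. indicator {w} v *\<^sub>R a w \<partial>count_space I) = a w"
      using w by (subst integral_scaleR_left) (auto simp: measure_count_space)
    have "s - a w = (\<integral>v. a v - indicator {w} v *\<^sub>R a w \<partial>count_space I)"
      unfolding s_def by (subst Bochner_Integration.integral_diff) (auto simp: int i1 i2)
    also have "ennreal (norm \<dots>) \<le> (\<integral>\<^sup>+v. ennreal (norm (a v - indicator {w} v *\<^sub>R a w)) \<partial>count_space I)"
      using int i1 by (intro integral_norm_bound_ennreal) auto
    also have "\<dots> = (\<integral>\<^sup>+v. ennreal (norm (a v)) * indicator (- {w}) v \<partial>count_space I)"
      by (intro nn_integral_cong) (auto simp: indicator_def)
    finally show ?thesis by (simp add: tail)
  qed
  have tfin: "t < \<infinity>"
    using int unfolding t_def by (simp add: integrable_iff_bounded)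
  \<comment> \<open>A uniform bound on the terms, so that the squares and the cross terms are
    summable by comparison with a multiple of \<open>norm (a w)\<close>.\<close>
  define D where "D = norm s + enn2real t"
  have D0: "0 \<le> D" by (simp add: D_def)
  have aD: "norm (a w) \<le> D" "norm (s - a w) \<le> 2 * D" if "w \<in> I" for w
  proof -
    have "ennreal (norm (a w)) \<le> t" using split[OF that] by simp
    then have 1: "norm (a w) \<le> enn2real t" using tfin
      by (metis enn2real_ennreal enn2real_mono infinity_ennreal_def norm_ge_zero)
    then show "norm (a w) \<le> D" by (simp add: D_def add_increasing)
    have "norm (s - a w) \<le> norm s + norm (a w)" by (rule norm_triangle_ineq4)
    also have "\<dots> \<le> D" using 1 by (simp add: D_def)
    also have "D \<le> 2 * D" by (simp add: D_def)
    finally show "norm (s - a w) \<le> 2 * D" .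
  qed
  have isq: "integrable (count_space I) (\<lambda>w. (norm (a w))\<^sup>2)"
  proof (rule Bochner_Integration.integrable_bound)
    show "integrable (count_space I) (\<lambda>w. D * norm (a w))" using int by auto
    show "AE w in count_space I. norm ((norm (a w))\<^sup>2) \<le> norm (D * norm (a w))"
    proof (rule AE_I2)
      fix w assume "w \<in> space (count_space I)"
      then have "norm (a w) * norm (a w) \<le> D * norm (a w)"
        using aD(1)[of w] by (intro mult_right_mono) auto
      then show "norm ((norm (a w))\<^sup>2) \<le> norm (D * norm (a w))"
        using D0 by (simp add: power2_eq_square)
    qed
  qed simp
  have icr: "integrable (count_space I) (\<lambda>w. norm (a w) * norm (s - a w))"
  proof (rule Bochner_Integration.integrable_bound)
    show "integrable (count_space I) (\<lambda>w. 2 * D * norm (a w))" using int by auto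
    show "AE w in count_space I. norm (norm (a w) * norm (s - a w)) \<le> norm (2 * D * norm (a w))"
    proof (rule AE_I2)
      fix w assume "w \<in> space (count_space I)"
      then have "norm (a w) * norm (s - a w) \<le> norm (a w) * (2 * D)"
        using aD(2)[of w] by (intro mult_left_mono) auto
      then show "norm (norm (a w) * norm (s - a w)) \<le> norm (2 * D * norm (a w))"
        using D0 by (simp add: abs_mult ac_simps)
    qed
  qed simp
  have ias: "integrable (count_space I) (\<lambda>w. Re (a w * cnj s))"
    using int by (intro integrable_Re integrable_mult_left) auto
  have "(\<integral>w. (norm (a w))\<^sup>2 \<partial>count_space I) \<le> (\<integral>w. Re (a w * cnj s) + norm (a w) * norm (s - a w) \<partial>count_space I)"
  proof (rule integral_mono)
    fix w
    \<comment> \<open>Here \<open>s\<close> is written as \<open>a w + (s - a w)\<close>. Summed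
      over \<open>w\<close>, the first term on the right becomes the squared norm of
      \<open>s\<close>.\<close>
    have "(norm (a w))\<^sup>2 = Re (a w * cnj s) - Re (a w * cnj (s - a w))"
      unfolding cmod_power2 by (simp add: power2_eq_square algebra_simps)
    moreover have "- Re (a w * cnj (s - a w)) \<le> norm (a w) * norm (s - a w)"
      using abs_Re_le_cmod[of "a w * cnj (s - a w)"]
      by (simp only: norm_mult complex_mod_cnj)
    ultimately show "(norm (a w))\<^sup>2 \<le> Re (a w * cnj s) + norm (a w) * norm (s - a w)" by linarith
  qed (use isq icr ias in auto)
  also have "\<dots> = (\<integral>w. Re (a w * cnj s) \<partial>count_space I) + (\<integral>w. norm (a w) * norm (s - a w) \<partial>count_space I)"
    using icr ias by simp
  also have "(\<integral>w. Re (a w * cnj s) \<partial>count_space I) = Re (s * cnj s)"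
    using int unfolding s_def by (subst integral_Re) auto
  also have "Re (s * cnj s) = (norm s)\<^sup>2"
    unfolding cmod_power2 by (simp add: power2_eq_square algebra_simps)
  finally have "ennreal (\<integral>w. (norm (a w))\<^sup>2 \<partial>count_space I)
      \<le> ennreal ((norm s)\<^sup>2 + (\<integral>w. norm (a w) * norm (s - a w) \<partial>count_space I))"
    by (rule ennreal_leI)
  also have "\<dots> = ennreal ((norm s)\<^sup>2) + ennreal (\<integral>w. norm (a w) * norm (s - a w) \<partial>count_space I)"
    by (intro ennreal_plus) auto
  also have "ennreal (\<integral>w. norm (a w) * norm (s - a w) \<partial>count_space I) = (\<integral>\<^sup>+w. ennreal (norm (a w) * norm (s - a w)) \<partial>count_space I)"
    using icr by (intro nn_integral_eq_integral[symmetric]) auto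
  also have "\<dots> \<le> r"
    unfolding r_def by (intro nn_integral_mono) (auto simp: ennreal_mult intro!: mult_left_mono d)
  also have "ennreal (\<integral>w. (norm (a w))\<^sup>2 \<partial>count_space I) = q"
    unfolding q_def using isq by (intro nn_integral_eq_integral[symmetric]) auto
  finally show "q \<le> ennreal ((norm s)\<^sup>2) + r" by (simp add: add_left_mono)
qed

text \<open>By Parseval \<open>C\<close> is the squared norm of the periodization \<open>PG\<close>.
  For almost every \<open>x\<close> the numerical bounds apply to the family
  \<open>G (x + w)\<close>, and integrating them over the torus unfolds to \<open>S\<close> and
  \<open>R\<close>. Their finiteness puts \<open>PG\<close> in the square-integrable class where
  Parseval is valid.\<close>

lemma unit_lattice_bounds:
  fixes G :: "real^'n \<Rightarrow> complex"
  assumes G: "integrable lborel G"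
  defines "S \<equiv> \<integral>\<^sup>+x. ennreal ((norm (G x))\<^sup>2) \<partial>lborel"
    and "R \<equiv> \<integral>\<^sup>+z. (\<integral>\<^sup>+x. ennreal (norm (G x) * norm (G (x + z))) \<partial>lborel) \<partial>count_space (int_points - {0})"
    and "C \<equiv> \<integral>\<^sup>+z. ennreal ((norm (\<integral>x. G x * echar z x \<partial>lborel))\<^sup>2) \<partial>count_space int_points"
  assumes fin: "S < \<infinity>" "R < \<infinity>"
  shows "C \<le> S + R" "S \<le> C + R"
proof -
  have [measurable]: "G \<in> borel_measurable borel" using G by auto
  interpret Z: sigma_finite_measure "count_space (int_points :: (real^'n) set)"
    by (rule sigma_finite_measure_count_space_countable) simp
  interpret Z0: sigma_finite_measure "count_space (int_points - {0} :: (real^'n) set)"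
    by (rule sigma_finite_measure_count_space_countable) simp
  have [measurable]: "(\<lambda>z. z) \<in> borel_measurable (count_space (int_points :: (real^'n) set))"
     "(\<lambda>z. z) \<in> borel_measurable (count_space (int_points - {0} :: (real^'n) set))" by simp_all
  define PG where "PG x = (\<integral>z. G (x + z) \<partial>count_space int_points)" for x
  have [measurable]: "PG \<in> borel_measurable borel" unfolding PG_def by measurable
  define g where "g x = (\<integral>\<^sup>+z. ennreal (norm (G x) * norm (G (x + z))) \<partial>count_space (int_points - {0}))" for x
  have [measurable]: "g \<in> borel_measurable borel" unfolding g_def by measurable
  have S: "S = (\<integral>\<^sup>+x. (\<integral>\<^sup>+w. ennreal ((norm (G (x + w)))\<^sup>2) \<partial>count_space int_points) \<partial>torus)"
    unfolding S_def by (rule nn_integral_periodize[symmetric]) measurable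
  have "R = (\<integral>\<^sup>+x. g x \<partial>lborel)"
    unfolding R_def g_def by (rule nn_integral_count_space_nn_integral[symmetric]) auto
  also have "\<dots> = (\<integral>\<^sup>+x. (\<integral>\<^sup>+w. g (x + w) \<partial>count_space int_points) \<partial>torus)"
    by (rule nn_integral_periodize[symmetric]) measurable
  finally have R: "R = (\<integral>\<^sup>+x. (\<integral>\<^sup>+w. g (x + w) \<partial>count_space int_points) \<partial>torus)" .
  \<comment> \<open>Substituting \<open>v = w + z\<close> turns pairs with nonzero offset
    \<open>z\<close> into pairs of distinct lattice points, the form of the off-diagonal sum in the
    numerical bounds.\<close>
  have gw: "g (x + w) = ennreal (norm (G (x + w))) * (\<integral>\<^sup>+v. ennreal (norm (G (x + v))) \<partial>count_space (int_points - {w}))"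
    if w: "w \<in> int_points" for x w
  proof -
    have "g (x + w) = (\<integral>\<^sup>+z. ennreal (norm (G (x + w))) * ennreal (norm (G (x + (w + z)))) \<partial>count_space (int_points - {0}))"
      by (simp add: g_def ennreal_mult add.assoc)
    also have "\<dots> = ennreal (norm (G (x + w))) * (\<integral>\<^sup>+z. ennreal (norm (G (x + (w + z)))) \<partial>count_space (int_points - {0}))"
      by (rule nn_integral_cmult) simp
    also have "(\<integral>\<^sup>+z. ennreal (norm (G (x + (w + z)))) \<partial>count_space (int_points - {0}))
        = (\<integral>\<^sup>+v. ennreal (norm (G (x + v))) \<partial>count_space (int_points - {w}))"
    proof (rule nn_integral_bij_count_space)
      show "bij_betw (\<lambda>z. w + z) (int_points - {0}) (int_points - {w})"
        using w by (intro bij_betwI[where g="\<lambda>z. z - w"]) auto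
    qed
    finally show ?thesis .
  qed
  have pw: "AE x in torus. ennreal ((norm (PG x))\<^sup>2) \<le> (\<integral>\<^sup>+w. ennreal ((norm (G (x + w)))\<^sup>2) \<partial>count_space int_points) + (\<integral>\<^sup>+w. g (x + w) \<partial>count_space int_points)
     \<and> (\<integral>\<^sup>+w. ennreal ((norm (G (x + w)))\<^sup>2) \<partial>count_space int_points) \<le> ennreal ((norm (PG x))\<^sup>2) + (\<integral>\<^sup>+w. g (x + w) \<partial>count_space int_points)"
    using integral_periodize(1)[OF G]
  proof eventually_elim
    case (elim x)
    have gx: "(\<integral>\<^sup>+w. g (x + w) \<partial>count_space int_points) = (\<integral>\<^sup>+w. ennreal (norm (G (x + w))) *
        (\<integral>\<^sup>+v. ennreal (norm (G (x + v))) \<partial>count_space (int_points - {w})) \<partial>count_space int_points)"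
      by (intro nn_integral_cong) (simp add: gw)
    show ?case
      unfolding gx PG_def using norm_sum_square_bounds[OF elim] by blast
  qed
  have "(\<integral>\<^sup>+x. ennreal ((norm (PG x))\<^sup>2) \<partial>torus) \<le> (\<integral>\<^sup>+x. (\<integral>\<^sup>+w. ennreal ((norm (G (x + w)))\<^sup>2) \<partial>count_space int_points) + (\<integral>\<^sup>+w. g (x + w) \<partial>count_space int_points) \<partial>torus)"
    by (rule nn_integral_mono_AE) (use pw in auto)
  also have "\<dots> = S + R" unfolding S R by (rule nn_integral_add) auto
  finally have up: "(\<integral>\<^sup>+x. ennreal ((norm (PG x))\<^sup>2) \<partial>torus) \<le> S + R" .
  have "(\<lambda>x. ennreal ((norm (PG x))\<^sup>2)) \<in> borel_measurable borel"
    by (intro measurable_compose[OF _ measurable_ennreal] borel_measurable_power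
        measurable_compose[OF _ borel_measurable_norm]) fact
  then have pm: "(\<lambda>x. ennreal ((norm (PG x))\<^sup>2)) \<in> borel_measurable torus"
    by (simp only: measurable_cong_sets[OF sets_torus refl])
  have gm: "(\<lambda>x. \<integral>\<^sup>+w. g (x + w) \<partial>count_space int_points) \<in> borel_measurable torus"
    using nn_integral_int_points_measurable[OF \<open>g \<in> borel_measurable borel\<close>] by simp
  have "S \<le> (\<integral>\<^sup>+x. ennreal ((norm (PG x))\<^sup>2) + (\<integral>\<^sup>+w. g (x + w) \<partial>count_space int_points) \<partial>torus)"
    unfolding S by (rule nn_integral_mono_AE) (use pw in auto)
  also have "\<dots> = (\<integral>\<^sup>+x. ennreal ((norm (PG x))\<^sup>2) \<partial>torus) + R" unfolding R by (rule nn_integral_add[OF pm gm])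
  finally have low: "S \<le> (\<integral>\<^sup>+x. ennreal ((norm (PG x))\<^sup>2) \<partial>torus) + R" .
  have "(\<integral>\<^sup>+x. ennreal ((norm (PG x))\<^sup>2) \<partial>torus) < \<infinity>"
    using up fin by (simp add: le_less_trans)
  from nn_integral_torus_parseval[OF \<open>PG \<in> borel_measurable borel\<close> this]
  have "(\<integral>\<^sup>+z. ennreal ((norm (\<integral>x. PG x * echar z x \<partial>torus))\<^sup>2) \<partial>count_space int_points)
    = (\<integral>\<^sup>+x. ennreal ((norm (PG x))\<^sup>2) \<partial>torus)" by simp
  \<comment> \<open>The character is invariant under lattice translations, so it enters the
    periodization as a factor and unfolding recovers the integral over the whole space.\<close>
  moreover have "(\<integral>x. PG x * echar z x \<partial>torus) = (\<integral>x. G x * echar z x \<partial>lborel)" if z: "z \<in> int_points" for z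
  proof -
    have i: "integrable lborel (\<lambda>x. G x * echar z x)"
      by (rule Bochner_Integration.integrable_bound[OF G]) (auto simp: norm_mult)
    have "(\<integral>w. G (x + w) * echar z (x + w) \<partial>count_space int_points) = PG x * echar z x" for x
    proof -
      have "(\<integral>w. G (x + w) * echar z (x + w) \<partial>count_space int_points) = (\<integral>w. G (x + w) * echar z x \<partial>count_space int_points)"
        by (intro Bochner_Integration.integral_cong) (simp_all add: echar_add_right echar_int_points z)
      also have "\<dots> = PG x * echar z x"
        unfolding PG_def by (rule integral_mult_left_zero)
      finally show ?thesis .
    qed
    then show ?thesis using integral_periodize(3)[OF i] by simp
  qed
  ultimately have "C = (\<integral>\<^sup>+x. ennreal ((norm (PG x))\<^sup>2) \<partial>torus)"
    unfolding C_def by (simp cong: nn_integral_cong_simp)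
  then show "C \<le> S + R" "S \<le> C + R" using up low by simp_all
qed

text \<open>The substitution \<open>x = M *v u\<close> reduces to the integer lattice. It
  contributes one factor \<open>\<bar>det M\<bar>\<close> to \<open>S\<close> and \<open>R\<close>
  but two to \<open>C\<close>, where the integral is squared.\<close>

lemma lattice_bounds:
  fixes H :: "real^'n::{finite,wellorder} \<Rightarrow> complex"
  assumes M: "invertible M" and H: "integrable lborel H"
  defines "S \<equiv> \<integral>\<^sup>+x. ennreal ((norm (H x))\<^sup>2) \<partial>lborel"
    and "R \<equiv> \<integral>\<^sup>+z. (\<integral>\<^sup>+x. ennreal (norm (H x) * norm (H (x + M *v z))) \<partial>lborel) \<partial>count_space (int_points - {0})"
    and "C \<equiv> \<integral>\<^sup>+z. ennreal ((norm (\<integral>x. H x * echar z (matrix_inv M *v x) \<partial>lborel))\<^sup>2) \<partial>count_space int_points"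
  assumes fin: "S < \<infinity>" "R < \<infinity>"
  shows "C \<le> ennreal \<bar>det M\<bar> * (S + R)" "ennreal \<bar>det M\<bar> * S \<le> C + ennreal \<bar>det M\<bar> * R"
proof -
  have [measurable]: "H \<in> borel_measurable borel" using H by auto
  let ?D = "ennreal \<bar>det M\<bar>"
  have d0: "det M \<noteq> 0" using M invertible_det_nz by blast
  define G where "G u = H (M *v u)" for u
  have [measurable]: "G \<in> borel_measurable borel" unfolding G_def by measurable
  have iG: "integrable lborel G"
    unfolding G_def using H by (subst integrable_matrix_iff[OF M]) auto
  define SG where "SG = (\<integral>\<^sup>+x. ennreal ((norm (G x))\<^sup>2) \<partial>lborel)"
  define RG where "RG = (\<integral>\<^sup>+z. (\<integral>\<^sup>+x. ennreal (norm (G x) * norm (G (x + z))) \<partial>lborel) \<partial>count_space (int_points - {0}))"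
  define CG where "CG = (\<integral>\<^sup>+z. ennreal ((norm (\<integral>x. G x * echar z x \<partial>lborel))\<^sup>2) \<partial>count_space int_points)"
  have S: "S = ?D * SG"
    unfolding S_def SG_def G_def by (subst nn_integral_matrix[OF M]) auto
  have "R = (\<integral>\<^sup>+z. ?D * (\<integral>\<^sup>+x. ennreal (norm (G x) * norm (G (x + z))) \<partial>lborel) \<partial>count_space (int_points - {0}))"
    unfolding R_def G_def by (subst nn_integral_matrix[OF M]) (auto simp: matrix_vector_right_distrib)
  then have R: "R = ?D * RG"
    unfolding RG_def by (simp add: nn_integral_cmult)
  have c: "(\<integral>x. H x * echar z (matrix_inv M *v x) \<partial>lborel) = \<bar>det M\<bar> *\<^sub>R (\<integral>x. G x * echar z x \<partial>lborel)" for z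
  proof -
    have "matrix_inv M *v (M *v x) = x" for x
      by (simp add: matrix_vector_mul_assoc matrix_inv_inverse[OF M])
    then show ?thesis
      unfolding G_def by (subst integral_matrix[OF M]) auto
  qed
  have "C = (\<integral>\<^sup>+z. (?D * ?D) * ennreal ((norm (\<integral>x. G x * echar z x \<partial>lborel))\<^sup>2) \<partial>count_space int_points)"
    unfolding C_def c by (simp add: power_mult_distrib ennreal_mult power2_eq_square ac_simps)
  then have C: "C = ?D * (?D * CG)"
    unfolding CG_def by (simp add: nn_integral_cmult mult.assoc)
  have "SG < \<infinity>" "RG < \<infinity>"
    using fin d0 unfolding S R by (auto simp: ennreal_mult_less_top)
  from unit_lattice_bounds[OF iG, folded SG_def RG_def CG_def, OF this]
  have b: "CG \<le> SG + RG" "SG \<le> CG + RG" by auto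
  show "C \<le> ?D * (S + R)"
    unfolding C S R using b(1) by (simp flip: distrib_left add: mult_left_mono)
  show "?D * S \<le> C + ?D * R"
    unfolding C S R using b(2) by (simp flip: distrib_left add: mult_left_mono)
qed

section \<open>Plancherel's theorem\<close>

abbreviation energy :: "('a::euclidean_space \<Rightarrow> complex) \<Rightarrow> ennreal" where
  "energy f \<equiv> \<integral>\<^sup>+x. ennreal ((norm (f x))\<^sup>2) \<partial>lborel"

lemma L2_iff: "f \<in> L2 \<longleftrightarrow> f \<in> borel_measurable borel \<and> energy f < \<infinity>"
  unfolding L2_def by (auto simp: integrable_iff_bounded)

lemma L2_measurable [dest]: "f \<in> L2 \<Longrightarrow> f \<in> borel_measurable borel"
  by (simp add: L2_iff)

lemma energy_eq_integral: "f \<in> L2 \<Longrightarrow> energy f = ennreal (\<integral>x. (norm (f x))\<^sup>2 \<partial>lborel)"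
  unfolding L2_def by (intro nn_integral_eq_integral) auto

lemma L2_norm_square: "(L2_norm f)\<^sup>2 = (\<integral>x. (norm (f x))\<^sup>2 \<partial>lborel)"
  by (simp add: L2_norm_def)

lemma energy_cmult:
  assumes [measurable]: "f \<in> borel_measurable borel"
  shows "energy (\<lambda>x. c * f x) = ennreal ((norm c)\<^sup>2) * energy f"
  by (simp add: norm_mult power_mult_distrib ennreal_mult nn_integral_cmult)

lemma energy_add:
  assumes "f \<in> borel_measurable borel" "g \<in> borel_measurable borel"
  shows "energy (\<lambda>x. f x + g x) \<le> 2 * energy f + 2 * energy g"
  using assms by (intro nn_integral_norm_add_square_le) auto

lemma energy_diff:
  assumes "f \<in> borel_measurable borel" "g \<in> borel_measurable borel"
  shows "energy (\<lambda>x. f x - g x) \<le> 2 * energy f + 2 * energy g"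
  using energy_add[OF assms(1), of "\<lambda>x. - g x"] assms(2) by simp

lemma L2_add: "f \<in> L2 \<Longrightarrow> g \<in> L2 \<Longrightarrow> (\<lambda>x. f x + g x) \<in> L2"
  using energy_add[of f g] unfolding L2_iff by (auto elim!: le_less_trans simp: ennreal_mult_less_top)

lemma L2_diff: "f \<in> L2 \<Longrightarrow> g \<in> L2 \<Longrightarrow> (\<lambda>x. f x - g x) \<in> L2"
  using energy_diff[of f g] unfolding L2_iff by (auto elim!: le_less_trans simp: ennreal_mult_less_top)

lemma L2_cmult: "f \<in> L2 \<Longrightarrow> (\<lambda>x. c * f x) \<in> L2"
  using energy_cmult[of f c] unfolding L2_iff by (auto simp: ennreal_mult_less_top)

lemma L2_product_integrable:
  assumes "f \<in> L2" "g \<in> L2"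
  shows "integrable lborel (\<lambda>x. f x * g x)"
proof (rule Bochner_Integration.integrable_bound)
  have [measurable]: "f \<in> borel_measurable borel" "g \<in> borel_measurable borel" using assms by auto
  show "integrable lborel (\<lambda>x. (norm (f x))\<^sup>2 + (norm (g x))\<^sup>2)"
    using assms by (auto simp: L2_def)
  show "(\<lambda>x. f x * g x) \<in> borel_measurable lborel" by measurable
  show "AE x in lborel. norm (f x * g x) \<le> norm ((norm (f x))\<^sup>2 + (norm (g x))\<^sup>2)"
  proof (rule AE_I2)
    fix x
    have "0 \<le> norm (f x) * norm (g x)" by simp
    then have "norm (f x) * norm (g x) \<le> (norm (f x))\<^sup>2 + (norm (g x))\<^sup>2"
      using sum_squares_bound[of "norm (f x)" "norm (g x)"] by linarith
    then show "norm (f x * g x) \<le> norm ((norm (f x))\<^sup>2 + (norm (g x))\<^sup>2)"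
      by (simp add: norm_mult)
  qed
qed

text \<open>AM-GM with weight \<open>\<delta>\<close> on the mixed term. The bound integrates
  directly: the part with \<open>b\<close> is made small by the choice of \<open>\<delta>\<close>,
  and the other part is then small by mean-square convergence.\<close>

lemma norm_square_diff_le:
  assumes "\<delta> > 0"
  shows "\<bar>(norm a)\<^sup>2 - (norm b)\<^sup>2\<bar> \<le> (1 + 1 / \<delta>) * (norm (a - b))\<^sup>2 + \<delta> * (norm (b::complex))\<^sup>2"
proof -
  let ?d = "norm (a - b)"
  have d: "\<bar>norm a - norm b\<bar> \<le> ?d" by (rule norm_triangle_ineq3)
  have "\<bar>(norm a)\<^sup>2 - (norm b)\<^sup>2\<bar> = \<bar>norm a - norm b\<bar> * (norm a + norm b)"
    by (simp add: power2_eq_square square_diff_square_factored abs_mult mult.commute)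
  also have "\<dots> \<le> ?d * (?d + 2 * norm b)"
    using d by (intro mult_mono) auto
  also have "\<dots> = ?d\<^sup>2 + 2 * (?d / sqrt \<delta>) * (sqrt \<delta> * norm b)"
    using assms by (simp add: power2_eq_square algebra_simps)
  also have "2 * (?d / sqrt \<delta>) * (sqrt \<delta> * norm b) \<le> (?d / sqrt \<delta>)\<^sup>2 + (sqrt \<delta> * norm b)\<^sup>2"
    by (rule sum_squares_bound)
  also have "?d\<^sup>2 + \<dots> = (1 + 1 / \<delta>) * ?d\<^sup>2 + \<delta> * (norm b)\<^sup>2"
    using assms by (simp add: power_divide power_mult_distrib algebra_simps)
  finally show ?thesis by simp
qed

lemma L2_tendsto_norm:
  assumes h: "\<And>n. h n \<in> L2" and f: "f \<in> L2" and lim: "L2_tendsto h f"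
  shows "(\<lambda>n. \<integral>x. (norm (h n x))\<^sup>2 \<partial>lborel) \<longlonglongrightarrow> (\<integral>x. (norm (f x))\<^sup>2 \<partial>lborel)"
proof (rule LIMSEQ_I)
  fix \<epsilon> :: real assume e: "\<epsilon> > 0"
  let ?F = "\<integral>x. (norm (f x))\<^sup>2 \<partial>lborel"
  define d where "d n = (\<integral>x. (norm (h n x - f x))\<^sup>2 \<partial>lborel)" for n
  have hf: "(\<lambda>x. h n x - f x) \<in> L2" for n using L2_diff h f by blast
  have "(\<lambda>n. ennreal (d n)) \<longlonglongrightarrow> ennreal 0"
    using lim unfolding L2_tendsto_def d_def by (simp add: energy_eq_integral[OF hf])
  then have d: "d \<longlonglongrightarrow> 0"
    by (subst (asm) tendsto_ennreal_iff) (auto simp: d_def)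
  \<comment> \<open>The added 1 guards against a vanishing norm of \<open>f\<close>; the choice
    leaves \<open>\<delta> * ?F\<close> strictly below \<epsilon>.\<close>
  define \<delta> where "\<delta> = \<epsilon> / (2 * (?F + 1))"
  have F0: "0 \<le> ?F" by simp
  then have \<delta>: "\<delta> > 0" using e unfolding \<delta>_def by (intro divide_pos_pos mult_pos_pos) linarith+
  have "\<delta> * ?F < \<epsilon>"
  proof -
    have "\<epsilon> / (2 * (t + 1)) * (t + 1) = \<epsilon> / 2" if "0 \<le> t" for t :: real
      using that by (simp add: field_simps)
    then have "\<delta> * (?F + 1) = \<epsilon> / 2" using F0 unfolding \<delta>_def by blast
    moreover have "\<delta> * ?F \<le> \<delta> * (?F + 1)" using \<delta> by simp
    ultimately show ?thesis using e by linarith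
  qed
  moreover have "(\<lambda>n. (1 + 1 / \<delta>) * d n + \<delta> * ?F) \<longlonglongrightarrow> (1 + 1 / \<delta>) * 0 + \<delta> * ?F"
    by (intro tendsto_intros d)
  ultimately have "eventually (\<lambda>n. (1 + 1 / \<delta>) * d n + \<delta> * ?F < \<epsilon>) sequentially"
    by (intro order_tendstoD(2)) auto
  moreover have "norm ((\<integral>x. (norm (h n x))\<^sup>2 \<partial>lborel) - ?F) \<le> (1 + 1 / \<delta>) * d n + \<delta> * ?F" for n
  proof -
    have i: "integrable lborel (\<lambda>x. (norm (h n x))\<^sup>2)" "integrable lborel (\<lambda>x. (norm (f x))\<^sup>2)"
      "integrable lborel (\<lambda>x. (norm (h n x - f x))\<^sup>2)"
      using h[of n] f hf[of n] by (auto simp: L2_def)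
    have "norm (\<integral>x. (norm (h n x))\<^sup>2 - (norm (f x))\<^sup>2 \<partial>lborel)
        \<le> (\<integral>x. norm ((norm (h n x))\<^sup>2 - (norm (f x))\<^sup>2) \<partial>lborel)"
      by (rule integral_norm_bound)
    also have "\<dots> \<le> (\<integral>x. (1 + 1 / \<delta>) * (norm (h n x - f x))\<^sup>2 + \<delta> * (norm (f x))\<^sup>2 \<partial>lborel)"
      using i norm_square_diff_le[OF \<delta>] by (intro integral_mono) auto
    also have "\<dots> = (1 + 1 / \<delta>) * d n + \<delta> * ?F"
      using i by (simp add: d_def)
    finally show ?thesis using i by simp
  qed
  ultimately show "\<exists>N. \<forall>n\<ge>N. norm ((\<integral>x. (norm (h n x))\<^sup>2 \<partial>lborel) - ?F) < \<epsilon>"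
    unfolding eventually_sequentially by (meson le_less_trans)
qed

lemma fourier_integral_echar: "fourier_integral f \<xi> = (\<integral>x. f x * echar (- \<xi>) x \<partial>lborel)"
  unfolding fourier_integral_def echar_def cis_conv_exp
  by (intro Bochner_Integration.integral_cong) (auto simp: algebra_simps)

lemma fourier_integral_measurable [measurable]:
  assumes [measurable]: "f \<in> borel_measurable borel"
  shows "fourier_integral f \<in> borel_measurable borel"
proof -
  have "(\<lambda>\<xi>. \<integral>x. f x * echar (- \<xi>) x \<partial>lborel) \<in> borel_measurable borel"
    by measurable
  then show ?thesis by (simp add: fourier_integral_echar[abs_def])
qed

lemma integrable_times_echar:
  assumes "integrable lborel f" and [measurable]: "\<theta> \<in> borel_measurable borel" "\<eta> \<in> borel_measurable borel"
  shows "integrable lborel (\<lambda>x. f x * echar (\<theta> x) (\<eta> x))"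
proof (rule Bochner_Integration.integrable_bound[OF assms(1)])
  have [measurable]: "f \<in> borel_measurable borel" using assms by auto
  show "(\<lambda>x. f x * echar (\<theta> x) (\<eta> x)) \<in> borel_measurable lborel" by measurable
qed (simp add: norm_mult)

lemma fourier_integral_add_cmult:
  assumes "integrable lborel f" "integrable lborel g"
  shows "fourier_integral (\<lambda>x. f x + c * g x) \<xi> = fourier_integral f \<xi> + c * fourier_integral g \<xi>"
proof -
  have i: "integrable lborel (\<lambda>x. f x * echar (- \<xi>) x)" "integrable lborel (\<lambda>x. g x * echar (- \<xi>) x)"
    using assms by (auto intro!: integrable_times_echar)
  have "fourier_integral (\<lambda>x. f x + c * g x) \<xi> = (\<integral>x. f x * echar (- \<xi>) x + c * (g x * echar (- \<xi>) x) \<partial>lborel)"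
    unfolding fourier_integral_echar by (simp add: algebra_simps)
  then show ?thesis using i by (simp add: fourier_integral_echar)
qed

lemma L2_bounded_support_integrable:
  assumes f: "f \<in> L2" and supp: "\<And>x. norm x > r \<Longrightarrow> f x = 0"
  shows "integrable lborel f"
proof (rule Bochner_Integration.integrable_bound)
  have [measurable]: "f \<in> borel_measurable borel" using f by auto
  show "f \<in> borel_measurable lborel" by measurable
  have "integrable lborel (indicator (cball (0::real^2) r) :: real^2 \<Rightarrow> real)"
    using emeasure_bounded_finite[OF bounded_cball[of "0::real^2" r]] by (intro integrable_real_indicator) auto
  then show "integrable lborel (\<lambda>x. indicator (cball 0 r) x + (norm (f x))\<^sup>2)"
    using f by (auto simp: L2_def)
  show "AE x in lborel. norm (f x) \<le> norm (indicator (cball 0 r) x + (norm (f x))\<^sup>2)"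
  proof (rule AE_I2)
    fix x :: "real^2"
    show "norm (f x) \<le> norm (indicator (cball 0 r) x + (norm (f x))\<^sup>2)"
    proof (cases "norm x > r")
      case True
      then show ?thesis using supp by simp
    next
      case False
      have "2 * norm (f x) \<le> 1 + (norm (f x))\<^sup>2"
        using sum_squares_bound[of 1 "norm (f x)"] by simp
      then have "norm (f x) \<le> 1 + (norm (f x))\<^sup>2"
        using norm_ge_zero[of "f x"] by linarith
      then show ?thesis using False by (simp add: dist_norm)
    qed
  qed
qed

lemma norm_int_points_ge_1:
  assumes "z \<in> int_points" "z \<noteq> 0"
  shows "1 \<le> norm z"
proof -
  obtain i where i: "z $ i \<noteq> 0" using assms(2) by (auto simp: vec_eq_iff)
  obtain k :: int where k: "z $ i = of_int k" using assms(1) by (auto simp: int_points_def Ints_def)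
  then have "1 \<le> \<bar>z $ i\<bar>" using i by simp
  also have "\<dots> \<le> norm z" by (rule component_le_norm_cart)
  finally show ?thesis .
qed

text \<open>When the lattice translates of \<open>f\<close> have disjoint supports, the error term
  of \<open>lattice_bounds\<close> vanishes and its two inequalities collapse to an
  equality.\<close>

lemma plancherel_bounded_support:
  fixes f :: "real^2 \<Rightarrow> complex"
  assumes f: "f \<in> L2" and supp: "\<And>x. norm x > r \<Longrightarrow> f x = 0"
  shows "energy (fourier_integral f) = energy f"
proof -
  have [measurable]: "f \<in> borel_measurable borel" using f by auto
  have fi: "integrable lborel f" using L2_bounded_support_integrable[OF f supp] .
  \<comment> \<open>Any length above the diameter \<open>2 * r\<close> of the support works; the
    absolute value keeps \<open>L\<close> positive also for negative \<open>r\<close>.\<close>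
  define L where "L = 2 * \<bar>r\<bar> + 1"
  have L: "L > 0" by (simp add: L_def)
  define M :: "real^2^2" where "M = mat L"
  have Mv: "M *v x = L *\<^sub>R x" for x
    by (simp add: M_def vec_eq_iff matrix_vector_mult_def mat_def if_distrib if_distribR sum.If_cases cong: if_cong)
  have "M ** mat (1 / L) = mat 1" "mat (1 / L) ** M = mat 1"
    using L by (simp_all add: M_def matrix_eq matrix_vector_mul_assoc[symmetric])
      (simp_all add: vec_eq_iff matrix_vector_mult_def mat_def if_distrib if_distribR sum.If_cases cong: if_cong)
  then have Minv: "invertible M" unfolding invertible_def by blast
  define N where "N = matrix_inv M"
  have NM: "M ** N = mat 1" "N ** M = mat 1" using matrix_inv_inverse[OF Minv] by (simp_all add: N_def)
  then have Ninv: "invertible N" unfolding invertible_def by blast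
  have dets: "ennreal \<bar>det N\<bar> * ennreal \<bar>det M\<bar> = 1"
  proof -
    have "det N * det M = 1" using NM by (metis det_I det_mul)
    then show ?thesis by (simp flip: ennreal_mult abs_mult)
  qed
  have Nv: "N *v x = (1 / L) *\<^sub>R x" for x
  proof -
    have "N *v x = N *v (M *v ((1 / L) *\<^sub>R x))" using L by (simp add: Mv)
    also have "\<dots> = (1 / L) *\<^sub>R x" using NM by (simp add: matrix_vector_mul_assoc)
    finally show ?thesis .
  qed
  have per: "(\<integral>\<^sup>+z. ennreal ((norm (fourier_integral f (N *v (u + z))))\<^sup>2) \<partial>count_space int_points) = ennreal \<bar>det M\<bar> * energy f" for u
  proof -
    \<comment> \<open>Modulation leaves the absolute value of \<open>f\<close> unchanged and moves
      the sampled frequencies to the translate of the sampling lattice by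
      \<open>N *v u\<close>.\<close>
    define H where "H x = f x * echar (- (N *v u)) x" for x
    have iH: "integrable lborel H"
      unfolding H_def using fi by (intro integrable_times_echar) auto
    have S: "energy H = energy f"
      by (simp add: H_def norm_mult)
    have nz: "norm (H x) * norm (H (x + M *v z)) = 0" if z: "z \<in> int_points - {0}" for x z
    proof (rule ccontr)
      assume "norm (H x) * norm (H (x + M *v z)) \<noteq> 0"
      then have "f x \<noteq> 0" "f (x + M *v z) \<noteq> 0" by (auto simp: H_def)
      then have "norm x \<le> r" "norm (x + M *v z) \<le> r" using supp by (meson not_le)+
      then have "norm (M *v z) \<le> 2 * r"
        using norm_triangle_ineq4[of "x + M *v z" x] by simp
      moreover have "norm (M *v z) \<ge> L"
        using norm_int_points_ge_1[of z] z L by (simp add: Mv mult_le_cancel_left1)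
      ultimately show False by (simp add: L_def)
    qed
    have "(\<integral>\<^sup>+x. ennreal (norm (H x) * norm (H (x + M *v z))) \<partial>lborel) = 0" if "z \<in> int_points - {0}" for z
    proof -
      have "(\<lambda>x. ennreal (norm (H x) * norm (H (x + M *v z)))) = (\<lambda>x. 0)"
        using nz[OF that] by (simp only: ennreal_0)
      then show ?thesis by simp
    qed
    then have "(\<integral>\<^sup>+z. (\<integral>\<^sup>+x. ennreal (norm (H x) * norm (H (x + M *v z))) \<partial>lborel) \<partial>count_space (int_points - {0}))
        = (\<integral>\<^sup>+z. 0 \<partial>count_space (int_points - {0 :: real^2}))"
      by (intro nn_integral_cong) simp
    then have R: "(\<integral>\<^sup>+z. (\<integral>\<^sup>+x. ennreal (norm (H x) * norm (H (x + M *v z))) \<partial>lborel) \<partial>count_space (int_points - {0})) = 0"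
      by simp
    have "energy H < \<infinity>" using f S by (simp add: L2_iff)
    from lattice_bounds[OF Minv iH this, unfolded R]
    have "(\<integral>\<^sup>+z. ennreal ((norm (\<integral>x. H x * echar z (N *v x) \<partial>lborel))\<^sup>2) \<partial>count_space int_points) = ennreal \<bar>det M\<bar> * energy f"
      by (auto simp: S N_def intro: antisym)
    also have "(\<lambda>z. \<integral>x. H x * echar z (N *v x) \<partial>lborel) = (\<lambda>z. fourier_integral f (N *v (u - z)))"
    proof
      fix z
      show "(\<integral>x. H x * echar z (N *v x) \<partial>lborel) = fourier_integral f (N *v (u - z))"
        unfolding fourier_integral_echar H_def
      proof (intro Bochner_Integration.integral_cong refl)
        fix x
        have "echar z (N *v x) = echar (N *v z) x"
          by (simp add: echar_def Nv)
        then show "f x * echar (- (N *v u)) x * echar z (N *v x) = f x * echar (- (N *v (u - z))) x"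
          by (simp add: matrix_vector_mult_diff_distrib mult.assoc echar_add_left[symmetric])
      qed
    qed
    finally have "(\<integral>\<^sup>+z. ennreal ((norm (fourier_integral f (N *v (u - z))))\<^sup>2) \<partial>count_space int_points) = ennreal \<bar>det M\<bar> * energy f" .
    moreover have "(\<integral>\<^sup>+z. ennreal ((norm (fourier_integral f (N *v (u - z))))\<^sup>2) \<partial>count_space int_points)
      = (\<integral>\<^sup>+z. ennreal ((norm (fourier_integral f (N *v (u + z))))\<^sup>2) \<partial>count_space int_points)"
      by (subst nn_integral_bij_count_space[of uminus int_points int_points, symmetric])
        (auto intro!: bij_betwI[where g=uminus])
    ultimately show ?thesis by simp
  qed
  have "energy (fourier_integral f) = ennreal \<bar>det N\<bar> * (\<integral>\<^sup>+u. ennreal ((norm (fourier_integral f (N *v u)))\<^sup>2) \<partial>lborel)"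
    by (rule nn_integral_matrix[OF Ninv]) measurable
  also have "(\<integral>\<^sup>+u. ennreal ((norm (fourier_integral f (N *v u)))\<^sup>2) \<partial>lborel)
      = (\<integral>\<^sup>+u. (\<integral>\<^sup>+z. ennreal ((norm (fourier_integral f (N *v (u + z))))\<^sup>2) \<partial>count_space int_points) \<partial>torus)"
    by (rule nn_integral_periodize[symmetric]) measurable
  also have "\<dots> = ennreal \<bar>det M\<bar> * energy f"
    using prob_space.emeasure_space_1[OF prob_space_torus[where 'n = 2]] by (simp add: per)
  finally show ?thesis
    by (simp add: mult.assoc[symmetric] dets)
qed

section \<open>Removing the support condition by truncation\<close>

definition truncate :: "(real^2 \<Rightarrow> complex) \<Rightarrow> nat \<Rightarrow> real^2 \<Rightarrow> complex" where
  "truncate f n x = indicator (cball 0 (real n)) x * f x"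

lemma truncate_measurable [measurable]:
  assumes [measurable]: "f \<in> borel_measurable borel"
  shows "truncate f n \<in> borel_measurable borel"
proof -
  have [measurable]: "cball (0::real^2) (real n) \<in> sets borel" by simp
  show ?thesis unfolding truncate_def by measurable
qed

lemma truncate_le: "norm (truncate f n x) \<le> norm (f x)"
  by (simp add: truncate_def indicator_def)

lemma truncate_support: "norm x > real n \<Longrightarrow> truncate f n x = 0"
  by (simp add: truncate_def indicator_def dist_norm)

lemma truncate_tendsto: "(\<lambda>n. truncate f n x) \<longlonglongrightarrow> f x"
proof -
  obtain N where "norm x \<le> real N" using real_arch_simple by blast
  then have "truncate f n x = f x" if "n \<ge> N" for n
    using that by (simp add: truncate_def indicator_def dist_norm)
  then show ?thesis by (auto intro!: tendsto_eventually eventually_sequentiallyI[of N])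
qed

lemma truncate_L2:
  assumes "f \<in> L2"
  shows "truncate f n \<in> L2"
proof -
  have "energy (truncate f n) \<le> energy f"
    by (intro nn_integral_mono ennreal_leI power_mono truncate_le) auto
  then show ?thesis using assms by (auto simp: L2_iff intro: le_less_trans)
qed

lemma truncate_integrable: "f \<in> L2 \<Longrightarrow> integrable lborel (truncate f n)"
  using L2_bounded_support_integrable[OF truncate_L2 truncate_support] .

lemma L2_tendsto_truncate:
  assumes f: "f \<in> L2"
  shows "L2_tendsto (truncate f) f"
proof -
  have [measurable]: "f \<in> borel_measurable borel" using f by auto
  have "(\<lambda>n. energy (\<lambda>x. truncate f n x - f x)) \<longlonglongrightarrow> (\<integral>\<^sup>+x. 0 \<partial>(lborel :: (real^2) measure))"
  proof (rule nn_integral_dominated_convergence[where w="\<lambda>x. ennreal ((norm (f x))\<^sup>2)"])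
    show "AE x in lborel. ennreal ((norm (truncate f n x - f x))\<^sup>2) \<le> ennreal ((norm (f x))\<^sup>2)" for n
      by (intro AE_I2 ennreal_leI power_mono) (auto simp: truncate_def indicator_def)
    show "AE x in lborel. (\<lambda>n. ennreal ((norm (truncate f n x - f x))\<^sup>2)) \<longlonglongrightarrow> 0"
    proof (rule AE_I2)
      fix x
      have "(\<lambda>n. ennreal ((norm (truncate f n x - f x))\<^sup>2)) \<longlonglongrightarrow> ennreal ((norm (f x - f x))\<^sup>2)"
        by (intro tendsto_intros truncate_tendsto)
      then show "(\<lambda>n. ennreal ((norm (truncate f n x - f x))\<^sup>2)) \<longlonglongrightarrow> 0" by simp
    qed
  qed (use f in \<open>auto simp: L2_iff\<close>)
  then show ?thesis by (simp add: L2_tendsto_def)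
qed

text \<open>Integrability of \<open>f\<close> gives pointwise convergence of the transforms of its
  truncations, and Fatou's lemma then yields an inequality. Applied to differences, it already makes
  the transform continuous in the mean-square sense.\<close>

lemma energy_fourier_integral_le:
  assumes f: "f \<in> L2" "integrable lborel f"
  shows "energy (fourier_integral f) \<le> energy f"
proof -
  have [measurable]: "f \<in> borel_measurable borel" using f by auto
  have lim: "(\<lambda>n. fourier_integral (truncate f n) \<xi>) \<longlonglongrightarrow> fourier_integral f \<xi>" for \<xi>
    unfolding fourier_integral_echar
  proof (rule integral_dominated_convergence[where w="\<lambda>x. norm (f x)"])
    show "AE x in lborel. (\<lambda>n. truncate f n x * echar (- \<xi>) x) \<longlonglongrightarrow> f x * echar (- \<xi>) x"
      by (intro AE_I2 tendsto_intros truncate_tendsto)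
    show "AE x in lborel. norm (truncate f n x * echar (- \<xi>) x) \<le> norm (f x)" for n
      by (simp add: norm_mult truncate_le)
  qed (use f in auto)
  have "energy (fourier_integral f) = (\<integral>\<^sup>+\<xi>. liminf (\<lambda>n. ennreal ((norm (fourier_integral (truncate f n) \<xi>))\<^sup>2)) \<partial>lborel)"
    using lim by (intro nn_integral_cong lim_imp_Liminf[symmetric] tendsto_intros) auto
  also have "\<dots> \<le> liminf (\<lambda>n. energy (fourier_integral (truncate f n)))"
    by (rule nn_integral_liminf) measurable
  also have "\<dots> \<le> liminf (\<lambda>n. energy f)"
  proof (intro Liminf_mono always_eventually allI)
    fix n
    have "energy (fourier_integral (truncate f n)) = energy (truncate f n)"
      by (rule plancherel_bounded_support[OF truncate_L2[OF f(1)] truncate_support])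
    also have "\<dots> \<le> energy f"
      by (intro nn_integral_mono ennreal_leI power_mono truncate_le) auto
    finally show "energy (fourier_integral (truncate f n)) \<le> energy f" .
  qed
  also have "\<dots> = energy f" by (simp add: Liminf_const)
  finally show ?thesis .
qed

lemma fourier_integral_L2:
  assumes f: "f \<in> L2" "integrable lborel f"
  shows "fourier_integral f \<in> L2"
  using energy_fourier_integral_le[OF f] f by (auto simp: L2_iff intro: le_less_trans)

lemma L2_tendsto_fourier_integral:
  assumes h: "\<And>n. h n \<in> L2" "\<And>n. integrable lborel (h n)" and f: "f \<in> L2" "integrable lborel f"
    and lim: "L2_tendsto h f"
  shows "L2_tendsto (\<lambda>n. fourier_integral (h n)) (fourier_integral f)"
  unfolding L2_tendsto_def
proof (rule tendsto_sandwich[of "\<lambda>_. 0"])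
  show "\<forall>\<^sub>F n in sequentially. energy (\<lambda>x. fourier_integral (h n) x - fourier_integral f x) \<le> energy (\<lambda>x. h n x - f x)"
  proof (intro always_eventually allI)
    fix n
    have "energy (fourier_integral (\<lambda>x. h n x - f x)) \<le> energy (\<lambda>x. h n x - f x)"
      using h f by (intro energy_fourier_integral_le L2_diff) auto
    moreover have "fourier_integral (\<lambda>x. h n x - f x) \<xi> = fourier_integral (h n) \<xi> - fourier_integral f \<xi>" for \<xi>
      using fourier_integral_add_cmult[OF h(2) f(2), of n "-1" \<xi>] by simp
    ultimately show "energy (\<lambda>x. fourier_integral (h n) x - fourier_integral f x) \<le> energy (\<lambda>x. h n x - f x)"
      by simp
  qed
  show "(\<lambda>n. energy (\<lambda>x. h n x - f x)) \<longlonglongrightarrow> 0" using lim by (simp add: L2_tendsto_def)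
qed auto

text \<open>Continuity of the transform lets both norms pass to the limit along truncations, where
  equality is known.\<close>

lemma plancherel_L1_L2:
  assumes f: "f \<in> L2" "integrable lborel f"
  shows "(\<integral>x. (norm (fourier_integral f x))\<^sup>2 \<partial>lborel) = (\<integral>x. (norm (f x))\<^sup>2 \<partial>lborel)"
proof (rule LIMSEQ_unique)
  show "(\<lambda>n. \<integral>x. (norm (fourier_integral (truncate f n) x))\<^sup>2 \<partial>lborel) \<longlonglongrightarrow> (\<integral>x. (norm (fourier_integral f x))\<^sup>2 \<partial>lborel)"
    by (intro L2_tendsto_norm fourier_integral_L2 L2_tendsto_fourier_integral truncate_L2 truncate_integrable
        L2_tendsto_truncate f)
  have "ennreal (\<integral>x. (norm (fourier_integral (truncate f n) x))\<^sup>2 \<partial>lborel) = ennreal (\<integral>x. (norm (truncate f n x))\<^sup>2 \<partial>lborel)" for n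
    using plancherel_bounded_support[OF truncate_L2[OF f(1)] truncate_support]
    by (simp only: energy_eq_integral truncate_L2 fourier_integral_L2 truncate_integrable f)
  then have "(\<integral>x. (norm (fourier_integral (truncate f n) x))\<^sup>2 \<partial>lborel) = (\<integral>x. (norm (truncate f n x))\<^sup>2 \<partial>lborel)" for n
    by simp
  moreover have "(\<lambda>n. \<integral>x. (norm (truncate f n x))\<^sup>2 \<partial>lborel) \<longlonglongrightarrow> (\<integral>x. (norm (f x))\<^sup>2 \<partial>lborel)"
    by (intro L2_tendsto_norm truncate_L2 L2_tendsto_truncate f)
  ultimately show "(\<lambda>n. \<integral>x. (norm (fourier_integral (truncate f n) x))\<^sup>2 \<partial>lborel) \<longlonglongrightarrow> (\<integral>x. (norm (f x))\<^sup>2 \<partial>lborel)"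
    by simp
qed

section \<open>The Fourier transform on square-integrable functions\<close>

lemma is_fourier_L2_norm:
  assumes f: "f \<in> L2" and g: "is_fourier_L2 f g"
  shows "(\<integral>x. (norm (g x))\<^sup>2 \<partial>lborel) = (\<integral>x. (norm (f x))\<^sup>2 \<partial>lborel)"
proof -
  obtain h where h: "\<And>n. h n \<in> L2" "\<And>n. integrable lborel (h n)" "L2_tendsto h f"
    "L2_tendsto (\<lambda>n. fourier_integral (h n)) g" and "g \<in> L2"
    using g unfolding is_fourier_L2_def by blast
  have "(\<lambda>n. \<integral>x. (norm (fourier_integral (h n) x))\<^sup>2 \<partial>lborel) \<longlonglongrightarrow> (\<integral>x. (norm (g x))\<^sup>2 \<partial>lborel)"
    using h \<open>g \<in> L2\<close> by (intro L2_tendsto_norm fourier_integral_L2) auto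
  moreover have "(\<lambda>n. \<integral>x. (norm (h n x))\<^sup>2 \<partial>lborel) \<longlonglongrightarrow> (\<integral>x. (norm (f x))\<^sup>2 \<partial>lborel)"
    using h f by (intro L2_tendsto_norm) auto
  ultimately show ?thesis
    using LIMSEQ_unique by (simp add: plancherel_L1_L2[OF h(1,2)])
qed

lemma L2_tendsto_add_cmult:
  assumes "\<And>n. h n \<in> L2" "\<And>n. h' n \<in> L2" "f \<in> L2" "f' \<in> L2"
    and "L2_tendsto h f" "L2_tendsto h' f'"
  shows "L2_tendsto (\<lambda>n x. h n x + c * h' n x) (\<lambda>x. f x + c * f' x)"
  unfolding L2_tendsto_def
proof (rule tendsto_sandwich[of "\<lambda>_. 0"])
  have lim: "(\<lambda>n. energy (\<lambda>x. h n x - f x)) \<longlonglongrightarrow> 0" "(\<lambda>n. energy (\<lambda>x. h' n x - f' x)) \<longlonglongrightarrow> 0"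
    using assms(5,6) by (simp_all add: L2_tendsto_def)
  have "(\<lambda>n. 2 * energy (\<lambda>x. h n x - f x) + 2 * (ennreal ((norm c)\<^sup>2) * energy (\<lambda>x. h' n x - f' x)))
      \<longlonglongrightarrow> 2 * 0 + 2 * (ennreal ((norm c)\<^sup>2) * 0)"
    by (intro tendsto_add ennreal_tendsto_cmult lim) auto
  then show "(\<lambda>n. 2 * energy (\<lambda>x. h n x - f x) + 2 * (ennreal ((norm c)\<^sup>2) * energy (\<lambda>x. h' n x - f' x))) \<longlonglongrightarrow> 0"
    by simp
  show "\<forall>\<^sub>F n in sequentially. energy (\<lambda>x. h n x + c * h' n x - (f x + c * f' x))
      \<le> 2 * energy (\<lambda>x. h n x - f x) + 2 * (ennreal ((norm c)\<^sup>2) * energy (\<lambda>x. h' n x - f' x))"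
  proof (intro always_eventually allI)
    fix n
    have [measurable]: "h n \<in> borel_measurable borel" "h' n \<in> borel_measurable borel"
      "f \<in> borel_measurable borel" "f' \<in> borel_measurable borel" using assms by auto
    have "energy (\<lambda>x. h n x + c * h' n x - (f x + c * f' x)) = energy (\<lambda>x. (h n x - f x) + c * (h' n x - f' x))"
      by (simp add: algebra_simps)
    also have "\<dots> \<le> 2 * energy (\<lambda>x. h n x - f x) + 2 * energy (\<lambda>x. c * (h' n x - f' x))"
      by (rule energy_add) measurable
    also have "energy (\<lambda>x. c * (h' n x - f' x)) = ennreal ((norm c)\<^sup>2) * energy (\<lambda>x. h' n x - f' x)"
      by (rule energy_cmult) measurable
    finally show "energy (\<lambda>x. h n x + c * h' n x - (f x + c * f' x))
      \<le> 2 * energy (\<lambda>x. h n x - f x) + 2 * (ennreal ((norm c)\<^sup>2) * energy (\<lambda>x. h' n x - f' x))" .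
  qed
qed auto

lemma is_fourier_L2_add_cmult:
  assumes f: "f \<in> L2" "is_fourier_L2 f g" and f': "f' \<in> L2" "is_fourier_L2 f' g'"
  shows "is_fourier_L2 (\<lambda>x. f x + c * f' x) (\<lambda>x. g x + c * g' x)"
proof -
  obtain h where h: "\<And>n. h n \<in> L2" "\<And>n. integrable lborel (h n)" "L2_tendsto h f"
    "L2_tendsto (\<lambda>n. fourier_integral (h n)) g" and g: "g \<in> L2"
    using f unfolding is_fourier_L2_def by blast
  obtain h' where h': "\<And>n. h' n \<in> L2" "\<And>n. integrable lborel (h' n)" "L2_tendsto h' f'"
    "L2_tendsto (\<lambda>n. fourier_integral (h' n)) g'" and g': "g' \<in> L2"
    using f' unfolding is_fourier_L2_def by blast
  have "L2_tendsto (\<lambda>n x. fourier_integral (h n) x + c * fourier_integral (h' n) x) (\<lambda>x. g x + c * g' x)"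
    using h h' g g' by (intro L2_tendsto_add_cmult fourier_integral_L2) auto
  then have "L2_tendsto (\<lambda>n. fourier_integral (\<lambda>x. h n x + c * h' n x)) (\<lambda>x. g x + c * g' x)"
    using fourier_integral_add_cmult[OF h(2) h'(2)] by presburger
  moreover have "L2_tendsto (\<lambda>n x. h n x + c * h' n x) (\<lambda>x. f x + c * f' x)"
    using h h' f f' by (intro L2_tendsto_add_cmult) auto
  moreover have "(\<lambda>x. h n x + c * h' n x) \<in> L2" "integrable lborel (\<lambda>x. h n x + c * h' n x)" for n
    using h h' L2_add[OF h(1) L2_cmult[OF h'(1)]] by auto
  moreover have "(\<lambda>x. g x + c * g' x) \<in> L2" using g g' by (intro L2_add L2_cmult)
  ultimately show ?thesis
    unfolding is_fourier_L2_def by (intro conjI exI[of _ "\<lambda>n x. h n x + c * h' n x"]) auto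
qed

lemma L2_cnj: "f \<in> L2 \<Longrightarrow> (\<lambda>x. cnj (f x)) \<in> L2"
proof -
  assume "f \<in> L2"
  moreover have "cnj \<in> borel_measurable borel"
    by (intro borel_measurable_continuous_onI continuous_on_cnj continuous_on_id)
  ultimately show "(\<lambda>x. cnj (f x)) \<in> L2"
    by (auto simp: L2_iff intro: measurable_compose)
qed

lemma L2_inner_polarization:
  assumes f: "f \<in> L2" and g: "g \<in> L2"
  shows "(\<integral>x. (norm (f x + c * g x))\<^sup>2 \<partial>lborel)
    = (\<integral>x. (norm (f x))\<^sup>2 \<partial>lborel) + 2 * Re (cnj c * L2_inner f g) + (norm c)\<^sup>2 * (\<integral>x. (norm (g x))\<^sup>2 \<partial>lborel)"
proof -
  have i: "integrable lborel (\<lambda>x. (norm (f x))\<^sup>2)" "integrable lborel (\<lambda>x. (norm (g x))\<^sup>2)"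
    "integrable lborel (\<lambda>x. f x * cnj (g x))"
    using f g L2_product_integrable[OF f L2_cnj[OF g]] by (auto simp: L2_def)
  then have iR: "integrable lborel (\<lambda>x. Re (cnj c * (f x * cnj (g x))))"
    by (intro integrable_Re integrable_mult_right) auto
  have "(\<integral>x. Re (cnj c * (f x * cnj (g x))) \<partial>lborel) = Re (\<integral>x. cnj c * (f x * cnj (g x)) \<partial>lborel)"
    using i by (intro integral_Re) auto
  also have "\<dots> = Re (cnj c * L2_inner f g)"
    unfolding L2_inner_def by (simp only: integral_mult_right_zero)
  finally have R: "(\<integral>x. Re (cnj c * (f x * cnj (g x))) \<partial>lborel) = Re (cnj c * L2_inner f g)" .
  have "(norm (f x + c * g x))\<^sup>2 = (norm (f x))\<^sup>2 + 2 * Re (cnj c * (f x * cnj (g x))) + (norm c)\<^sup>2 * (norm (g x))\<^sup>2" for x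
    unfolding cmod_power2 by (simp add: power2_eq_square algebra_simps)
  then have "(\<integral>x. (norm (f x + c * g x))\<^sup>2 \<partial>lborel)
    = (\<integral>x. (norm (f x))\<^sup>2 + 2 * Re (cnj c * (f x * cnj (g x))) + (norm c)\<^sup>2 * (norm (g x))\<^sup>2 \<partial>lborel)"
    by (simp only:)
  also have "\<dots> = (\<integral>x. (norm (f x))\<^sup>2 \<partial>lborel) + 2 * (\<integral>x. Re (cnj c * (f x * cnj (g x))) \<partial>lborel)
      + (norm c)\<^sup>2 * (\<integral>x. (norm (g x))\<^sup>2 \<partial>lborel)"
    using i iR by (simp del: times_complex.simps)
  finally show ?thesis by (simp only: R)
qed

text \<open>Polarization: the norm of \<open>f + c * f'\<close> is preserved for every
  \<open>c\<close>. The choice \<open>c = 1\<close> recovers the real part of the inner product and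
  \<open>c = \<i>\<close> the imaginary part.\<close>

lemma plancherel_inner:
  assumes f: "f \<in> L2" "is_fourier_L2 f g" and f': "f' \<in> L2" "is_fourier_L2 f' g'"
  shows "L2_inner f f' = L2_inner g g'"
proof -
  have g: "g \<in> L2" "g' \<in> L2" using f f' by (auto simp: is_fourier_L2_def)
  have "Re (cnj c * L2_inner f f') = Re (cnj c * L2_inner g g')" for c
  proof -
    have "(\<lambda>x. f x + c * f' x) \<in> L2" using f f' by (intro L2_add L2_cmult)
    from is_fourier_L2_norm[OF this is_fourier_L2_add_cmult[OF f f']]
    show ?thesis
      unfolding L2_inner_polarization[OF f(1) f'(1)] L2_inner_polarization[OF g]
      using is_fourier_L2_norm[OF f] is_fourier_L2_norm[OF f'] by simp
  qed
  from this[of 1] this[of \<i>] show ?thesis by (simp add: complex_eq_iff)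
qed

text \<open>Riesz-Fischer for a sequence with a geometric rate. Since the squared increments decay
  like 4^-k, they remain summable after multiplication by 2^k; the weighted sum \<open>W\<close> is
  then finite almost everywhere and forces pointwise convergence without passing to a
  subsequence.\<close>

lemma L2_complete:
  fixes u :: "nat \<Rightarrow> real^2 \<Rightarrow> complex"
  assumes u: "\<And>n. u n \<in> L2"
    and cauchy: "\<And>k m. k \<le> m \<Longrightarrow> energy (\<lambda>x. u k x - u m x) \<le> ennreal (C * (1 / 4) ^ k)" and C: "0 \<le> C"
  obtains g where "g \<in> L2" "L2_tendsto u g"
proof -
  have [measurable]: "u n \<in> borel_measurable borel" for n using u by auto
  define W where "W x = (\<Sum>k. ennreal (2 ^ k * (norm (u (Suc k) x - u k x))\<^sup>2))" for x
  have [measurable]: "W \<in> borel_measurable borel" unfolding W_def by measurable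
  have "(\<integral>\<^sup>+x. W x \<partial>lborel) = (\<Sum>k. \<integral>\<^sup>+x. ennreal (2 ^ k * (norm (u (Suc k) x - u k x))\<^sup>2) \<partial>lborel)"
    unfolding W_def by (rule nn_integral_suminf) measurable
  also have "\<dots> \<le> (\<Sum>k. ennreal (C * (1 / 2) ^ k))"
  proof (rule suminf_le)
    fix k
    have "(\<integral>\<^sup>+x. ennreal (2 ^ k * (norm (u (Suc k) x - u k x))\<^sup>2) \<partial>lborel) = ennreal (2 ^ k) * energy (\<lambda>x. u k x - u (Suc k) x)"
      by (simp add: ennreal_mult nn_integral_cmult norm_minus_commute)
    also have "\<dots> \<le> ennreal (2 ^ k) * ennreal (C * (1 / 4) ^ k)"
      by (intro mult_left_mono cauchy) auto
    also have "\<dots> = ennreal (C * (1 / 2) ^ k)"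
      using C by (simp flip: ennreal_mult add: power_divide power_mult_distrib[symmetric])
        (simp add: field_simps flip: power_mult_distrib)
    finally show "(\<integral>\<^sup>+x. ennreal (2 ^ k * (norm (u (Suc k) x - u k x))\<^sup>2) \<partial>lborel) \<le> ennreal (C * (1 / 2) ^ k)" .
  qed auto
  also have "\<dots> = ennreal (\<Sum>k. C * (1 / 2) ^ k)"
    using C by (intro suminf_ennreal2) (auto intro!: summable_mult summable_geometric)
  also have "\<dots> < \<infinity>" by simp
  finally have "AE x in lborel. W x \<noteq> \<infinity>"
    by (intro nn_integral_PInf_AE) auto
  then have conv: "AE x in lborel. (\<lambda>n. u n x) \<longlonglongrightarrow> lim (\<lambda>n. u n x)"
  proof eventually_elim
    case (elim x)
    then have s: "summable (\<lambda>k. 2 ^ k * (norm (u (Suc k) x - u k x))\<^sup>2)"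
      unfolding W_def by (intro summable_suminf_not_top) auto
    have "summable (\<lambda>k. norm (u (Suc k) x - u k x))"
    proof (rule summable_comparison_test'[where N=0])
      show "summable (\<lambda>k. (1 / 2) ^ k + 2 ^ k * (norm (u (Suc k) x - u k x))\<^sup>2)"
        by (intro summable_add s summable_geometric) simp
      fix k :: nat
      let ?d = "norm (u (Suc k) x - u k x)"
      \<comment> \<open>This is where the weight is spent: an increment is either at most 2^-k or at
        most its weighted square, and both bounds are summable.\<close>
      have "?d \<le> (1 / 2) ^ k + 2 ^ k * ?d\<^sup>2"
      proof (cases "2 ^ k * ?d \<le> 1")
        case True
        then have "?d \<le> (1 / 2) ^ k" by (simp add: field_simps)
        then show ?thesis by (simp add: add_increasing2)
      next
        case False
        then have "1 * ?d \<le> (2 ^ k * ?d) * ?d" by (intro mult_right_mono) auto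
        then have "?d \<le> 2 ^ k * ?d\<^sup>2" by (simp add: power2_eq_square mult.assoc)
        then show ?thesis by (simp add: add_increasing)
      qed
      then show "norm ?d \<le> (1 / 2) ^ k + 2 ^ k * ?d\<^sup>2" by simp
    qed
    then have "summable (\<lambda>k. u (Suc k) x - u k x)" by (rule summable_norm_cancel)
    then have "convergent (\<lambda>n. \<Sum>k<n. u (Suc k) x - u k x)"
      by (simp add: summable_iff_convergent)
    then have "convergent (\<lambda>n. u n x - u 0 x)"
      by (simp only: sum_lessThan_telescope[of "\<lambda>n. u n x"])
    then have "convergent (\<lambda>n. (u n x - u 0 x) + u 0 x)"
      by (intro convergent_add convergent_const)
    then show ?case by (simp add: convergent_LIMSEQ_iff)
  qed
  define g where "g x = lim (\<lambda>n. u n x)" for x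
  have [measurable]: "g \<in> borel_measurable borel" unfolding g_def by measurable
  \<comment> \<open>The rate between two members of the sequence passes to the limit by Fatou's
    lemma in \<open>m\<close>; it gives both \<open>g \<in> L2\<close> and the convergence.\<close>
  have bound: "energy (\<lambda>x. u k x - g x) \<le> ennreal (C * (1 / 4) ^ k)" for k
  proof -
    have "energy (\<lambda>x. u k x - g x) = (\<integral>\<^sup>+x. liminf (\<lambda>m. ennreal ((norm (u k x - u m x))\<^sup>2)) \<partial>lborel)"
    proof (rule nn_integral_cong_AE)
      show "AE x in lborel. ennreal ((norm (u k x - g x))\<^sup>2) = liminf (\<lambda>m. ennreal ((norm (u k x - u m x))\<^sup>2))"
        using conv
      proof eventually_elim
        case (elim x)
        show ?case unfolding g_def
          by (intro lim_imp_Liminf[symmetric] tendsto_intros elim) auto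
      qed
    qed
    also have "\<dots> \<le> liminf (\<lambda>m. energy (\<lambda>x. u k x - u m x))"
      by (rule nn_integral_liminf) measurable
    also have "\<dots> \<le> liminf (\<lambda>m::nat. ennreal (C * (1 / 4) ^ k))"
      using cauchy by (intro Liminf_mono) (auto intro!: eventually_sequentiallyI[of k])
    also have "\<dots> = ennreal (C * (1 / 4) ^ k)" by (simp add: Liminf_const)
    finally show ?thesis .
  qed
  have "(\<lambda>x. u 0 x - g x) \<in> L2"
    using bound[of 0] by (auto simp: L2_iff intro: le_less_trans)
  from L2_diff[OF u[of 0] this] have "g \<in> L2" by simp
  moreover have "L2_tendsto u g"
    unfolding L2_tendsto_def
  proof (rule tendsto_sandwich[of "\<lambda>_. 0"])
    have "(\<lambda>k. ennreal (C * (1 / 4) ^ k)) \<longlonglongrightarrow> ennreal (C * 0)"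
      by (intro tendsto_intros LIMSEQ_realpow_zero) auto
    then show "(\<lambda>k. ennreal (C * (1 / 4) ^ k)) \<longlonglongrightarrow> 0" by simp
  qed (use bound in auto)
  ultimately show ?thesis using that by blast
qed

text \<open>Truncations are selected so as to converge at a geometric rate. Their transforms inherit
  the rate, as the transform does not increase the energy of a difference, and completeness yields
  the limit.\<close>

lemma fourier_L2_exists:
  assumes f: "f \<in> L2"
  shows "\<exists>g. is_fourier_L2 f g"
proof -
  have [measurable]: "f \<in> borel_measurable borel" using f by auto
  have "\<exists>n. energy (\<lambda>x. truncate f n x - f x) < ennreal ((1 / 4) ^ k)" for k
  proof -
    have "\<forall>\<^sub>F n in sequentially. energy (\<lambda>x. truncate f n x - f x) < ennreal ((1 / 4) ^ k)"
      using L2_tendsto_truncate[OF f] unfolding L2_tendsto_def by (rule order_tendstoD) simp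
    then show ?thesis by (auto simp: eventually_sequentially)
  qed
  then obtain N where N: "\<And>k. energy (\<lambda>x. truncate f (N k) x - f x) < ennreal ((1 / 4) ^ k)"
    by metis
  define h where "h k = truncate f (N k)" for k
  have h: "h k \<in> L2" "integrable lborel (h k)" for k
    using f by (auto simp: h_def intro: truncate_L2 truncate_integrable)
  have [measurable]: "h k \<in> borel_measurable borel" for k using h by auto
  have hf: "L2_tendsto h f"
    unfolding L2_tendsto_def
  proof (rule tendsto_sandwich[of "\<lambda>_. 0"])
    have "(\<lambda>k. ennreal ((1 / 4) ^ k)) \<longlonglongrightarrow> ennreal 0"
      by (intro tendsto_ennrealI LIMSEQ_realpow_zero) auto
    then show "(\<lambda>k. ennreal ((1 / 4) ^ k)) \<longlonglongrightarrow> 0" by simp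
    show "\<forall>\<^sub>F k in sequentially. energy (\<lambda>x. h k x - f x) \<le> ennreal ((1 / 4) ^ k)"
      unfolding h_def using N less_imp_le by (intro always_eventually allI) blast
  qed auto
  \<comment> \<open>The constant 4 is 2 + 2, from the squared triangle inequality through
    \<open>f\<close>.\<close>
  have "energy (\<lambda>x. fourier_integral (h k) x - fourier_integral (h m) x) \<le> ennreal (4 * (1 / 4) ^ k)"
    if km: "k \<le> m" for k m
  proof -
    have "fourier_integral (h k) \<xi> - fourier_integral (h m) \<xi> = fourier_integral (\<lambda>x. h k x - h m x) \<xi>" for \<xi>
      using fourier_integral_add_cmult[OF h(2)[of k] h(2)[of m], of "-1" \<xi>] by simp
    then have "energy (\<lambda>x. fourier_integral (h k) x - fourier_integral (h m) x) \<le> energy (\<lambda>x. h k x - h m x)"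
      using h by (simp only:) (intro energy_fourier_integral_le L2_diff Bochner_Integration.integrable_diff)
    also have "\<dots> = energy (\<lambda>x. (h k x - f x) - (h m x - f x))" by simp
    also have "\<dots> \<le> 2 * energy (\<lambda>x. h k x - f x) + 2 * energy (\<lambda>x. h m x - f x)"
      by (rule energy_diff) measurable
    also have "\<dots> \<le> 2 * ennreal ((1 / 4) ^ k) + 2 * ennreal ((1 / 4) ^ m)"
      unfolding h_def using N by (intro add_mono mult_left_mono less_imp_le) auto
    also have "\<dots> \<le> 2 * ennreal ((1 / 4) ^ k) + 2 * ennreal ((1 / 4) ^ k)"
      using km by (intro add_mono mult_left_mono ennreal_leI power_decreasing) auto
    also have "\<dots> = ennreal (4 * (1 / 4) ^ k)"
      by (simp flip: ennreal_plus ennreal_mult ennreal_numeral)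
    finally show ?thesis .
  qed
  then obtain g where "g \<in> L2" "L2_tendsto (\<lambda>k. fourier_integral (h k)) g"
    using L2_complete[of "\<lambda>k. fourier_integral (h k)" 4] h fourier_integral_L2 by auto
  then show ?thesis
    unfolding is_fourier_L2_def using h hf by blast
qed

lemma is_fourier_L2_fourier_L2: "f \<in> L2 \<Longrightarrow> is_fourier_L2 f (fourier_L2 f)"
  unfolding fourier_L2_def using fourier_L2_exists by (rule someI_ex)

section \<open>Fourier transforms under affine substitutions\<close>

lemma energy_affine:
  fixes f :: "real^2 \<Rightarrow> complex"
  assumes A: "invertible A" and [measurable]: "f \<in> borel_measurable borel"
  shows "energy (\<lambda>x. f (A *v x - l)) = ennreal (1 / \<bar>det A\<bar>) * energy f"
proof -
  have d0: "det A \<noteq> 0" using A invertible_det_nz by blast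
  have "energy f = energy (\<lambda>x. f (x - l))"
    using nn_integral_shift[of "\<lambda>x. ennreal ((norm (f x))\<^sup>2)" "- l"] by simp
  also have "\<dots> = ennreal \<bar>det A\<bar> * energy (\<lambda>x. f (A *v x - l))"
    by (rule nn_integral_matrix[OF A]) measurable
  finally have "ennreal (1 / \<bar>det A\<bar>) * energy f = (ennreal (1 / \<bar>det A\<bar>) * ennreal \<bar>det A\<bar>) * energy (\<lambda>x. f (A *v x - l))"
    by (simp add: mult.assoc)
  also have "ennreal (1 / \<bar>det A\<bar>) * ennreal \<bar>det A\<bar> = 1"
    using d0 by (simp flip: ennreal_mult)
  finally show ?thesis by simp
qed

lemma L2_affine:
  assumes "invertible A" "f \<in> L2"
  shows "(\<lambda>x. f (A *v x - l)) \<in> L2"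
proof -
  have [measurable]: "f \<in> borel_measurable borel" using assms by auto
  show ?thesis
    using assms energy_affine[OF assms(1), of f l] by (auto simp: L2_iff ennreal_mult_less_top)
qed

lemma L2_tendsto_affine:
  assumes A: "invertible A" and "\<And>n. h n \<in> L2" "f \<in> L2" "L2_tendsto h f"
  shows "L2_tendsto (\<lambda>n x. h n (A *v x - l)) (\<lambda>x. f (A *v x - l))"
proof -
  have [measurable]: "h n \<in> borel_measurable borel" "f \<in> borel_measurable borel" for n using assms by auto
  have "(\<lambda>n. ennreal (1 / \<bar>det A\<bar>) * energy (\<lambda>x. h n x - f x)) \<longlonglongrightarrow> ennreal (1 / \<bar>det A\<bar>) * 0"
    using assms(4) unfolding L2_tendsto_def by (intro ennreal_tendsto_cmult) auto
  then show ?thesis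
    unfolding L2_tendsto_def using energy_affine[OF A, of "\<lambda>x. h _ x - f x" l] by simp
qed

lemma inner_matrix_inv_transpose:
  fixes A :: "real^'n^'n"
  assumes "invertible A"
  shows "(matrix_inv (transpose A) *v \<xi>) \<bullet> (A *v x) = \<xi> \<bullet> x"
proof -
  have "invertible (transpose A)" using assms by (rule transpose_invertible)
  then have "transpose A *v (matrix_inv (transpose A) *v \<xi>) = \<xi>"
    by (simp add: matrix_vector_mul_assoc matrix_inv_inverse)
  then show ?thesis
    by (metis dot_lmul_matrix transpose_matrix_vector)
qed

lemma fourier_integral_affine:
  fixes h :: "real^2 \<Rightarrow> complex"
  assumes A: "invertible A" and h: "integrable lborel h"
  defines "B \<equiv> matrix_inv (transpose A)"
  shows "fourier_integral (\<lambda>x. h (A *v x - l)) \<xi>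
    = of_real (1 / \<bar>det A\<bar>) * (echar (- (B *v \<xi>)) l * fourier_integral h (B *v \<xi>))"
proof -
  have d0: "det A \<noteq> 0" using A invertible_det_nz by blast
  have [measurable]: "h \<in> borel_measurable borel" using h by auto
  define F where "F y = h (y - l) * echar (- (B *v \<xi>)) y" for y
  have [measurable]: "F \<in> borel_measurable borel" unfolding F_def by measurable
  have "echar (- \<xi>) x = echar (- (B *v \<xi>)) (A *v x)" for x
    by (simp add: echar_def B_def inner_matrix_inv_transpose[OF A])
  then have "fourier_integral (\<lambda>x. h (A *v x - l)) \<xi> = (\<integral>x. F (A *v x) \<partial>lborel)"
    by (simp add: fourier_integral_echar F_def)
  also have "\<dots> = (1 / \<bar>det A\<bar>) *\<^sub>R (\<integral>x. F x \<partial>lborel)"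
    using d0 by (subst integral_matrix[OF A, of F]) auto
  also have "(\<integral>x. F x \<partial>lborel) = (\<integral>x. F (x + l) \<partial>lborel)"
    by (rule integral_shift[symmetric]) measurable
  also have "\<dots> = (\<integral>x. echar (- (B *v \<xi>)) l * (h x * echar (- (B *v \<xi>)) x) \<partial>lborel)"
    by (simp add: F_def echar_add_right ac_simps)
  also have "\<dots> = echar (- (B *v \<xi>)) l * fourier_integral h (B *v \<xi>)"
    unfolding fourier_integral_echar by (rule integral_mult_right_zero)
  finally show ?thesis by (simp add: scaleR_conv_of_real)
qed

text \<open>The substitution may be made in each member of an approximating sequence, where it is a
  computation with integrals. The induced operation on transforms multiplies every energy by the
  same constant (\<open>isom\<close>), so convergence survives.\<close>

lemma is_fourier_L2_affine:
  assumes A: "invertible A" and f: "f \<in> L2" "is_fourier_L2 f g"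
  defines "B \<equiv> matrix_inv (transpose A)"
  shows "is_fourier_L2 (\<lambda>x. f (A *v x - l))
    (\<lambda>\<xi>. of_real (1 / \<bar>det A\<bar>) * (echar (- (B *v \<xi>)) l * g (B *v \<xi>)))"
proof -
  obtain h where h: "\<And>n. h n \<in> L2" "\<And>n. integrable lborel (h n)" "L2_tendsto h f"
    "L2_tendsto (\<lambda>n. fourier_integral (h n)) g" and g: "g \<in> L2"
    using f unfolding is_fourier_L2_def by blast
  have [measurable]: "g \<in> borel_measurable borel" "h n \<in> borel_measurable borel" for n using g h by auto
  have "invertible (transpose A)" using A by (rule transpose_invertible)
  from matrix_inv_inverse[OF this] have B: "invertible B" unfolding invertible_def B_def by blast
  have isom: "energy (\<lambda>\<xi>. of_real (1 / \<bar>det A\<bar>) * (echar (- (B *v \<xi>)) l * u (B *v \<xi>)))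
     = ennreal ((1 / \<bar>det A\<bar>)\<^sup>2 * (1 / \<bar>det B\<bar>)) * energy u"
    if [measurable]: "u \<in> borel_measurable borel" for u
  proof -
    have "energy (\<lambda>\<xi>. of_real (1 / \<bar>det A\<bar>) * (echar (- (B *v \<xi>)) l * u (B *v \<xi>)))
      = energy (\<lambda>\<xi>. of_real (1 / \<bar>det A\<bar>) * u (B *v \<xi>))"
      by (simp add: norm_mult norm_divide)
    also have "\<dots> = ennreal ((1 / \<bar>det A\<bar>)\<^sup>2) * energy (\<lambda>\<xi>. u (B *v \<xi>))"
      by (subst energy_cmult) (auto simp: norm_divide)
    also have "energy (\<lambda>\<xi>. u (B *v \<xi>)) = ennreal (1 / \<bar>det B\<bar>) * energy u"
      using energy_affine[OF B that, of 0] by simp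
    finally show ?thesis
      unfolding mult.assoc[symmetric] by (subst ennreal_mult) auto
  qed
  have "(\<lambda>\<xi>. of_real (1 / \<bar>det A\<bar>) * (echar (- (B *v \<xi>)) l * g (B *v \<xi>))) \<in> L2"
    using isom[of g] g by (auto simp: L2_iff ennreal_mult_less_top)
  moreover have "(\<lambda>x. h n (A *v x - l)) \<in> L2" for n by (intro L2_affine A h)
  moreover have "integrable lborel (\<lambda>x. h n (A *v x - l))" for n
  proof -
    have "integrable lborel (\<lambda>x. h n (x - l))"
      using h(2)[of n] integrable_shift_iff[of "h n" "- l"] by simp
    then show ?thesis by (subst integrable_matrix_iff[OF A, of "\<lambda>x. h n (x - l)"]) auto
  qed
  moreover have "L2_tendsto (\<lambda>n x. h n (A *v x - l)) (\<lambda>x. f (A *v x - l))"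
    using A h f by (intro L2_tendsto_affine) auto
  moreover have "L2_tendsto (\<lambda>n. fourier_integral (\<lambda>x. h n (A *v x - l)))
     (\<lambda>\<xi>. of_real (1 / \<bar>det A\<bar>) * (echar (- (B *v \<xi>)) l * g (B *v \<xi>)))"
  proof -
    have "energy (\<lambda>\<xi>. fourier_integral (\<lambda>x. h n (A *v x - l)) \<xi> - of_real (1 / \<bar>det A\<bar>) * (echar (- (B *v \<xi>)) l * g (B *v \<xi>)))
      = ennreal ((1 / \<bar>det A\<bar>)\<^sup>2 * (1 / \<bar>det B\<bar>)) * energy (\<lambda>\<xi>. fourier_integral (h n) \<xi> - g \<xi>)" for n
      using isom[of "\<lambda>\<xi>. fourier_integral (h n) \<xi> - g \<xi>"]
      by (simp add: fourier_integral_affine[OF A h(2)] B_def[symmetric] right_diff_distrib)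
    moreover have "(\<lambda>n. ennreal ((1 / \<bar>det A\<bar>)\<^sup>2 * (1 / \<bar>det B\<bar>)) * energy (\<lambda>\<xi>. fourier_integral (h n) \<xi> - g \<xi>))
      \<longlonglongrightarrow> ennreal ((1 / \<bar>det A\<bar>)\<^sup>2 * (1 / \<bar>det B\<bar>)) * 0"
      using h(4) unfolding L2_tendsto_def by (intro ennreal_tendsto_cmult) auto
    ultimately show ?thesis unfolding L2_tendsto_def by simp
  qed
  ultimately show ?thesis
    unfolding is_fourier_L2_def by (intro conjI exI[of _ "\<lambda>n x. h n (A *v x - l)"]) auto
qed

section \<open>Frame bounds\<close>

text \<open>The estimate for one scale and angle. Normalizing by \<open>\<kappa>\<close> with square
  \<open>\<bar>det A\<bar>\<close> cancels the determinant that Parseval produces, since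
  \<open>\<bar>det M\<bar>\<close> equals \<open>\<bar>det A\<bar> / \<bar>det P\<bar>\<close>; only
  \<open>det P\<close> is left, and estimates at different scales can be added. The error
  \<open>R\<close> carries just the square of \<open>g\<close> at one point as its
  \<open>f\<close>-dependent factor, ready for a bound uniform in \<open>\<xi>\<close>.\<close>

lemma wavepacket_coefficient_bounds:
  fixes \<psi> w f g :: "real^2 \<Rightarrow> complex" and A P :: "real^2^2"
  assumes f: "f \<in> L2" "is_fourier_L2 f g" and \<psi>: "\<psi> \<in> L2" "is_fourier_L2 \<psi> w"
    and A: "invertible A" and P: "invertible P" and \<kappa>: "0 < \<kappa>" "\<kappa>\<^sup>2 = \<bar>det A\<bar>"
  defines "B \<equiv> matrix_inv (transpose A)" and "Q \<equiv> transpose (matrix_inv P)"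
  defines "T \<equiv> \<lambda>\<zeta> \<xi>. norm (w (B *v \<xi>)) * norm (w (B *v \<xi> - \<zeta>))"
  defines "C \<equiv> \<integral>\<^sup>+z. ennreal ((norm (L2_inner f (\<lambda>x. of_real \<kappa> * \<psi> (A *v x - P *v z))))\<^sup>2) \<partial>count_space int_points"
    and "S \<equiv> \<integral>\<^sup>+\<xi>. ennreal ((norm (g \<xi>))\<^sup>2) * ennreal ((norm (w (B *v \<xi>)))\<^sup>2) \<partial>lborel"
    and "R \<equiv> \<integral>\<^sup>+z. (\<integral>\<^sup>+\<xi>. ennreal ((norm (g \<xi>))\<^sup>2) *
           ennreal ((T (Q *v z) \<xi> + T (- (Q *v z)) \<xi>) / 2) \<partial>lborel) \<partial>count_space (int_points - {0})"
  assumes fin: "S < \<infinity>" "R < \<infinity>"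
  shows "ennreal \<bar>det P\<bar> * C \<le> S + R" "S \<le> ennreal \<bar>det P\<bar> * C + R"
proof -
  have gw: "g \<in> L2" "w \<in> L2" using f \<psi> by (auto simp: is_fourier_L2_def)
  then have [measurable]: "g \<in> borel_measurable borel" "w \<in> borel_measurable borel" by auto
  have At: "invertible (transpose A)" using A by (rule transpose_invertible)
  note AB = matrix_inv_inverse[OF At, folded B_def] and PP = matrix_inv_inverse[OF P]
  have B: "invertible B" using AB unfolding invertible_def by blast
  have QP: "transpose P ** Q = mat 1" "Q ** transpose P = mat 1"
    unfolding Q_def by (simp_all flip: matrix_transpose_mul add: PP)
  \<comment> \<open>\<open>M\<close> carries the integer points onto the periodization lattice. Its
    inverse \<open>N\<close> turns the translation phase into a character:
    \<open>(B *v \<xi>) \<bullet> (P *v z) = z \<bullet> (N *v \<xi>)\<close>.\<close>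
  define M where "M = transpose A ** Q"
  define N where "N = transpose P ** B"
  have "M ** N = transpose A ** (Q ** transpose P) ** B" "N ** M = transpose P ** (B ** transpose A) ** Q"
    unfolding M_def N_def by (simp_all add: matrix_mul_assoc)
  then have MN: "M ** N = mat 1" "N ** M = mat 1" using AB QP by simp_all
  then have M: "invertible M" unfolding invertible_def by blast
  have Minv: "matrix_inv M = N"
    using matrix_inv_inverse[OF M] MN by (metis matrix_mul_assoc matrix_mul_lid matrix_mul_rid)
  have BM: "B *v (M *v z) = Q *v z" for z
    by (simp add: M_def matrix_vector_mul_assoc matrix_mul_assoc AB)
  have dA: "det A \<noteq> 0" and dP: "det P \<noteq> 0" using A P invertible_det_nz by blast+
  have "det P * det Q = 1"
    using QP(1) by (metis det_I det_mul det_transpose)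
  then have "det M = det A / det P"
    using dP by (simp add: M_def det_mul field_simps)
  then have dM: "\<bar>det M\<bar> = \<bar>det A\<bar> / \<bar>det P\<bar>" by simp
  define H where "H \<xi> = g \<xi> * cnj (w (B *v \<xi>))" for \<xi>
  have wB: "(\<lambda>\<xi>. w (B *v \<xi>)) \<in> L2" using L2_affine[OF B gw(2), of 0] by simp
  have [measurable]: "H \<in> borel_measurable borel"
    using L2_measurable[OF L2_cnj[OF wB]] unfolding H_def by measurable
  have H: "integrable lborel H"
    unfolding H_def by (intro L2_product_integrable gw(1) L2_cnj wB)
  have SH: "energy H = S"
    unfolding S_def H_def by (simp add: norm_mult power_mult_distrib ennreal_mult)
  define R' where "R' = (\<integral>\<^sup>+z. (\<integral>\<^sup>+x. ennreal (norm (H x) * norm (H (x + M *v z))) \<partial>lborel) \<partial>count_space (int_points - {0}))"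
  have "R' \<le> R"
    unfolding R'_def R_def
  proof (rule nn_integral_mono)
    fix z :: "real^2"
    define \<gamma> where "\<gamma> = Q *v z"
    have [measurable]: "T \<zeta> \<in> borel_measurable borel" for \<zeta> unfolding T_def by measurable
    \<comment> \<open>In the argument of the window the shift is the dual lattice vector
      \<open>\<gamma>\<close> itself; the matrix \<open>A\<close> has disappeared from it.\<close>
    have Bs: "B *v (\<xi> + M *v z) = B *v \<xi> + \<gamma>" "B *v (\<xi> - M *v z) = B *v \<xi> - \<gamma>" for \<xi>
      by (simp_all add: matrix_vector_right_distrib matrix_vector_mult_diff_distrib BM \<gamma>_def)
    have "(\<integral>\<^sup>+x. ennreal (norm (H x) * norm (H (x + M *v z))) \<partial>lborel)
      \<le> (\<integral>\<^sup>+x. ennreal ((norm (g x))\<^sup>2) * ennreal (T (- \<gamma>) x / 2) + ennreal ((norm (g (x + M *v z)))\<^sup>2) * ennreal (T (- \<gamma>) x / 2) \<partial>lborel)"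
    proof (rule nn_integral_mono)
      fix x
      have T0: "0 \<le> T (- \<gamma>) x" by (simp add: T_def)
      have "norm (H x) * norm (H (x + M *v z)) = (norm (g x) * norm (g (x + M *v z))) * T (- \<gamma>) x"
        by (simp add: H_def T_def norm_mult Bs ac_simps)
      also have "\<dots> \<le> (((norm (g x))\<^sup>2 + (norm (g (x + M *v z)))\<^sup>2) / 2) * T (- \<gamma>) x"
        using sum_squares_bound[of "norm (g x)" "norm (g (x + M *v z))"]
        by (intro mult_right_mono T0) (simp add: field_simps)
      also have "\<dots> = (norm (g x))\<^sup>2 * (T (- \<gamma>) x / 2) + (norm (g (x + M *v z)))\<^sup>2 * (T (- \<gamma>) x / 2)"
        by (simp add: field_simps)
      finally show "ennreal (norm (H x) * norm (H (x + M *v z)))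
        \<le> ennreal ((norm (g x))\<^sup>2) * ennreal (T (- \<gamma>) x / 2) + ennreal ((norm (g (x + M *v z)))\<^sup>2) * ennreal (T (- \<gamma>) x / 2)"
        using T0 by (simp add: ennreal_mult[symmetric] ennreal_plus[symmetric] ennreal_leI del: ennreal_plus)
    qed
    also have "\<dots> = (\<integral>\<^sup>+x. ennreal ((norm (g x))\<^sup>2) * ennreal (T (- \<gamma>) x / 2) \<partial>lborel)
        + (\<integral>\<^sup>+x. ennreal ((norm (g (x + M *v z)))\<^sup>2) * ennreal (T (- \<gamma>) x / 2) \<partial>lborel)"
      by (rule nn_integral_add) measurable
    \<comment> \<open>Translating by \<open>- (M *v z)\<close> brings \<open>g\<close> back to
      \<open>x\<close>. It interchanges the two window factors, so \<open>T (- \<gamma>)\<close>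
      becomes \<open>T \<gamma>\<close>.\<close>
    also have "(\<integral>\<^sup>+x. ennreal ((norm (g (x + M *v z)))\<^sup>2) * ennreal (T (- \<gamma>) x / 2) \<partial>lborel)
        = (\<integral>\<^sup>+x. ennreal ((norm (g x))\<^sup>2) * ennreal (T \<gamma> x / 2) \<partial>lborel)"
    proof -
      have "(\<lambda>x. ennreal ((norm (g (x + M *v z)))\<^sup>2) * ennreal (T (- \<gamma>) x / 2)) \<in> borel_measurable borel" by measurable
      from nn_integral_shift[OF this, of "- (M *v z)", symmetric]
      show ?thesis by (simp add: T_def Bs mult.commute)
    qed
    also have "(\<integral>\<^sup>+x. ennreal ((norm (g x))\<^sup>2) * ennreal (T (- \<gamma>) x / 2) \<partial>lborel)
        + (\<integral>\<^sup>+x. ennreal ((norm (g x))\<^sup>2) * ennreal (T \<gamma> x / 2) \<partial>lborel)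
        = (\<integral>\<^sup>+x. ennreal ((norm (g x))\<^sup>2) * ennreal (T (- \<gamma>) x / 2) + ennreal ((norm (g x))\<^sup>2) * ennreal (T \<gamma> x / 2) \<partial>lborel)"
      by (rule nn_integral_add[symmetric]) measurable
    also have "\<dots> = (\<integral>\<^sup>+x. ennreal ((norm (g x))\<^sup>2) * ennreal ((T \<gamma> x + T (- \<gamma>) x) / 2) \<partial>lborel)"
    proof (rule nn_integral_cong)
      fix x
      have "0 \<le> T (- \<gamma>) x" "0 \<le> T \<gamma> x" by (simp_all add: T_def)
      then have "ennreal (T (- \<gamma>) x / 2) + ennreal (T \<gamma> x / 2) = ennreal ((T \<gamma> x + T (- \<gamma>) x) / 2)"
        by (simp add: ennreal_plus[symmetric] add_divide_distrib add.commute del: ennreal_plus)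
      then show "ennreal ((norm (g x))\<^sup>2) * ennreal (T (- \<gamma>) x / 2) + ennreal ((norm (g x))\<^sup>2) * ennreal (T \<gamma> x / 2)
        = ennreal ((norm (g x))\<^sup>2) * ennreal ((T \<gamma> x + T (- \<gamma>) x) / 2)"
        by (simp only: distrib_left[symmetric])
    qed
    finally show "(\<integral>\<^sup>+x. ennreal (norm (H x) * norm (H (x + M *v z))) \<partial>lborel)
      \<le> (\<integral>\<^sup>+\<xi>. ennreal ((norm (g \<xi>))\<^sup>2) * ennreal ((T (Q *v z) \<xi> + T (- (Q *v z)) \<xi>) / 2) \<partial>lborel)"
      by (simp only: \<gamma>_def)
  qed
  define C' where "C' = (\<integral>\<^sup>+z. ennreal ((norm (\<integral>x. H x * echar z (N *v x) \<partial>lborel))\<^sup>2) \<partial>count_space int_points)"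
  have coef: "(norm (L2_inner f (\<lambda>x. of_real \<kappa> * \<psi> (A *v x - P *v z))))\<^sup>2
      = (1 / \<bar>det A\<bar>) * (norm (\<integral>x. H x * echar z (N *v x) \<partial>lborel))\<^sup>2" for z
  proof -
    have "L2_inner f (\<lambda>x. of_real \<kappa> * \<psi> (A *v x - P *v z)) = of_real \<kappa> * L2_inner f (\<lambda>x. \<psi> (A *v x - P *v z))"
      unfolding L2_inner_def by (simp add: mult.left_commute)
    also have "L2_inner f (\<lambda>x. \<psi> (A *v x - P *v z))
        = L2_inner g (\<lambda>\<xi>. of_real (1 / \<bar>det A\<bar>) * (echar (- (B *v \<xi>)) (P *v z) * w (B *v \<xi>)))"
      unfolding B_def by (intro plancherel_inner f L2_affine A \<psi> is_fourier_L2_affine)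
    also have "\<dots> = (\<integral>\<xi>. of_real (1 / \<bar>det A\<bar>) * (H \<xi> * echar z (N *v \<xi>)) \<partial>lborel)"
      unfolding L2_inner_def
    proof (intro Bochner_Integration.integral_cong refl)
      fix \<xi>
      have "(B *v \<xi>) \<bullet> (P *v z) = z \<bullet> (N *v \<xi>)"
        unfolding N_def matrix_vector_mul_assoc[symmetric] transpose_matrix_vector
        by (metis dot_lmul_matrix inner_commute)
      then have "echar (B *v \<xi>) (P *v z) = echar z (N *v \<xi>)" by (simp add: echar_def)
      then show "g \<xi> * cnj (of_real (1 / \<bar>det A\<bar>) * (echar (- (B *v \<xi>)) (P *v z) * w (B *v \<xi>)))
        = of_real (1 / \<bar>det A\<bar>) * (H \<xi> * echar z (N *v \<xi>))"
        by (simp add: H_def cnj_echar ac_simps)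
    qed
    also have "\<dots> = of_real (1 / \<bar>det A\<bar>) * (\<integral>\<xi>. H \<xi> * echar z (N *v \<xi>) \<partial>lborel)"
      by (rule integral_mult_right_zero)
    finally have "norm (L2_inner f (\<lambda>x. of_real \<kappa> * \<psi> (A *v x - P *v z)))
        = (\<kappa> / \<bar>det A\<bar>) * norm (\<integral>\<xi>. H \<xi> * echar z (N *v \<xi>) \<partial>lborel)"
      using \<kappa>(1) by (simp add: norm_mult norm_divide)
    moreover have "(\<kappa> / \<bar>det A\<bar>)\<^sup>2 = 1 / \<bar>det A\<bar>"
    proof -
      have "t / t\<^sup>2 = 1 / t" for t :: real by (simp add: power2_eq_square)
      then show ?thesis by (simp only: power_divide \<kappa>(2))
    qed
    ultimately show ?thesis by (simp only: power_mult_distrib)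
  qed
  have CC: "C = ennreal (1 / \<bar>det A\<bar>) * C'"
    unfolding C_def C'_def coef by (subst ennreal_mult) (auto simp: nn_integral_cmult)
  have fin': "energy H < \<infinity>" "R' < \<infinity>"
    using fin \<open>R' \<le> R\<close> by (auto simp: SH intro: le_less_trans)
  from lattice_bounds[OF M H, unfolded Minv, folded R'_def C'_def, OF this, unfolded SH]
  have LB: "C' \<le> ennreal \<bar>det M\<bar> * (S + R')" "ennreal \<bar>det M\<bar> * S \<le> C' + ennreal \<bar>det M\<bar> * R'" by auto
  define a where "a = ennreal (\<bar>det P\<bar> / \<bar>det A\<bar>)"
  have aM: "a * ennreal \<bar>det M\<bar> = 1"
    using dA dP by (simp add: a_def dM flip: ennreal_mult)
  have aC: "ennreal \<bar>det P\<bar> * C = a * C'"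
    unfolding CC a_def mult.assoc[symmetric] by (simp flip: ennreal_mult)
  have "a * C' \<le> a * (ennreal \<bar>det M\<bar> * (S + R'))" by (intro mult_left_mono LB) auto
  also have "\<dots> = S + R'" by (simp only: mult.assoc[symmetric] aM mult_1)
  also have "\<dots> \<le> S + R" using \<open>R' \<le> R\<close> by (rule add_left_mono)
  finally show "ennreal \<bar>det P\<bar> * C \<le> S + R" by (simp only: aC)
  have "S = a * (ennreal \<bar>det M\<bar> * S)" by (simp only: mult.assoc[symmetric] aM mult_1)
  also have "\<dots> \<le> a * (C' + ennreal \<bar>det M\<bar> * R')" by (intro mult_left_mono LB) auto
  also have "\<dots> = a * C' + R'" by (simp only: distrib_left mult.assoc[symmetric] aM mult_1)
  also have "\<dots> \<le> a * C' + R" using \<open>R' \<le> R\<close> by (rule add_left_mono)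
  finally show "S \<le> ennreal \<bar>det P\<bar> * C + R" by (simp only: aC)
qed

text \<open>The pair \<open>(0, 0)\<close> stands for the window \<open>\<phi>\<^sub>0\<close>; this is consistent because \<open>A_mat 0 0 = mat 1\<close>.\<close>

definition scale_indices :: "(nat \<times> nat) set" where
  "scale_indices = {(j, k). k < 2 ^ j}"

lemma countable_scale_indices [simp]: "countable scale_indices"
  by (rule countable_subset[of _ UNIV]) auto

text \<open>At level 0 the condition \<open>k < 2 ^ 0\<close> leaves only \<open>k = 0\<close>, so
  splitting off that level produces the single term of the low-frequency window.\<close>

lemma nn_integral_scale_indices:
  fixes F :: "nat \<Rightarrow> nat \<Rightarrow> ennreal"
  shows "(\<integral>\<^sup>+p. F (fst p) (snd p) \<partial>count_space scale_indices) = F 0 0 + (\<Sum>\<^sub>\<infinity>j\<in>{1..}. \<Sum>k<2 ^ j. F j k)"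
proof -
  define G where "G j = (\<Sum>k<2 ^ j. F j k)" for j
  have "(\<integral>\<^sup>+p. F (fst p) (snd p) \<partial>count_space scale_indices)
      = (\<integral>\<^sup>+p. F (fst p) (snd p) * indicator scale_indices p \<partial>count_space UNIV)"
    by (simp add: nn_integral_count_space_indicator)
  also have "\<dots> = (\<integral>\<^sup>+j. \<integral>\<^sup>+k. F j k * indicator scale_indices (j, k) \<partial>count_space UNIV \<partial>count_space UNIV)"
    by (subst nn_integral_fst_count_space[symmetric]) simp
  also have "\<dots> = (\<integral>\<^sup>+j. G j \<partial>count_space UNIV)"
  proof (rule nn_integral_cong)
    fix j
    have "(\<integral>\<^sup>+k. F j k * indicator scale_indices (j, k) \<partial>count_space UNIV)
        = (\<Sum>k<2 ^ j. F j k * indicator scale_indices (j, k))"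
      by (intro nn_integral_count_space') (auto simp: scale_indices_def indicator_def)
    also have "\<dots> = G j"
      unfolding G_def by (intro sum.cong) (auto simp: scale_indices_def)
    finally show "(\<integral>\<^sup>+k. F j k * indicator scale_indices (j, k) \<partial>count_space UNIV) = G j" .
  qed
  also have "\<dots> = (\<integral>\<^sup>+j. G j * indicator {0} j + G j * indicator {1..} j \<partial>count_space UNIV)"
    by (intro nn_integral_cong) (auto simp: indicator_def)
  also have "\<dots> = (\<integral>\<^sup>+j. G j * indicator {0} j \<partial>count_space UNIV) + (\<integral>\<^sup>+j. G j * indicator {1..} j \<partial>count_space UNIV)"
    by (rule nn_integral_add) auto
  also have "(\<integral>\<^sup>+j. G j * indicator {0} j \<partial>count_space UNIV) = F 0 0"
    by (subst nn_integral_count_space'[of "{0}"]) (auto simp: G_def)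
  also have "(\<integral>\<^sup>+j. G j * indicator {1..} j \<partial>count_space UNIV) = (\<Sum>\<^sub>\<infinity>j\<in>{1..}. G j)"
    by (subst infsum_ennreal_eq_nn_integral) (auto simp: nn_integral_count_space_indicator)
  finally show ?thesis by (simp add: G_def)
qed

lemma ennreal_half_sum:
  assumes "0 \<le> a" "0 \<le> b"
  shows "ennreal ((a + b) / 2) = ennreal (1 / 2) * (ennreal a + ennreal b)"
proof -
  have "ennreal ((a + b) / 2) = ennreal (1 / 2 * (a + b))" by simp
  also have "\<dots> = ennreal (1 / 2) * ennreal (a + b)"
    using assms by (intro ennreal_mult) auto
  finally show ?thesis using assms by (simp only: ennreal_plus)
qed

text \<open>The covering and correlation bounds hold for sums over all scales, not scale by scale.
  The single-scale estimates are therefore added first, and Tonelli moves the sum over scales inside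
  the integral against the square of \<open>g\<close>. The matrices \<open>D j k\<close> remain
  abstract: beyond invertibility only the relation of \<open>\<kappa>\<close> to their determinants
  enters.\<close>

lemma frame_sum_bounds:
  fixes \<psi> w :: "nat \<Rightarrow> real^2 \<Rightarrow> complex" and D :: "nat \<Rightarrow> nat \<Rightarrow> real^2^2" and \<kappa> :: "nat \<Rightarrow> real"
    and \<Theta> :: "real^2 \<Rightarrow> ennreal"
  assumes f: "f \<in> L2" and \<psi>: "\<And>j. \<psi> j \<in> L2" "\<And>j. is_fourier_L2 (\<psi> j) (w j)"
    and D: "\<And>j k. invertible (D j k)" and P: "invertible P"
    and \<kappa>: "\<And>j. 0 < \<kappa> j" "\<And>j k. (\<kappa> j)\<^sup>2 = \<bar>det (D j k)\<bar>"
  defines "B \<equiv> \<lambda>j k. matrix_inv (transpose (D j k))"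
  assumes cover: "AE \<xi> in lborel. ennreal a \<le> (\<integral>\<^sup>+p. ennreal ((norm (w (fst p) (B (fst p) (snd p) *v \<xi>)))\<^sup>2) \<partial>count_space scale_indices)"
    "AE \<xi> in lborel. (\<integral>\<^sup>+p. ennreal ((norm (w (fst p) (B (fst p) (snd p) *v \<xi>)))\<^sup>2) \<partial>count_space scale_indices) \<le> ennreal b"
    and \<Theta>: "\<And>\<zeta>. AE \<xi> in lborel. (\<integral>\<^sup>+p. ennreal (norm (w (fst p) (B (fst p) (snd p) *v \<xi>)) *
          norm (w (fst p) (B (fst p) (snd p) *v \<xi> - \<zeta>))) \<partial>count_space scale_indices) \<le> \<Theta> \<zeta>"
    and \<Delta>: "(\<integral>\<^sup>+z. max (\<Theta> (transpose (matrix_inv P) *v z)) (\<Theta> (- (transpose (matrix_inv P) *v z))) \<partial>count_space (int_points - {0})) \<le> ennreal \<Delta>"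
  defines "X \<equiv> \<integral>\<^sup>+p. (\<integral>\<^sup>+z. ennreal ((norm (L2_inner f (\<lambda>x. of_real (\<kappa> (fst p)) * \<psi> (fst p) (D (fst p) (snd p) *v x - P *v z))))\<^sup>2)
      \<partial>count_space int_points) \<partial>count_space scale_indices"
  shows "ennreal \<bar>det P\<bar> * X \<le> (ennreal b + ennreal \<Delta>) * energy f"
    and "ennreal a * energy f \<le> ennreal \<bar>det P\<bar> * X + ennreal \<Delta> * energy f"
proof -
  let ?J = "count_space scale_indices" and ?Z = "count_space (int_points - {0::real^2})"
  define g where "g = fourier_L2 f"
  have g: "is_fourier_L2 f g" unfolding g_def by (rule is_fourier_L2_fourier_L2[OF f])
  then have gL: "g \<in> L2" by (simp add: is_fourier_L2_def)
  have wL: "w j \<in> L2" for j using \<psi>(2) by (simp add: is_fourier_L2_def)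
  have eg: "energy g = energy f"
    using is_fourier_L2_norm[OF f g] by (simp add: energy_eq_integral f gL)
  have [measurable]: "g \<in> borel_measurable borel" "w j \<in> borel_measurable borel" for j
    using gL wL by auto
  have gc: "(\<integral>\<^sup>+\<xi>. ennreal ((norm (g \<xi>))\<^sup>2) * c \<partial>lborel) = c * energy f" for c
    by (subst nn_integral_multc) (auto simp: eg mult.commute)
  define Q where "Q = transpose (matrix_inv P)"
  define T where "T p \<zeta> \<xi> = norm (w (fst p) (B (fst p) (snd p) *v \<xi>)) * norm (w (fst p) (B (fst p) (snd p) *v \<xi> - \<zeta>))" for p \<zeta> \<xi>
  have [measurable]: "T p \<zeta> \<in> borel_measurable borel" for p \<zeta> unfolding T_def by measurable
  have T0: "0 \<le> T p \<zeta> \<xi>" for p \<zeta> \<xi> by (simp add: T_def)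
  define C where "C p = (\<integral>\<^sup>+z. ennreal ((norm (L2_inner f (\<lambda>x. of_real (\<kappa> (fst p)) * \<psi> (fst p) (D (fst p) (snd p) *v x - P *v z))))\<^sup>2) \<partial>count_space int_points)" for p
  define S where "S p = (\<integral>\<^sup>+\<xi>. ennreal ((norm (g \<xi>))\<^sup>2) * ennreal ((norm (w (fst p) (B (fst p) (snd p) *v \<xi>)))\<^sup>2) \<partial>lborel)" for p
  define R where "R p = (\<integral>\<^sup>+z. (\<integral>\<^sup>+\<xi>. ennreal ((norm (g \<xi>))\<^sup>2) *
           ennreal ((T p (Q *v z) \<xi> + T p (- (Q *v z)) \<xi>) / 2) \<partial>lborel) \<partial>?Z)" for p
  have "(\<integral>\<^sup>+p. S p \<partial>?J) = (\<integral>\<^sup>+\<xi>. (\<integral>\<^sup>+p. ennreal ((norm (g \<xi>))\<^sup>2) * ennreal ((norm (w (fst p) (B (fst p) (snd p) *v \<xi>)))\<^sup>2) \<partial>?J) \<partial>lborel)"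
    unfolding S_def by (rule nn_integral_count_space_nn_integral[symmetric]) auto
  also have "\<dots> = (\<integral>\<^sup>+\<xi>. ennreal ((norm (g \<xi>))\<^sup>2) * (\<integral>\<^sup>+p. ennreal ((norm (w (fst p) (B (fst p) (snd p) *v \<xi>)))\<^sup>2) \<partial>?J) \<partial>lborel)"
    by (simp add: nn_integral_cmult)
  finally have SS: "(\<integral>\<^sup>+p. S p \<partial>?J) = (\<integral>\<^sup>+\<xi>. ennreal ((norm (g \<xi>))\<^sup>2) * (\<integral>\<^sup>+p. ennreal ((norm (w (fst p) (B (fst p) (snd p) *v \<xi>)))\<^sup>2) \<partial>?J) \<partial>lborel)" .
  have "(\<integral>\<^sup>+p. S p \<partial>?J) \<le> (\<integral>\<^sup>+\<xi>. ennreal ((norm (g \<xi>))\<^sup>2) * ennreal b \<partial>lborel)"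
    unfolding SS by (rule nn_integral_mono_AE) (use cover(2) in \<open>auto elim!: eventually_mono intro!: mult_left_mono\<close>)
  then have S_up: "(\<integral>\<^sup>+p. S p \<partial>?J) \<le> ennreal b * energy f"
    by (simp only: gc)
  have "(\<integral>\<^sup>+\<xi>. ennreal ((norm (g \<xi>))\<^sup>2) * ennreal a \<partial>lborel) \<le> (\<integral>\<^sup>+p. S p \<partial>?J)"
    unfolding SS by (rule nn_integral_mono_AE) (use cover(1) in \<open>auto elim!: eventually_mono intro!: mult_left_mono\<close>)
  then have S_low: "ennreal a * energy f \<le> (\<integral>\<^sup>+p. S p \<partial>?J)"
    by (simp only: gc)
  \<comment> \<open>The sum over scales goes inside the sum over the lattice, so that for each
    lattice vector the full correlation sum is formed and can be compared with
    \<open>\<Theta>\<close>.\<close>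
  have "(\<integral>\<^sup>+p. R p \<partial>?J) = (\<integral>\<^sup>+z. (\<integral>\<^sup>+p. (\<integral>\<^sup>+\<xi>. ennreal ((norm (g \<xi>))\<^sup>2) *
           ennreal ((T p (Q *v z) \<xi> + T p (- (Q *v z)) \<xi>) / 2) \<partial>lborel) \<partial>?J) \<partial>?Z)"
    unfolding R_def by (rule nn_integral_count_space_nn_integral) auto
  also have "\<dots> \<le> (\<integral>\<^sup>+z. energy f * max (\<Theta> (Q *v z)) (\<Theta> (- (Q *v z))) \<partial>?Z)"
  proof (rule nn_integral_mono)
    fix z :: "real^2"
    let ?m = "max (\<Theta> (Q *v z)) (\<Theta> (- (Q *v z)))"
    have "(\<integral>\<^sup>+p. (\<integral>\<^sup>+\<xi>. ennreal ((norm (g \<xi>))\<^sup>2) * ennreal ((T p (Q *v z) \<xi> + T p (- (Q *v z)) \<xi>) / 2) \<partial>lborel) \<partial>?J)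
      = (\<integral>\<^sup>+\<xi>. (\<integral>\<^sup>+p. ennreal ((norm (g \<xi>))\<^sup>2) * ennreal ((T p (Q *v z) \<xi> + T p (- (Q *v z)) \<xi>) / 2) \<partial>?J) \<partial>lborel)"
      by (rule nn_integral_count_space_nn_integral[symmetric]) auto
    also have "\<dots> \<le> (\<integral>\<^sup>+\<xi>. ennreal ((norm (g \<xi>))\<^sup>2) * ?m \<partial>lborel)"
    proof (rule nn_integral_mono_AE)
      \<comment> \<open>The exceptional null set may depend on the shift; for fixed \<open>z\<close>
        only the two shifts \<open>Q *v z\<close> and \<open>- (Q *v z)\<close> occur.\<close>
      show "AE \<xi> in lborel. (\<integral>\<^sup>+p. ennreal ((norm (g \<xi>))\<^sup>2) * ennreal ((T p (Q *v z) \<xi> + T p (- (Q *v z)) \<xi>) / 2) \<partial>?J)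
          \<le> ennreal ((norm (g \<xi>))\<^sup>2) * ?m"
        using \<Theta>[of "Q *v z", folded T_def] \<Theta>[of "- (Q *v z)", folded T_def]
      proof eventually_elim
        case (elim \<xi>)
        have "(\<integral>\<^sup>+p. ennreal ((T p (Q *v z) \<xi> + T p (- (Q *v z)) \<xi>) / 2) \<partial>?J)
          = (\<integral>\<^sup>+p. ennreal (1 / 2) * (ennreal (T p (Q *v z) \<xi>) + ennreal (T p (- (Q *v z)) \<xi>)) \<partial>?J)"
          by (intro nn_integral_cong ennreal_half_sum T0)
        also have "\<dots> = ennreal (1 / 2) * ((\<integral>\<^sup>+p. ennreal (T p (Q *v z) \<xi>) \<partial>?J) + (\<integral>\<^sup>+p. ennreal (T p (- (Q *v z)) \<xi>) \<partial>?J))"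
          by (subst nn_integral_cmult, simp, subst nn_integral_add) auto
        also have "\<dots> \<le> ennreal (1 / 2) * (?m + ?m)"
          using elim by (intro mult_left_mono add_mono) (auto intro: order_trans max.cobounded1 max.cobounded2)
        also have "\<dots> = (ennreal (1 / 2) + ennreal (1 / 2)) * ?m"
          by (simp only: distrib_left distrib_right)
        also have "ennreal (1 / 2) + ennreal (1 / 2) = 1"
          by (subst ennreal_plus[symmetric]) simp_all
        finally show ?case
          by (subst nn_integral_cmult) (auto intro: mult_left_mono)
      qed
    qed
    also have "\<dots> = energy f * ?m"
      by (simp only: gc mult.commute)
    finally show "(\<integral>\<^sup>+p. (\<integral>\<^sup>+\<xi>. ennreal ((norm (g \<xi>))\<^sup>2) * ennreal ((T p (Q *v z) \<xi> + T p (- (Q *v z)) \<xi>) / 2) \<partial>lborel) \<partial>?J)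
       \<le> energy f * ?m" .
  qed
  also have "\<dots> = energy f * (\<integral>\<^sup>+z. max (\<Theta> (Q *v z)) (\<Theta> (- (Q *v z))) \<partial>?Z)"
    by (rule nn_integral_cmult) simp
  also have "\<dots> \<le> energy f * ennreal \<Delta>"
    using \<Delta> unfolding Q_def by (rule mult_left_mono) simp
  finally have R_up: "(\<integral>\<^sup>+p. R p \<partial>?J) \<le> ennreal \<Delta> * energy f" by (simp add: mult.commute)
  have fe: "energy f < \<infinity>" using f by (simp add: L2_iff)
  \<comment> \<open>The single-scale estimate requires finite \<open>S p\<close> and
    \<open>R p\<close>; each is dominated by its total over all scales, which has just been
    bounded.\<close>
  have one: "ennreal \<bar>det P\<bar> * C p \<le> S p + R p \<and> S p \<le> ennreal \<bar>det P\<bar> * C p + R p" if p: "p \<in> scale_indices" for p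
  proof -
    have "S p \<le> (\<integral>\<^sup>+p. S p \<partial>?J)" "R p \<le> (\<integral>\<^sup>+p. R p \<partial>?J)"
      using p by (auto intro: nn_integral_ge_point)
    then have "S p \<le> ennreal b * energy f" "R p \<le> ennreal \<Delta> * energy f"
      using S_up R_up by (blast intro: order_trans)+
    moreover have "ennreal b * energy f < \<infinity>" "ennreal \<Delta> * energy f < \<infinity>"
      using fe by (simp_all add: ennreal_mult_less_top)
    ultimately have "S p < \<infinity>" "R p < \<infinity>"
      by (blast intro: le_less_trans)+
    then show ?thesis
      using wavepacket_coefficient_bounds[OF f g \<psi>(1)[of "fst p"] \<psi>(2)[of "fst p"]
          D[of "fst p" "snd p"] P \<kappa>(1)[of "fst p"] \<kappa>(2)[of "fst p" "snd p"]]
      unfolding C_def S_def R_def T_def B_def Q_def by blast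
  qed
  have X: "ennreal \<bar>det P\<bar> * X = (\<integral>\<^sup>+p. ennreal \<bar>det P\<bar> * C p \<partial>?J)"
    unfolding X_def C_def by (rule nn_integral_cmult[symmetric]) simp
  have "ennreal \<bar>det P\<bar> * X \<le> (\<integral>\<^sup>+p. S p + R p \<partial>?J)"
    unfolding X by (rule nn_integral_mono) (use one in auto)
  also have "\<dots> = (\<integral>\<^sup>+p. S p \<partial>?J) + (\<integral>\<^sup>+p. R p \<partial>?J)" by (rule nn_integral_add) auto
  also have "\<dots> \<le> ennreal b * energy f + ennreal \<Delta> * energy f" by (rule add_mono[OF S_up R_up])
  finally show "ennreal \<bar>det P\<bar> * X \<le> (ennreal b + ennreal \<Delta>) * energy f" by (simp only: distrib_right)
  have "ennreal a * energy f \<le> (\<integral>\<^sup>+p. S p \<partial>?J)" by (rule S_low)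
  also have "\<dots> \<le> (\<integral>\<^sup>+p. ennreal \<bar>det P\<bar> * C p + R p \<partial>?J)"
    by (rule nn_integral_mono) (use one in auto)
  also have "\<dots> = ennreal \<bar>det P\<bar> * X + (\<integral>\<^sup>+p. R p \<partial>?J)" unfolding X by (rule nn_integral_add) auto
  also have "\<dots> \<le> ennreal \<bar>det P\<bar> * X + ennreal \<Delta> * energy f" by (rule add_left_mono[OF R_up])
  finally show "ennreal a * energy f \<le> ennreal \<bar>det P\<bar> * X + ennreal \<Delta> * energy f" .
qed

section \<open>Specialization to the wavepacket family\<close>

lemma det_A_mat: "det (A_mat j k) = 8 ^ j"
proof -
  have "det (dil j) = 8 ^ j"
    by (simp add: dil_def det_2 flip: power_mult_distrib)
  moreover have "det (rot \<theta>) = 1" for \<theta>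
    using sin_cos_squared_add2[of \<theta>] by (simp add: rot_def det_2 power2_eq_square)
  ultimately show ?thesis by (simp add: A_mat_def det_mul)
qed

lemma A_mat_0: "A_mat 0 0 = mat 1"
  by (simp add: A_mat_def dil_def rot_def vec_eq_iff forall_2 matrix_matrix_mult_def sum_2 mat_def)

lemma B_mat_0: "B_mat 0 0 = mat 1"
proof -
  have "mat 1 ** matrix_inv (mat 1 :: real^2^2) = mat 1"
    by (rule matrix_inv_inverse) (auto simp: invertible_def)
  then show ?thesis by (simp add: B_mat_def A_mat_0 transpose_mat)
qed

definition window :: "(real^2 \<Rightarrow> complex) \<Rightarrow> (real^2 \<Rightarrow> complex) \<Rightarrow> nat \<Rightarrow> real^2 \<Rightarrow> complex" where
  "window \<phi>0 \<phi> j = (if j = 0 then \<phi>0 else \<phi>)"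

lemma covering_sum_eq:
  "covering_sum \<phi>0 \<phi> \<xi> = (\<integral>\<^sup>+p. ennreal ((norm (fourier_L2 (window \<phi>0 \<phi> (fst p)) (B_mat (fst p) (snd p) *v \<xi>)))\<^sup>2)
     \<partial>count_space scale_indices)"
  unfolding nn_integral_scale_indices[of "\<lambda>j k. ennreal ((norm (fourier_L2 (window \<phi>0 \<phi> j) (B_mat j k *v \<xi>)))\<^sup>2)"]
    covering_sum_def
  by (intro arg_cong2[where f="(+)"] infsum_cong) (auto simp: window_def B_mat_0)

lemma AE_Theta:
  "AE \<xi> in lborel. (\<integral>\<^sup>+p. ennreal (norm (fourier_L2 (window \<phi>0 \<phi> (fst p)) (B_mat (fst p) (snd p) *v \<xi>)) *
      norm (fourier_L2 (window \<phi>0 \<phi> (fst p)) (B_mat (fst p) (snd p) *v \<xi> - \<zeta>))) \<partial>count_space scale_indices)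
    \<le> Theta \<phi>0 \<phi> \<zeta>"
proof -
  have eq: "(\<integral>\<^sup>+p. ennreal (norm (fourier_L2 (window \<phi>0 \<phi> (fst p)) (B_mat (fst p) (snd p) *v \<xi>)) *
      norm (fourier_L2 (window \<phi>0 \<phi> (fst p)) (B_mat (fst p) (snd p) *v \<xi> - \<zeta>))) \<partial>count_space scale_indices)
    = ennreal (norm (fourier_L2 \<phi>0 \<xi>) * norm (fourier_L2 \<phi>0 (\<xi> - \<zeta>))) +
     (\<Sum>\<^sub>\<infinity>j\<in>{1..}. \<Sum>k<2 ^ j.
        ennreal (norm (fourier_L2 \<phi> (B_mat j k *v \<xi>)) * norm (fourier_L2 \<phi> (B_mat j k *v \<xi> - \<zeta>))))" for \<xi>
    unfolding nn_integral_scale_indices[of "\<lambda>j k. ennreal (norm (fourier_L2 (window \<phi>0 \<phi> j) (B_mat j k *v \<xi>)) *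
      norm (fourier_L2 (window \<phi>0 \<phi> j) (B_mat j k *v \<xi> - \<zeta>)))"]
    by (intro arg_cong2[where f="(+)"] infsum_cong) (auto simp: window_def B_mat_0)
  show ?thesis
    unfolding eq Theta_def by (rule esssup_AE)
qed

lemma invertible_vec_inj:
  fixes M :: "real^'n^'n"
  assumes "invertible M"
  shows "M *v x = M *v y \<longleftrightarrow> x = y"
  by (metis assms matrix_inv_inverse(2) matrix_vector_mul_assoc matrix_vector_mul_lid)

text \<open>Dual lattice vectors are parametrized by integer points through the inverse transpose of
  \<open>P\<close>; invertibility makes this one-to-one and matches 0 with 0, so the excluded terms
  agree.\<close>

lemma Delta_eq:
  assumes P: "invertible P"
  shows "Delta \<phi>0 \<phi> (dual_lattice_of P) = (\<integral>\<^sup>+z. max (Theta \<phi>0 \<phi> (transpose (matrix_inv P) *v z))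
     (Theta \<phi>0 \<phi> (- (transpose (matrix_inv P) *v z))) \<partial>count_space (int_points - {0}))"
proof -
  let ?Q = "transpose (matrix_inv P)"
  have "invertible (matrix_inv P)"
    using matrix_inv_inverse[OF P] unfolding invertible_def by blast
  then have Q: "invertible ?Q" by (rule transpose_invertible)
  have \<Gamma>: "dual_lattice_of P = (\<lambda>z. ?Q *v z) ` int_points"
    by (simp add: dual_lattice_of_def lattice_of_def int_points_def)
  have bij: "bij_betw (\<lambda>z. ?Q *v z) (int_points - {0}) (dual_lattice_of P - {0})"
    unfolding bij_betw_def \<Gamma>
    using invertible_vec_inj[OF Q] invertible_vec_inj[OF Q, of _ 0] by (auto simp: inj_on_def)
  have "countable (dual_lattice_of P - {0})" unfolding \<Gamma> by auto
  then have "Delta \<phi>0 \<phi> (dual_lattice_of P)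
      = (\<integral>\<^sup>+\<gamma>. max (Theta \<phi>0 \<phi> \<gamma>) (Theta \<phi>0 \<phi> (- \<gamma>)) \<partial>count_space (dual_lattice_of P - {0}))"
    unfolding Delta_def by (rule infsum_ennreal_eq_nn_integral)
  also have "\<dots> = (\<integral>\<^sup>+z. max (Theta \<phi>0 \<phi> (?Q *v z)) (Theta \<phi>0 \<phi> (- (?Q *v z))) \<partial>count_space (int_points - {0}))"
    by (rule nn_integral_bij_count_space[OF bij, symmetric])
  finally show ?thesis .
qed

definition wp_index_of :: "real^2^2 \<Rightarrow> (nat \<times> nat) \<times> (real^2) \<Rightarrow> wp_index" where
  "wp_index_of P = (\<lambda>((j, k), z). if j = 0 then Inl (P *v z) else Inr (j, k, P *v z))"

text \<open>Distinct integer points give distinct lattice points because \<open>P\<close> is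
  invertible. At level 0 the index \<open>Inl\<close> forgets \<open>k\<close>, which is harmless
  since \<open>k\<close> can only be 0 there.\<close>

lemma bij_betw_wp_index_of:
  assumes P: "invertible P"
  shows "bij_betw (wp_index_of P) (scale_indices \<times> int_points) (wavepacket_indices (lattice_of P))"
proof -
  have \<Lambda>: "lattice_of P = (\<lambda>z. P *v z) ` int_points"
    by (simp add: lattice_of_def int_points_def)
  have "inj_on (wp_index_of P) (scale_indices \<times> int_points)"
    using invertible_vec_inj[OF P]
    by (auto simp: inj_on_def wp_index_of_def scale_indices_def split: if_splits)
  moreover have "wp_index_of P ` (scale_indices \<times> int_points) = wavepacket_indices (lattice_of P)"
  proof (intro equalityI subsetI)
    fix i assume "i \<in> wp_index_of P ` (scale_indices \<times> int_points)"
    then show "i \<in> wavepacket_indices (lattice_of P)"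
      by (auto simp: wp_index_of_def wavepacket_indices_def \<Lambda> scale_indices_def split: if_splits)
  next
    fix i assume "i \<in> wavepacket_indices (lattice_of P)"
    then consider z where "i = Inl (P *v z)" "z \<in> int_points"
      | j k z where "i = Inr (j, k, P *v z)" "1 \<le> j" "k < 2 ^ j" "z \<in> int_points"
      by (auto simp: wavepacket_indices_def \<Lambda>)
    then show "i \<in> wp_index_of P ` (scale_indices \<times> int_points)"
    proof cases
      case 1
      then show ?thesis
        by (intro image_eqI[where x="((0, 0), z)"]) (auto simp: wp_index_of_def scale_indices_def)
    next
      case 2
      then show ?thesis
        by (intro image_eqI[where x="((j, k), z)"]) (auto simp: wp_index_of_def scale_indices_def)
    qed
  qed
  ultimately show ?thesis by (simp add: bij_betw_def)
qed

lemma wavepacket_wp_index_of: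
  assumes "(j, k) \<in> scale_indices"
  shows "wavepacket \<phi>0 \<phi> (wp_index_of P ((j, k), z))
    = (\<lambda>x. of_real (8 powr (real j / 2)) * window \<phi>0 \<phi> j (A_mat j k *v x - P *v z))"
  using assms by (auto simp: wavepacket_def wp_index_of_def window_def scale_indices_def A_mat_0)

lemma nn_integral_wavepacket_indices:
  assumes P: "invertible P"
  shows "(\<integral>\<^sup>+i. F (wavepacket \<phi>0 \<phi> i) \<partial>count_space (wavepacket_indices (lattice_of P)))
    = (\<integral>\<^sup>+p. (\<integral>\<^sup>+z. F (\<lambda>x. of_real (8 powr (real (fst p) / 2)) * window \<phi>0 \<phi> (fst p) (A_mat (fst p) (snd p) *v x - P *v z))
        \<partial>count_space int_points) \<partial>count_space scale_indices)"
proof -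
  interpret Z: sigma_finite_measure "count_space (int_points :: (real^2) set)"
    by (rule sigma_finite_measure_count_space_countable) simp
  have "(\<integral>\<^sup>+i. F (wavepacket \<phi>0 \<phi> i) \<partial>count_space (wavepacket_indices (lattice_of P)))
     = (\<integral>\<^sup>+q. F (wavepacket \<phi>0 \<phi> (wp_index_of P q)) \<partial>count_space (scale_indices \<times> int_points))"
    by (rule nn_integral_bij_count_space[OF bij_betw_wp_index_of[OF P], symmetric])
  also have "\<dots> = (\<integral>\<^sup>+q. F (wavepacket \<phi>0 \<phi> (wp_index_of P q)) \<partial>(count_space scale_indices \<Otimes>\<^sub>M count_space int_points))"
    by (simp add: pair_measure_countable)
  also have "\<dots> = (\<integral>\<^sup>+p. (\<integral>\<^sup>+z. F (wavepacket \<phi>0 \<phi> (wp_index_of P (p, z))) \<partial>count_space int_points) \<partial>count_space scale_indices)"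
    by (rule Z.nn_integral_fst[symmetric]) (simp add: pair_measure_countable)
  also have "\<dots> = (\<integral>\<^sup>+p. (\<integral>\<^sup>+z. F (\<lambda>x. of_real (8 powr (real (fst p) / 2)) * window \<phi>0 \<phi> (fst p) (A_mat (fst p) (snd p) *v x - P *v z))
        \<partial>count_space int_points) \<partial>count_space scale_indices)"
  proof (intro nn_integral_cong)
    fix p z assume "p \<in> space (count_space scale_indices)"
    then show "F (wavepacket \<phi>0 \<phi> (wp_index_of P (p, z)))
      = F (\<lambda>x. of_real (8 powr (real (fst p) / 2)) * window \<phi>0 \<phi> (fst p) (A_mat (fst p) (snd p) *v x - P *v z))"
      using wavepacket_wp_index_of[of "fst p" "snd p"] by simp
  qed
  finally show ?thesis .
qed

theorem theorem3p3:
  fixes \<phi>0 \<phi> :: "real^2 \<Rightarrow> complex"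
    and A B \<delta> \<sigma> :: real
    and P :: "real^2^2"
    and \<Lambda> \<Gamma> :: "(real^2) set"
  assumes "\<phi>0 \<in> L2" and "\<phi> \<in> L2"
    and "0 < A" and "A \<le> B"
    and "AE \<xi> in lborel. ennreal A \<le> covering_sum \<phi>0 \<phi> \<xi> \<and> covering_sum \<phi>0 \<phi> \<xi> \<le> ennreal B"
    and "\<delta> > 0" and "\<sigma> > 2"
    and "\<exists>c>0. AE \<xi> in lborel. norm (fourier_L2 \<phi>0 \<xi>) \<le> c * exp (- \<delta> * (norm \<xi>)\<^sup>2)"
    and "\<exists>c>0. AE \<xi> in lborel.
           norm (fourier_L2 \<phi> \<xi>) \<le> c * (min 1 (\<bar>\<xi> $ 1\<bar> powr \<sigma>) * exp (- \<delta> * (norm \<xi>)\<^sup>2))"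
    and "invertible P" and "\<Lambda> = lattice_of P" and "\<Gamma> = dual_lattice_of P"
    and "Delta \<phi>0 \<phi> \<Gamma> < ennreal A"
  shows "frame_with_bounds (wavepacket_indices \<Lambda>) (wavepacket \<phi>0 \<phi>)
           ((A - enn2real (Delta \<phi>0 \<phi> \<Gamma>)) / \<bar>det P\<bar>)
           ((B + enn2real (Delta \<phi>0 \<phi> \<Gamma>)) / \<bar>det P\<bar>)"
proof -
  note P = \<open>invertible P\<close>
  define \<Delta> where "\<Delta> = enn2real (Delta \<phi>0 \<phi> \<Gamma>)"
  define I where "I = wavepacket_indices \<Lambda>"
  \<comment> \<open>Being below the real number \<open>A\<close>, the sum is finite, so
    \<open>enn2real\<close> loses nothing; at infinity it would return 0.\<close>
  have D: "Delta \<phi>0 \<phi> \<Gamma> = ennreal \<Delta>"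
    using assms(13) unfolding \<Delta>_def by (metis ennreal_enn2real ennreal_less_top less_trans)
  have \<Delta>: "0 \<le> \<Delta>" "\<Delta> < A"
    using assms(13) \<open>0 < A\<close> unfolding D by (simp_all add: \<Delta>_def ennreal_less_iff)
  have dP: "\<bar>det P\<bar> > 0" using P invertible_det_nz by auto
  have win: "window \<phi>0 \<phi> j \<in> L2" for j using assms(1,2) by (simp add: window_def)
  have inv: "invertible (A_mat j k)" for j k by (simp add: invertible_det_nz det_A_mat)
  have I_eq: "I = wp_index_of P ` (scale_indices \<times> int_points)"
    using bij_betw_wp_index_of[OF P] assms(11) by (simp add: I_def bij_betw_def)
  have cI: "countable I" unfolding I_eq by (intro countable_image countable_SIGMA) auto
  have eL2: "wavepacket \<phi>0 \<phi> i \<in> L2" if i: "i \<in> I" for i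
  proof -
    obtain j k z where "i = wp_index_of P ((j, k), z)" "(j, k) \<in> scale_indices"
      using i unfolding I_eq by auto
    then show ?thesis
      using L2_cmult[OF L2_affine[OF inv win]] by (simp add: wavepacket_wp_index_of)
  qed
  have fr: "(\<lambda>i. (norm (L2_inner f (wavepacket \<phi>0 \<phi> i)))\<^sup>2) summable_on I \<and>
        (A - \<Delta>) / \<bar>det P\<bar> * (L2_norm f)\<^sup>2 \<le> (\<Sum>\<^sub>\<infinity>i\<in>I. (norm (L2_inner f (wavepacket \<phi>0 \<phi> i)))\<^sup>2) \<and>
        (\<Sum>\<^sub>\<infinity>i\<in>I. (norm (L2_inner f (wavepacket \<phi>0 \<phi> i)))\<^sup>2) \<le> (B + \<Delta>) / \<bar>det P\<bar> * (L2_norm f)\<^sup>2"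
    if f: "f \<in> L2" for f
  proof -
    define N where "N = (L2_norm f)\<^sup>2"
    have N: "energy f = ennreal N" "0 \<le> N"
      using energy_eq_integral[OF f] by (simp_all add: N_def L2_norm_square)
    define X where "X = (\<integral>\<^sup>+i. ennreal ((norm (L2_inner f (wavepacket \<phi>0 \<phi> i)))\<^sup>2) \<partial>count_space I)"
    have X: "X = (\<integral>\<^sup>+p. (\<integral>\<^sup>+z. ennreal ((norm (L2_inner f (\<lambda>x. of_real (8 powr (real (fst p) / 2)) *
        window \<phi>0 \<phi> (fst p) (A_mat (fst p) (snd p) *v x - P *v z))))\<^sup>2) \<partial>count_space int_points) \<partial>count_space scale_indices)"
      unfolding X_def I_def assms(11)
      by (rule nn_integral_wavepacket_indices[OF P, of "\<lambda>e. ennreal ((norm (L2_inner f e))\<^sup>2)"])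
    have \<kappa>: "(8 powr (real j / 2))\<^sup>2 = \<bar>det (A_mat j k)\<bar>" for j k
      by (simp add: det_A_mat power2_eq_square powr_add[symmetric] powr_realpow)
    have "AE \<xi> in lborel. ennreal A \<le> covering_sum \<phi>0 \<phi> \<xi>" "AE \<xi> in lborel. covering_sum \<phi>0 \<phi> \<xi> \<le> ennreal B"
      using assms(5) by auto
    note cover = this[unfolded covering_sum_eq B_mat_def]
    have "(\<integral>\<^sup>+z. max (Theta \<phi>0 \<phi> (transpose (matrix_inv P) *v z))
       (Theta \<phi>0 \<phi> (- (transpose (matrix_inv P) *v z))) \<partial>count_space (int_points - {0})) \<le> ennreal \<Delta>"
      using D by (simp add: assms(12) Delta_eq[OF P])
    note bounds = frame_sum_bounds[OF f win is_fourier_L2_fourier_L2[OF win] inv P _ \<kappa> cover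
        AE_Theta[unfolded B_mat_def] this, folded X, unfolded N(1)]
    have up: "ennreal \<bar>det P\<bar> * X \<le> (ennreal B + ennreal \<Delta>) * ennreal N"
      and low: "ennreal A * ennreal N \<le> ennreal \<bar>det P\<bar> * X + ennreal \<Delta> * ennreal N"
      using bounds by simp_all
    \<comment> \<open>The upper bound is used first for finiteness: it yields summability of the
      squared coefficients, after which both inequalities can be read in the reals.\<close>
    have "ennreal \<bar>det P\<bar> * X < \<infinity>"
      using up by (rule le_less_trans) (simp add: ennreal_mult_less_top)
    then have "X < \<infinity>"
      using dP by (auto simp: ennreal_mult_less_top)
    note s = summable_on_of_nn_integral[OF cI _ this[unfolded X_def]]
    define s where "s = (\<Sum>\<^sub>\<infinity>i\<in>I. (norm (L2_inner f (wavepacket \<phi>0 \<phi> i)))\<^sup>2)"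
    have s0: "0 \<le> s" unfolding s_def by (intro infsum_nonneg) simp
    have sX: "X = ennreal s" using s(2) by (simp add: s_def X_def)
    have "ennreal (\<bar>det P\<bar> * s) \<le> ennreal ((B + \<Delta>) * N)"
      using up s0 N(2) \<Delta>(1) assms(3,4) unfolding sX
      by (simp add: ennreal_mult ennreal_plus)
    then have 1: "\<bar>det P\<bar> * s \<le> (B + \<Delta>) * N"
      using N(2) \<Delta>(1) assms(3,4) by (subst (asm) ennreal_le_iff) auto
    have "ennreal (A * N) \<le> ennreal (\<bar>det P\<bar> * s + \<Delta> * N)"
      using low s0 N(2) \<Delta>(1) assms(3,4) unfolding sX
      by (simp add: ennreal_mult ennreal_plus)
    then have 2: "A * N \<le> \<bar>det P\<bar> * s + \<Delta> * N"
      using N(2) \<Delta>(1) s0 by (subst (asm) ennreal_le_iff) auto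
    have "(A - \<Delta>) / \<bar>det P\<bar> * N \<le> s" "s \<le> (B + \<Delta>) / \<bar>det P\<bar> * N"
      using 1 2 dP by (simp_all add: field_simps)
    then show ?thesis
      using s(1) by (simp add: s_def N_def)
  qed
  have "0 < (A - \<Delta>) / \<bar>det P\<bar>" "0 < (B + \<Delta>) / \<bar>det P\<bar>"
    using \<Delta> dP assms(3,4) by simp_all
  then show ?thesis
    using eL2 fr unfolding frame_with_bounds_def I_def \<Delta>_def by blast
qed

end
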